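(* Fix $\ell\in\{0,1,2\}$ and suppose the coefficients of a power series $$u(x)=\sum_{k=1}^3\sum_{j=0}^\infty c_{jk}P^{(\ell)}_{jk}(x)$$ about the boundary point $q_\ell$ satisfy $$|c_{jk}|=O(R^j)\ \text{for some } R<\lambda_2,\quad k=1,2,3.$$ Then the function $u$ may also be represented by power series about the other two boundary points, with coefficients also satisfying $|c'_{jk}|=O(R'^j)$ for some $R'<\lambda_2$, $k=1,2,3$. More precisely, the coefficients $c'_{j'k}$ at $q_{\ell+1}$ are given by $$(c'_{j'1},\ c'_{j'2},\ c'_{j'3})=\sum_{j=0}^\infty(c_{(j+j')1},\ c_{(j+j')2},\ c_{(j+j')3})\,M_j,$$ and the coefficients at $q_{\ell-1}$ are given by the same formula with $M_j$ replaced by $\widetilde M_j$.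
   Context: Let $q_0,q_1,q_2$ be the vertices of an equilateral triangle in the plane (indices mod 3), $F_i(x)=\frac12(x+q_i)$, and let $SG$ (Sierpinski gasket) be the unique nonempty compact set with $SG=\bigcup_{i=0}^2F_i(SG)$. For a word $w=(w_1,\dots,w_m)\in\{0,1,2\}^m$, $|w|=m$, put $F_w=F_{w_1}\circ\cdots\circ F_{w_m}$. $V_0=\{q_0,q_1,q_2\}$, $V_m=\bigcup_iF_i(V_{m-1})$, $V_*=\bigcup_mV_m$; for distinct $x,y\in V_m$, $x\sim_my$ means $x,y$ lie in a common set $F_w(SG)$ with $|w|=m$. Laplacian: $u\in\mathrm{dom}\,\Delta$ with $\Delta u=f$ means that $u,f$ are continuous on $SG$ and $\frac32 5^m\sum_{y\sim_mx}(u(y)-u(x))\to f(x)$ as $m\to\infty$, uniformly for $x\in V_*\setminus V_0$. Powers $\Delta^n$ are defined iteratively. Normal derivative: $\partial_nu(q_j)=\lim_{m\to\infty}(5/3)^m\big(2u(q_j)-u(F_j^mq_{j+1})-u(F_j^mq_{j-1})\big)$. Tangential derivative: $\partial_Tu(q_j)=\lim_{m\to\infty}5^m\big(u(F_j^mq_{j+1})-u(F_j^mq_{j-1})\big)$. $\mathcal H_j$ is the $(3j+3)$-dimensional space of solutions of $\Delta^{j+1}u=0$ on $SG$. The monomial $P^{(\ell)}_{jk}$ ($k=1,2,3$, $j\ge0$) is the unique function in $\mathcal H_j$ such that for all $0\le m\le j$: $\Delta^mP^{(\ell)}_{jk}(q_\ell)=\delta_{mj}\delta_{k1}$, $\partial_n\Delta^mP^{(\ell)}_{jk}(q_\ell)=\delta_{mj}\delta_{k2}$,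 $\partial_T\Delta^mP^{(\ell)}_{jk}(q_\ell)=\delta_{mj}\delta_{k3}$. Constants: $\alpha_j=P^{(0)}_{j1}(q_1)$, $\beta_j=P^{(0)}_{j2}(q_1)$, $n_j=\partial_nP^{(0)}_{j1}(q_1)$, $t_j=\partial_TP^{(0)}_{j2}(q_1)$. Matrices: $$M_0=\begin{pmatrix}\alpha_0&n_0&0\\ \beta_0&\frac12-\alpha_0&t_0\\ 3\alpha_1&3n_1&-\frac12\end{pmatrix},\quad M_1=\begin{pmatrix}\alpha_1&n_1&\frac16\\ \beta_1&-\alpha_1&t_1\\ 3\alpha_2&3n_2&0\end{pmatrix},\quad M_j=\begin{pmatrix}\alpha_j&n_j&0\\ \beta_j&-\alpha_j&t_j\\ 3\alpha_{j+1}&3n_{j+1}&0\end{pmatrix}\ (j\ge2),$$ $$\widetilde M_0=\begin{pmatrix}\alpha_0&n_0&0\\ \beta_0&\frac12-\alpha_0&-t_0\\ -3\alpha_1&-3n_1&-\frac12\end{pmatrix},\quad \widetilde M_1=\begin{pmatrix}\alpha_1&n_1&-\frac16\\ \beta_1&-\alpha_1&-t_1\\ -3\alpha_2&-3n_2&0\end{pmatrix},\quad \widetilde M_j=\begin{pmatrix}\alpha_j&n_j&0\\ \beta_j&-\alpha_j&-t_j\\ -3\alpha_{j+1}&-3n_{j+1}&0\end{pmatrix}\ (j\ge2).$$ A Neumann eigenvalue is a $\lambda$ for which there is a nonzero $u\in\mathrm{dom}\,\Delta$ with $-\Delta u=\lambda u$ and $\partial_nu(q_i)=0$ for $i=0,1,2$.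 $\lambda_2\approx135.572126995788$ denotes the second nonzero Neumann eigenvalue (distinct eigenvalues in increasing order, not counting multiplicity). *)

theory Defs
  imports "HOL-Analysis.Analysis" "HOL-Library.Landau_Symbols"
begin

text \<open>
  Boundary indices live in the numeral type \<^typ>\<open>3\<close>, whose arithmetic is modulo 3, so
  \<open>q (j + 1)\<close> and \<open>q (j - 1)\<close> are the cyclic neighbours of \<open>q j\<close>. The index \<open>k = 1, 2, 3\<close> of the
  monomials and of coefficient vectors in \<^typ>\<open>real^3\<close> also ranges over \<^typ>\<open>3\<close>, following the
  library's convention for vector components; there \<open>3\<close> is the same element as \<open>0\<close>.

  Functions on the gasket are total functions on the plane of which only the values on the gasket
  matter. Where a unique function is selected, it is normalised to be \<^const>\<open>extensional\<close>.
\<close>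

definition equilateral :: "(3 \<Rightarrow> real^2) \<Rightarrow> bool" where
  "equilateral q \<longleftrightarrow> (\<exists>s>0. \<forall>i j. i \<noteq> j \<longrightarrow> dist (q i) (q j) = s)"

definition sg_map :: "(3 \<Rightarrow> real^2) \<Rightarrow> 3 \<Rightarrow> real^2 \<Rightarrow> real^2" where
  "sg_map q i x = (1/2) *\<^sub>R (x + q i)"

definition SG :: "(3 \<Rightarrow> real^2) \<Rightarrow> (real^2) set" where
  "SG q = (THE K. compact K \<and> K \<noteq> {} \<and> K = (\<Union>i. sg_map q i ` K))"

definition sg_word_map :: "(3 \<Rightarrow> real^2) \<Rightarrow> 3 list \<Rightarrow> real^2 \<Rightarrow> real^2" where
  "sg_word_map q w = foldr (sg_map q) w"

primrec vertices :: "(3 \<Rightarrow> real^2) \<Rightarrow> nat \<Rightarrow> (real^2) set" where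
  "vertices q 0 = range q"
| "vertices q (Suc m) = (\<Union>i. sg_map q i ` vertices q m)"

definition sg_adj :: "(3 \<Rightarrow> real^2) \<Rightarrow> nat \<Rightarrow> real^2 \<Rightarrow> real^2 \<Rightarrow> bool" where
  "sg_adj q m x y \<longleftrightarrow> x \<in> vertices q m \<and> y \<in> vertices q m \<and> x \<noteq> y \<and>
     (\<exists>w. length w = m \<and> x \<in> sg_word_map q w ` SG q \<and> y \<in> sg_word_map q w ` SG q)"

text \<open>
  The level \<open>m\<close> difference quotient makes sense only at points of \<^term>\<open>vertices q m\<close>, so uniform
  convergence on all non-boundary vertices means that at level \<open>m\<close> the error is small simultaneously
  at all points of \<^term>\<open>vertices q m - vertices q 0\<close>.
\<close>

definition has_laplacian :: "(3 \<Rightarrow> real^2) \<Rightarrow> (real^2 \<Rightarrow> real) \<Rightarrow> (real^2 \<Rightarrow> real) \<Rightarrow> bool" where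
  "has_laplacian q u f \<longleftrightarrow> continuous_on (SG q) u \<and> continuous_on (SG q) f \<and>
     (\<forall>\<epsilon>>0. \<exists>N. \<forall>m\<ge>N. \<forall>x \<in> vertices q m - vertices q 0.
        \<bar>3/2 * 5^m * (\<Sum>y | sg_adj q m x y. u y - u x) - f x\<bar> < \<epsilon>)"

definition dom_laplacian :: "(3 \<Rightarrow> real^2) \<Rightarrow> (real^2 \<Rightarrow> real) set" where
  "dom_laplacian q = {u. \<exists>f. has_laplacian q u f}"

definition laplacian :: "(3 \<Rightarrow> real^2) \<Rightarrow> (real^2 \<Rightarrow> real) \<Rightarrow> real^2 \<Rightarrow> real" where
  "laplacian q u = (THE f. f \<in> extensional (SG q) \<and> has_laplacian q u f)"

definition has_normal_deriv :: "(3 \<Rightarrow> real^2) \<Rightarrow> (real^2 \<Rightarrow> real) \<Rightarrow> 3 \<Rightarrow> real \<Rightarrow> bool" where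
  "has_normal_deriv q u j d \<longleftrightarrow>
     (\<lambda>m. (5/3)^m * (2 * u (q j) - u ((sg_map q j ^^ m) (q (j + 1)))
                               - u ((sg_map q j ^^ m) (q (j - 1))))) \<longlonglongrightarrow> d"

definition has_tangential_deriv :: "(3 \<Rightarrow> real^2) \<Rightarrow> (real^2 \<Rightarrow> real) \<Rightarrow> 3 \<Rightarrow> real \<Rightarrow> bool" where
  "has_tangential_deriv q u j d \<longleftrightarrow>
     (\<lambda>m. 5^m * (u ((sg_map q j ^^ m) (q (j + 1))) - u ((sg_map q j ^^ m) (q (j - 1))))) \<longlonglongrightarrow> d"

definition normal_deriv :: "(3 \<Rightarrow> real^2) \<Rightarrow> (real^2 \<Rightarrow> real) \<Rightarrow> 3 \<Rightarrow> real" where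
  "normal_deriv q u j = (THE d. has_normal_deriv q u j d)"

definition tangential_deriv :: "(3 \<Rightarrow> real^2) \<Rightarrow> (real^2 \<Rightarrow> real) \<Rightarrow> 3 \<Rightarrow> real" where
  "tangential_deriv q u j = (THE d. has_tangential_deriv q u j d)"

definition multiharmonic :: "(3 \<Rightarrow> real^2) \<Rightarrow> nat \<Rightarrow> (real^2 \<Rightarrow> real) set" where
  "multiharmonic q j = {u. (\<forall>m\<le>j. (laplacian q ^^ m) u \<in> dom_laplacian q) \<and>
                           (\<forall>x\<in>SG q. (laplacian q ^^ (j + 1)) u x = 0)}"

definition monomial :: "(3 \<Rightarrow> real^2) \<Rightarrow> 3 \<Rightarrow> nat \<Rightarrow> 3 \<Rightarrow> real^2 \<Rightarrow> real" where
  "monomial q l j k = (THE P. P \<in> extensional (SG q) \<and> P \<in> multiharmonic q j \<and>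
     (\<forall>m\<le>j. (laplacian q ^^ m) P (q l) = of_bool (m = j \<and> k = 1) \<and>
             has_normal_deriv q ((laplacian q ^^ m) P) l (of_bool (m = j \<and> k = 2)) \<and>
             has_tangential_deriv q ((laplacian q ^^ m) P) l (of_bool (m = j \<and> k = 3))))"

definition alpha :: "(3 \<Rightarrow> real^2) \<Rightarrow> nat \<Rightarrow> real" where
  "alpha q j = monomial q 0 j 1 (q 1)"

definition beta :: "(3 \<Rightarrow> real^2) \<Rightarrow> nat \<Rightarrow> real" where
  "beta q j = monomial q 0 j 2 (q 1)"

definition ncoef :: "(3 \<Rightarrow> real^2) \<Rightarrow> nat \<Rightarrow> real" where
  "ncoef q j = normal_deriv q (monomial q 0 j 1) 1"

definition tcoef :: "(3 \<Rightarrow> real^2) \<Rightarrow> nat \<Rightarrow> real" where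
  "tcoef q j = tangential_deriv q (monomial q 0 j 2) 1"

definition Mmat :: "(3 \<Rightarrow> real^2) \<Rightarrow> nat \<Rightarrow> real^3^3" where
  "Mmat q j =
    (if j = 0 then vector
       [vector [alpha q 0, ncoef q 0, 0],
        vector [beta q 0, 1/2 - alpha q 0, tcoef q 0],
        vector [3 * alpha q 1, 3 * ncoef q 1, - (1/2)]]
     else if j = 1 then vector
       [vector [alpha q 1, ncoef q 1, 1/6],
        vector [beta q 1, - alpha q 1, tcoef q 1],
        vector [3 * alpha q 2, 3 * ncoef q 2, 0]]
     else vector
       [vector [alpha q j, ncoef q j, 0],
        vector [beta q j, - alpha q j, tcoef q j],
        vector [3 * alpha q (j + 1), 3 * ncoef q (j + 1), 0]])"

definition Mtilde :: "(3 \<Rightarrow> real^2) \<Rightarrow> nat \<Rightarrow> real^3^3" where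
  "Mtilde q j =
    (if j = 0 then vector
       [vector [alpha q 0, ncoef q 0, 0],
        vector [beta q 0, 1/2 - alpha q 0, - tcoef q 0],
        vector [- (3 * alpha q 1), - (3 * ncoef q 1), - (1/2)]]
     else if j = 1 then vector
       [vector [alpha q 1, ncoef q 1, - (1/6)],
        vector [beta q 1, - alpha q 1, - tcoef q 1],
        vector [- (3 * alpha q 2), - (3 * ncoef q 2), 0]]
     else vector
       [vector [alpha q j, ncoef q j, 0],
        vector [beta q j, - alpha q j, - tcoef q j],
        vector [- (3 * alpha q (j + 1)), - (3 * ncoef q (j + 1)), 0]])"

definition neumann_eigenvalue :: "(3 \<Rightarrow> real^2) \<Rightarrow> real \<Rightarrow> bool" where
  "neumann_eigenvalue q \<mu> \<longleftrightarrow>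
     (\<exists>u\<in>dom_laplacian q. (\<exists>x\<in>SG q. u x \<noteq> 0) \<and> (\<forall>x\<in>SG q. - laplacian q u x = \<mu> * u x) \<and>
        (\<forall>i. has_normal_deriv q u i 0))"

text \<open>
  The second nonzero eigenvalue is the nonzero eigenvalue with exactly one nonzero eigenvalue below
  it; numerically it is about 135.572126995788.
\<close>

definition lambda2 :: "(3 \<Rightarrow> real^2) \<Rightarrow> real" where
  "lambda2 q = (THE r. neumann_eigenvalue q r \<and> r \<noteq> 0 \<and>
                       card {\<mu>. neumann_eigenvalue q \<mu> \<and> \<mu> \<noteq> 0 \<and> \<mu> < r} = 1)"

definition has_power_series ::
    "(3 \<Rightarrow> real^2) \<Rightarrow> 3 \<Rightarrow> (nat \<Rightarrow> real^3) \<Rightarrow> (real^2 \<Rightarrow> real) \<Rightarrow> bool" where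
  "has_power_series q l c u \<longleftrightarrow>
     (\<forall>x\<in>SG q. (\<forall>k. summable (\<lambda>j. c j $ k * monomial q l j k x)) \<and>
                u x = (\<Sum>k\<in>UNIV. \<Sum>j. c j $ k * monomial q l j k x))"

definition subcritical_growth :: "(3 \<Rightarrow> real^2) \<Rightarrow> (nat \<Rightarrow> real^3) \<Rightarrow> bool" where
  "subcritical_growth q c \<longleftrightarrow>
     (\<exists>R. 0 < R \<and> R < lambda2 q \<and> (\<forall>k. (\<lambda>j. c j $ k) \<in> O(\<lambda>j. R ^ j)))"

end

theory Submission
  imports Defs "HOL-Complex_Analysis.Complex_Analysis"
begin

text \<open>
  Everything is reduced to formal power series in the eigenvalue parameter \<open>t\<close> of \<open>\<Delta> u = t u\<close>: the
  monomials with index \<open>k\<close> are the coefficients of the series \<open>U\<^sub>k\<close> that solves this equation with the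
  \<open>k\<close>-th unit jet at \<open>q l\<close>. On such a series the level \<open>m\<close> graph Laplacian is multiplication by an
  explicit entire series, so that spectral decimation constructs the \<open>U\<^sub>k\<close> and computes all their
  boundary values and derivatives. The matrices \<open>M\<^sub>j\<close> are the coefficients of the matrix that expresses
  the jets at the next corner, and expanding \<open>U\<^sub>k\<close> there is a linear identity; the theorem follows by
  rearranging an absolutely convergent double series.

  Convergence needs \<open>\<bar>P\<^sub>j\<^sub>k\<bar> = O(r\<^sup>-\<^sup>j)\<close> for every \<open>r < \<lambda>\<^sub>2\<close>. The connection matrix is holomorphic for
  \<open>\<bar>t\<bar> < \<Lambda>\<close>, where \<open>- \<Lambda>\<close> is the zero of \<open>3 + Z\<^sub>2(t)\<close> closest to 0, and since \<open>U\<^sub>k\<close> on a cell is a combination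
  of the rescaled \<open>U\<^sub>k(t/5)\<close> with coefficients from that matrix, a bound with a small radius bootstraps to
  every radius below \<open>\<Lambda>\<close>. Finally \<open>\<lambda>\<^sub>2 \<le> \<Lambda>\<close>, because \<open>\<Lambda> / 5\<close> and \<open>\<Lambda>\<close> are Neumann eigenvalues and there
  are only finitely many up to \<open>\<Lambda>\<close>.
\<close>

text \<open>Subdivision propagates corner values, so the construction starts from solutions with
  Dirichlet data. Their building blocks \<open>ea\<close>, \<open>eb\<close>, \<open>kappa\<close>
  have poles where \<open>Zs 1 = -2\<close>, which happens already for some |t| < \<Lambda> / 5;
  analytic functions of \<open>t\<close> would therefore break down far too early. Formal power
  series do not see these poles. They cancel when solutions are normalised by their jet at a corner
  instead: of the factors \<open>2 + Zs 1\<close>, \<open>W\<close> and \<open>G\<close> in the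
  denominators only \<open>inverse G\<close> survives, in \<open>beta_fps\<close> and
  \<open>tau_fps\<close>. Since \<open>G\<close> collects the factors \<open>1 + Zs m / 3\<close>
  with \<open>m \<ge> 2\<close>, and \<open>Zs (m + 1)\<close> at \<open>t\<close> is
  \<open>Zs m\<close> at \<open>t / 5\<close>, the factor with \<open>m = 2\<close> determines the
  radius \<Lambda>.\<close>

section \<open>Geometry of the gasket\<close>

lemma index3_simps [simp]:
  fixes i :: 3
  shows "i + 1 \<noteq> i" "i - 1 \<noteq> i" "i + 1 \<noteq> i - 1" "i - 1 \<noteq> i + 1" "i \<noteq> i + 1" "i \<noteq> i - 1"
    "i + 1 + 1 = i - 1" "i - 1 - 1 = i + 1"
  by simp_all

lemma exhaust_index3: "(i::3) = j \<or> i = j + 1 \<or> i = j - 1"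
  using exhaust_3[of i] exhaust_3[of j] by (elim disjE) (hypsubst; simp)+

lemma UNIV_index3: "(UNIV :: 3 set) = {j, j + 1, j - 1}"
  using exhaust_index3[of _ j] by auto

lemma sum_index3: "(\<Sum>i\<in>UNIV. f (i::3)) = f j + f (j + 1) + f (j - 1)"
  for f :: "3 \<Rightarrow> 'b::comm_monoid_add"
  unfolding UNIV_index3[of j] by (simp add: ac_simps)

lemma third_index:
  assumes "(k::3) \<noteq> l"
  obtains "l = k + 1" | "l = k - 1"
  using assms exhaust_index3[of l k] by auto

locale gasket =
  fixes q :: "3 \<Rightarrow> real^2"
  assumes equilateral: "equilateral q"
begin

abbreviation F :: "3 \<Rightarrow> real^2 \<Rightarrow> real^2" where "F \<equiv> sg_map q"
abbreviation V :: "nat \<Rightarrow> (real^2) set" where "V \<equiv> vertices q"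

text \<open>Barycentric coordinates: the vector in the inner product is twice the altitude from
  \<open>q i\<close>, which in an equilateral triangle is orthogonal to the opposite side.\<close>

definition bary :: "3 \<Rightarrow> real^2 \<Rightarrow> real" where
  "bary i x = (x - q (i + 1)) \<bullet> (2 *\<^sub>R q i - q (i + 1) - q (i - 1)) /
              ((q i - q (i + 1)) \<bullet> (2 *\<^sub>R q i - q (i + 1) - q (i - 1)))"

lemma bary_corner: "bary i (q j) = of_bool (i = j)"
proof -
  obtain s where s: "s > 0" "\<And>i j. i \<noteq> j \<Longrightarrow> dist (q i) (q j) = s"
    using equilateral unfolding equilateral_def by blast
  define e f where "e = q i - q (i + 1)" and "f = q i - q (i - 1)"
  have ef: "e \<bullet> e = s\<^sup>2" "f \<bullet> f = s\<^sup>2" "(e - f) \<bullet> (e - f) = s\<^sup>2"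
    using s(2)[of i "i + 1"] s(2)[of i "i - 1"] s(2)[of "i - 1" "i + 1"]
    by (simp_all add: e_def f_def dist_norm dot_square_norm)
  then have e_f: "e \<bullet> f = s\<^sup>2 / 2"
    by (simp add: inner_diff inner_commute)
  have n: "2 *\<^sub>R q i - q (i + 1) - q (i - 1) = e + f"
    by (simp add: e_def f_def scaleR_2)
  have d: "e \<bullet> (e + f) = 3 / 2 * s\<^sup>2"
    using ef e_f by (simp add: inner_add_right)
  have "q (i - 1) - q (i + 1) = e - f"
    by (simp add: e_def f_def)
  moreover have "(e - f) \<bullet> (e + f) = 0"
    using ef(1,2) by (simp add: inner_diff_left inner_add_right inner_commute[of f e])
  ultimately show ?thesis
    using s(1) exhaust_index3[of j i] d unfolding bary_def n
    by (auto simp flip: e_def)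
qed

lemma bary_map: "bary i (F k x) = (bary i x + of_bool (i = k)) / 2"
proof -
  have "F k x - q (i + 1) = (1/2) *\<^sub>R ((x - q (i + 1)) + (q k - q (i + 1)))"
    by (simp add: sg_map_def algebra_simps flip: scaleR_add_left)
  then have "bary i (F k x) = (bary i x + bary i (q k)) / 2"
    unfolding bary_def by (simp only: inner_scaleR_left inner_add_left) (simp add: add_divide_distrib)
  then show ?thesis by (simp add: bary_corner)
qed

lemma continuous_bary: "continuous_on A (bary i)"
  unfolding bary_def divide_inverse by (intro continuous_intros)

lemma F_inject [simp]: "F k x = F k y \<longleftrightarrow> x = y"
  by (simp add: sg_map_def)

lemma F_corner: "F k (q k) = q k"
  by (simp add: sg_map_def flip: scaleR_2)

lemma F_corner_commute: "F k (q l) = F l (q k)"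
  by (simp add: sg_map_def add.commute)

lemma continuous_F: "continuous_on A (F k)"
  unfolding sg_map_def by (intro continuous_intros)

lemma dist_F: "dist (F k x) (F k y) = dist x y / 2"
  by (simp add: sg_map_def dist_norm flip: scaleR_diff_right)

lemma q_in_V: "q i \<in> V m"
proof (induction m)
  case (Suc m)
  then have "F i (q i) \<in> V (Suc m)" by auto
  then show ?case by (simp add: F_corner)
qed simp

lemma F_V: "x \<in> V m \<Longrightarrow> F k x \<in> V (Suc m)"
  by auto

lemma V_Suc_mono: "V m \<subseteq> V (Suc m)"
proof (induction m)
  case 0
  show ?case using q_in_V[of _ "Suc 0"] by auto
next
  case (Suc m)
  then have "F i ` V m \<subseteq> V (Suc (Suc m))" for i
    by (force simp only: vertices.simps)
  then show ?case by (simp only: vertices.simps UN_subset_iff) blast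
qed

lemma V_mono: "m \<le> n \<Longrightarrow> V m \<subseteq> V n"
  using V_Suc_mono by (rule lift_Suc_mono_le)

lemma finite_V: "finite (V m)"
  by (induction m) auto

lemma bary_nonneg_V: "x \<in> V m \<Longrightarrow> bary i x \<ge> 0"
proof (induction m arbitrary: x)
  case 0
  then show ?case by (auto simp: bary_corner)
next
  case (Suc m)
  then obtain k y where "x = F k y" "y \<in> V m" by auto
  with Suc.IH[of y] show ?case by (auto simp: bary_map)
qed

lemma bary_combination_V: "x \<in> V m \<Longrightarrow> (\<Sum>i\<in>UNIV. bary i x *\<^sub>R q i) = x \<and> (\<Sum>i\<in>UNIV. bary i x) = 1"
proof (induction m arbitrary: x)
  case 0
  then show ?case by (auto simp: bary_corner of_bool_def if_distrib[of "\<lambda>c. c *\<^sub>R _"] cong: if_cong)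
next
  case (Suc m)
  then obtain k y where x: "x = F k y" and y: "y \<in> V m" by auto
  have "(\<Sum>i\<in>UNIV. bary i x *\<^sub>R q i) = (1/2) *\<^sub>R ((\<Sum>i\<in>UNIV. bary i y *\<^sub>R q i) + (\<Sum>i\<in>UNIV. of_bool (i = k) *\<^sub>R q i))"
    by (simp add: x bary_map scaleR_sum_right sum.distrib[symmetric] algebra_simps add_divide_distrib)
  also have "(\<Sum>i\<in>UNIV. of_bool (i = k) *\<^sub>R q i) = q k"
    by (simp add: of_bool_def if_distrib[of "\<lambda>c. c *\<^sub>R _"] cong: if_cong)
  finally have 1: "(\<Sum>i\<in>UNIV. bary i x *\<^sub>R q i) = x"
    using Suc.IH[OF y] by (simp add: x sg_map_def)
  have "(\<Sum>i\<in>UNIV. bary i x) = ((\<Sum>i\<in>UNIV. bary i y) + (\<Sum>i\<in>UNIV. of_bool (i = k))) / 2"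
    by (simp only: x bary_map sum.distrib sum_divide_distrib add_divide_distrib)
  also have "\<dots> = 1"
    using Suc.IH[OF y] by simp
  finally show ?case using 1 by simp
qed

lemma bounded_vertices: "bounded (\<Union>m. V m)"
proof -
  define B where "B = (\<Sum>i\<in>UNIV. norm (q i))"
  have "norm x \<le> B" if "x \<in> V m" for x m
    using that
  proof (induction m arbitrary: x)
    case 0
    then show ?case unfolding B_def by (auto intro!: member_le_sum)
  next
    case (Suc m)
    then obtain k y where x: "x = F k y" and y: "y \<in> V m" by auto
    have "norm (q k) \<le> B" unfolding B_def by (auto intro!: member_le_sum)
    moreover have "norm x \<le> (norm y + norm (q k)) / 2"
      unfolding x sg_map_def using norm_triangle_ineq[of y "q k"] by simp
    ultimately show ?case using Suc.IH[OF y] by simp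
  qed
  then show ?thesis unfolding bounded_iff by blast
qed

text \<open>A point of \<open>K\<close> at maximal distance from \<open>K'\<close> is an image under
  some \<open>F k\<close>, which halves distances; so the maximal distance is at most half of
  itself.\<close>

lemma self_similar_unique:
  assumes "compact K" "K \<noteq> {}" "K = (\<Union>i. F i ` K)"
    and "compact K'" "K' \<noteq> {}" "K' = (\<Union>i. F i ` K')"
  shows "K \<subseteq> K'"
proof -
  have "continuous_on K (\<lambda>x. infdist x K')"
    by (intro continuous_intros)
  then obtain x where x: "x \<in> K" "\<And>y. y \<in> K \<Longrightarrow> infdist y K' \<le> infdist x K'"
    using continuous_attains_sup[OF assms(1,2)] by blast
  obtain k y where y: "y \<in> K" "x = F k y" using x(1) assms(3) by blast
  obtain z where z: "z \<in> K'" "infdist y K' = dist y z"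
    using infdist_attains_inf[OF compact_imp_closed[OF assms(4)] assms(5)] by blast
  have "F k z \<in> K'" using z(1) assms(6) by blast
  then have "infdist x K' \<le> dist (F k y) (F k z)" unfolding y(2) by (rule infdist_le)
  also have "\<dots> = infdist y K' / 2" by (simp add: dist_F z(2))
  finally have "infdist x K' \<le> infdist x K' / 2" using x(2)[OF y(1)] by simp
  then have "infdist y K' = 0" if "y \<in> K" for y
    using x(2)[OF that] infdist_nonneg[of y K'] by simp
  then show ?thesis
    using in_closed_iff_infdist_zero[OF compact_imp_closed[OF assms(4)] assms(5)] by blast
qed

lemma closure_vertices:
  defines "K \<equiv> closure (\<Union>m. V m)"
  shows "compact K" "K \<noteq> {}" "K = (\<Union>i. F i ` K)"
proof -
  show "compact K" "K \<noteq> {}"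
    using bounded_vertices q_in_V unfolding K_def by (auto simp: compact_closure)
  have F: "F i ` closure A = closure (F i ` A)" for i A
  proof -
    have "F i ` A = (+) ((1/2) *\<^sub>R q i) ` ((*\<^sub>R) (1/2) ` A)" for A
      by (auto simp: sg_map_def image_image scaleR_add_right add.commute)
    then show ?thesis
      by (simp add: closure_translation closure_scaleR)
  qed
  have "(\<Union>m. V m) = (\<Union>i. F i ` (\<Union>m. V m))"
  proof
    have "x \<in> (\<Union>i. F i ` (\<Union>m. V m))" if x: "x \<in> V m" for x m
    proof (cases m)
      case 0
      then obtain i where "x = q i" using x 0 by auto
      then have "x = F i (q i)" by (simp add: F_corner)
      moreover have "q i \<in> V 0" by simp
      ultimately show ?thesis by blast
    qed (use x in auto)
    then show "(\<Union>m. V m) \<subseteq> (\<Union>i. F i ` (\<Union>m. V m))" by blast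
    show "(\<Union>i. F i ` (\<Union>m. V m)) \<subseteq> (\<Union>m. V m)" using F_V by blast
  qed
  then have "K = closure (\<Union>i. F i ` (\<Union>m. V m))" unfolding K_def by (rule arg_cong[where f = closure])
  also have "\<dots> = (\<Union>i. closure (F i ` (\<Union>m. V m)))"
    by (simp add: UNIV_index3[of 0])
  also have "\<dots> = (\<Union>i. F i ` K)" by (simp only: F K_def)
  finally show "K = (\<Union>i. F i ` K)" .
qed

lemma SG_eq_closure: "SG q = closure (\<Union>m. V m)"
  unfolding SG_def
proof (rule the_equality)
  let ?K = "closure (\<Union>m. V m)"
  show "compact ?K \<and> ?K \<noteq> {} \<and> ?K = (\<Union>i. F i ` ?K)"
    using closure_vertices by blast
  show "K = ?K" if "compact K \<and> K \<noteq> {} \<and> K = (\<Union>i. F i ` K)" for K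
    using self_similar_unique[of K ?K] self_similar_unique[of ?K K] that closure_vertices by blast
qed

lemma compact_SG: "compact (SG q)" and SG_self_similar: "SG q = (\<Union>i. F i ` SG q)"
  unfolding SG_eq_closure by (rule closure_vertices)+

lemma V_subset_SG: "V m \<subseteq> SG q"
  unfolding SG_eq_closure by (rule order_trans[OF _ closure_subset]) blast

lemma q_in_SG [simp]: "q i \<in> SG q"
  using q_in_V V_subset_SG by blast

lemma F_in_SG [simp]: "x \<in> SG q \<Longrightarrow> F k x \<in> SG q"
  by (rule equalityD2[OF SG_self_similar, THEN subsetD]) blast

lemma SG_cases:
  assumes "x \<in> SG q"
  obtains k y where "y \<in> SG q" "x = F k y"
proof -
  have "x \<in> (\<Union>i. F i ` SG q)" using assms by (rule equalityD1[OF SG_self_similar, THEN subsetD])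
  then show ?thesis using that by blast
qed

lemma bary_nonneg: "x \<in> SG q \<Longrightarrow> bary i x \<ge> 0"
  unfolding SG_eq_closure
  by (rule continuous_ge_on_closure[OF continuous_bary]) (auto intro: bary_nonneg_V)

lemma bary_sum: "x \<in> SG q \<Longrightarrow> (\<Sum>i\<in>UNIV. bary i x) = 1"
  unfolding SG_eq_closure
  by (rule continuous_constant_on_closure[where f = "\<lambda>x. \<Sum>i\<in>UNIV. bary i x"])
     (auto intro!: continuous_intros continuous_bary dest: bary_combination_V)

lemma bary_combination: "x \<in> SG q \<Longrightarrow> (\<Sum>i\<in>UNIV. bary i x *\<^sub>R q i) = x"
proof -
  assume x: "x \<in> SG q"
  have "(\<Sum>i\<in>UNIV. bary i x *\<^sub>R q i) - x = 0"
    using x unfolding SG_eq_closure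
    by (rule continuous_constant_on_closure[where f = "\<lambda>x. (\<Sum>i\<in>UNIV. bary i x *\<^sub>R q i) - x", rotated -1])
       (auto intro!: continuous_intros continuous_bary dest: bary_combination_V)
  then show ?thesis by simp
qed

lemma corner_if_bary:
  assumes "x \<in> SG q" "bary i x \<ge> 1"
  shows "x = q i"
proof -
  have s: "bary i x + bary (i + 1) x + bary (i - 1) x = 1"
    using bary_sum[OF assms(1)] by (simp add: sum_index3[of _ i])
  then have z: "bary i x = 1" "bary (i + 1) x = 0" "bary (i - 1) x = 0"
    using assms(2) bary_nonneg[OF assms(1), of "i + 1"] bary_nonneg[OF assms(1), of "i - 1"]
    by linarith+
  show ?thesis
    using bary_combination[OF assms(1)] unfolding sum_index3[of _ i] z by simp
qed

text \<open>Coordinate \<open>l\<close> is at least 1/2 on cell \<open>l\<close>, while at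
  \<open>F k x\<close> it is half of its value at \<open>x\<close>; so it is at least 1 at
  \<open>x\<close>, and this forces a corner.\<close>

lemma cells_meet:
  assumes "x \<in> SG q" "y \<in> SG q" "F k x = F l y" "k \<noteq> l"
  shows "x = q l" "y = q k"
proof -
  have "bary l (F k x) = bary l (F l y)" "bary k (F k x) = bary k (F l y)" using assms(3) by simp_all
  then have "bary l x \<ge> 1" "bary k y \<ge> 1"
    using assms(4) bary_nonneg[OF assms(1), of k] bary_nonneg[OF assms(2), of l]
    by (simp_all add: bary_map)
  then show "x = q l" "y = q k" using corner_if_bary assms(1,2) by blast+
qed

lemma F_eq_corner:
  assumes "x \<in> SG q" "F k x = q j"
  shows "k = j" "x = q j"
proof -
  have "x = q j \<and> k = j"
    using cells_meet[OF assms(1), of "q j" k j] assms F_corner[of j] F_inject[of j x "q j"]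
    by (metis bary_corner of_bool_eq_iff q_in_SG)
  then show "k = j" "x = q j" by simp_all
qed

lemma F_in_V_iff: "x \<in> SG q \<Longrightarrow> F k x \<in> V (Suc m) \<longleftrightarrow> x \<in> V m"
proof
  assume x: "x \<in> SG q" "F k x \<in> V (Suc m)"
  then obtain l y where y: "F k x = F l y" "y \<in> V m" by auto
  then show "x \<in> V m"
    using cells_meet(1)[OF x(1) _ y(1)] V_subset_SG q_in_V by (cases "k = l") auto
qed (rule F_V)

lemma vertex_cases:
  assumes "x \<in> V (Suc m) - V 0"
  obtains (interior) k y where "y \<in> V m - V 0" "x = F k y"
    | (junction) k l where "k \<noteq> l" "x = F k (q l)"
proof -
  obtain k y where y: "y \<in> V m" "x = F k y" using assms by auto
  show thesis
  proof (cases "y \<in> V 0")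
    case True
    then obtain l where l: "y = q l" by auto
    then have "k \<noteq> l" using assms y F_corner[of k] by auto
    then show ?thesis using junction l y by blast
  qed (use y interior in blast)
qed

lemma iterate_F_in_V: "(F j ^^ n) (q i) \<in> V n"
  by (induction n) auto

lemma iterate_F_in_SG: "x \<in> SG q \<Longrightarrow> (F j ^^ n) x \<in> SG q"
  by (induction n) auto

lemma dist_iterate_F: "dist ((F j ^^ n) x) (q j) = dist x (q j) / 2 ^ n"
proof (induction n)
  case (Suc n)
  have "dist ((F j ^^ Suc n) x) (q j) = dist (F j ((F j ^^ n) x)) (F j (q j))"
    by (simp add: F_corner)
  then show ?case by (simp add: dist_F Suc)
qed simp

lemma iterate_F_tendsto: "(\<lambda>n. (F j ^^ n) x) \<longlonglongrightarrow> q j"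
proof -
  have "(\<lambda>n. dist x (q j) * (1/2) ^ n) \<longlonglongrightarrow> dist x (q j) * 0"
    by (intro tendsto_intros LIMSEQ_power_zero) simp
  then show ?thesis
    by (subst tendsto_dist_iff) (simp add: dist_iterate_F power_divide)
qed

lemma bary_iterate_F: "i \<noteq> j \<Longrightarrow> bary i ((F j ^^ n) x) = bary i x / 2 ^ n"
  by (induction n) (simp_all add: bary_map)

lemma iterate_F_not_corner: "n > 0 \<Longrightarrow> (F j ^^ n) (q (j + 1)) \<in> V n - V 0"
proof -
  assume n: "n > 0"
  have "(F j ^^ n) (q (j + 1)) \<noteq> q i" for i
  proof
    assume *: "(F j ^^ n) (q (j + 1)) = q i"
    have "1 / 2 ^ n = (of_bool (j + 1 = i) :: real)"
      using bary_iterate_F[of "j + 1" j n "q (j + 1)"] unfolding * by (simp add: bary_corner)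
    then show False using n one_less_power[of "2::real" n] by (cases "j + 1 = i") auto
  qed
  then show ?thesis using iterate_F_in_V by auto
qed

text \<open>The Laplacian is tested only off \<open>V 0\<close>; this density is what determines its
  values everywhere, corners included.\<close>

lemma interior_vertices_dense: "SG q \<subseteq> closure (\<Union>m. V m - V 0)"
proof -
  have corner: "q i \<in> closure (\<Union>m. V m - V 0)" for i
  proof (rule closure_sequential[THEN iffD2], intro exI conjI allI)
    show "(\<lambda>n. (F i ^^ Suc n) (q (i + 1))) \<longlonglongrightarrow> q i"
      using iterate_F_tendsto by (rule LIMSEQ_Suc)
    show "(F i ^^ Suc n) (q (i + 1)) \<in> (\<Union>m. V m - V 0)" for n
      using iterate_F_not_corner[of "Suc n" i] by blast
  qed
  have "x \<in> closure (\<Union>m. V m - V 0)" if x: "x \<in> V m" for x m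
  proof (cases "x \<in> V 0")
    case True
    then obtain i where "x = q i" by auto
    then show ?thesis using corner by simp
  next
    case False
    then have "x \<in> (\<Union>m. V m - V 0)" using x by blast
    then show ?thesis by (rule subsetD[OF closure_subset])
  qed
  then have "(\<Union>m. V m) \<subseteq> closure (\<Union>m. V m - V 0)" by (intro UN_least subsetI)
  then show ?thesis unfolding SG_eq_closure by (rule closure_minimal) (rule closed_closure)
qed


section \<open>The graph Laplacian\<close>

definition nbrs :: "nat \<Rightarrow> real^2 \<Rightarrow> (real^2) set" where
  "nbrs m x = {y. sg_adj q m x y}"

text \<open>Polymorphic so that the same operator acts on real functions and on functions whose
  values are formal power series.\<close>

definition L :: "nat \<Rightarrow> (real^2 \<Rightarrow> 'b::ab_group_add) \<Rightarrow> real^2 \<Rightarrow> 'b" where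
  "L m u x = (\<Sum>y\<in>nbrs m x. u y - u x)"

lemma nbrs_subset: "nbrs m x \<subseteq> V m"
  by (auto simp: nbrs_def sg_adj_def)

lemma finite_nbrs [simp]: "finite (nbrs m x)"
  using finite_subset[OF nbrs_subset finite_V] .

lemma nbrs_in_SG: "y \<in> nbrs m x \<Longrightarrow> y \<in> SG q"
  by (rule subsetD[OF V_subset_SG subsetD[OF nbrs_subset]])

lemma q_inject [simp]: "q i = q j \<longleftrightarrow> i = j"
proof
  assume "q i = q j"
  then have "bary i (q i) = bary i (q j)" by simp
  then show "i = j" by (simp add: bary_corner split: if_splits)
qed simp

lemma nbrs_0: "nbrs 0 (q j) = {q (j + 1), q (j - 1)}"
proof -
  have "sg_adj q 0 (q j) y \<longleftrightarrow> y \<in> range q \<and> y \<noteq> q j" for y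
    by (auto simp: sg_adj_def sg_word_map_def)
  then have "nbrs 0 (q j) = q ` UNIV - {q j}" by (auto simp: nbrs_def)
  also have "q ` UNIV = {q j, q (j + 1), q (j - 1)}"
    by (simp only: UNIV_index3[of j] image_insert image_empty)
  also have "{q j, q (j + 1), q (j - 1)} - {q j} = {q (j + 1), q (j - 1)}"
    by (simp add: insert_Diff_if)
  finally show ?thesis .
qed

lemma sg_adj_Suc:
  assumes "x \<in> SG q" "y \<in> SG q"
  shows "sg_adj q (Suc m) (F k x) (F k y) \<longleftrightarrow> sg_adj q m x y"
proof
  assume "sg_adj q m x y"
  then obtain w where w: "length w = m" "x \<in> sg_word_map q w ` SG q" "y \<in> sg_word_map q w ` SG q"
    "x \<in> V m" "y \<in> V m" "x \<noteq> y"
    unfolding sg_adj_def by blast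
  then have "F k x \<in> sg_word_map q (k # w) ` SG q" "F k y \<in> sg_word_map q (k # w) ` SG q"
    by (auto simp: sg_word_map_def)
  then show "sg_adj q (Suc m) (F k x) (F k y)"
    unfolding sg_adj_def using w by (auto intro!: exI[of _ "k # w"])
next
  assume A: "sg_adj q (Suc m) (F k x) (F k y)"
  then obtain w where w: "length w = Suc m" "F k x \<in> sg_word_map q w ` SG q"
    "F k y \<in> sg_word_map q w ` SG q" "x \<noteq> y"
    unfolding sg_adj_def by auto
  then obtain l w' where lw: "w = l # w'" "length w' = m" by (cases w) auto
  have sub: "sg_word_map q w' ` SG q \<subseteq> SG q"
    unfolding sg_word_map_def by (induction w') (auto simp: image_subset_iff)
  obtain x' y' where xy': "x' \<in> sg_word_map q w' ` SG q" "y' \<in> sg_word_map q w' ` SG q"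
    "F k x = F l x'" "F k y = F l y'"
    using w(2,3) unfolding lw by (auto simp: sg_word_map_def)
  have "k = l"
    using cells_meet(1)[OF assms(1) _ xy'(3)] cells_meet(1)[OF assms(2) _ xy'(4)] sub xy' w(4) by blast
  then have "x \<in> sg_word_map q w' ` SG q" "y \<in> sg_word_map q w' ` SG q" using xy' by auto
  then show "sg_adj q m x y"
    using A w(4) lw(2) unfolding sg_adj_def by (auto simp: F_in_V_iff assms simp del: vertices.simps)
qed

lemma nbrs_Suc_cell:
  assumes "x \<in> SG q"
  shows "nbrs (Suc m) (F k x) \<inter> F k ` SG q = F k ` nbrs m x"
proof (intro equalityI subsetI)
  fix z assume "z \<in> nbrs (Suc m) (F k x) \<inter> F k ` SG q"
  then show "z \<in> F k ` nbrs m x" using sg_adj_Suc[OF assms] by (auto simp: nbrs_def)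
next
  fix z assume "z \<in> F k ` nbrs m x"
  then obtain y where "y \<in> nbrs m x" "y \<in> SG q" "z = F k y" using nbrs_in_SG by blast
  then show "z \<in> nbrs (Suc m) (F k x) \<inter> F k ` SG q"
    using sg_adj_Suc[OF assms] by (auto simp: nbrs_def)
qed

lemma nbrs_Suc_in_cell:
  assumes "y \<in> nbrs (Suc m) x"
  obtains k where "x \<in> F k ` SG q" "y \<in> F k ` SG q"
proof -
  obtain w where w: "length w = Suc m" "x \<in> sg_word_map q w ` SG q" "y \<in> sg_word_map q w ` SG q"
    using assms unfolding nbrs_def sg_adj_def by blast
  then obtain l w' where lw: "w = l # w'" by (cases w) auto
  have "sg_word_map q w' ` SG q \<subseteq> SG q"
    unfolding sg_word_map_def by (induction w') (auto simp: image_subset_iff)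
  then have "sg_word_map q w ` SG q \<subseteq> F l ` SG q"
    unfolding lw by (auto simp: sg_word_map_def)
  then show ?thesis using w that by blast
qed

lemma sum_F_nbrs: "(\<Sum>y\<in>F k ` nbrs m x. u y - u (F k x)) = L m (\<lambda>y. u (F k y)) x"
  unfolding L_def by (subst sum.reindex) (auto intro: inj_onI)

lemma L_single_cell:
  assumes x: "x \<in> SG q" and only: "\<And>l. F k x \<in> F l ` SG q \<Longrightarrow> l = k"
  shows "L (Suc m) u (F k x) = L m (\<lambda>y. u (F k y)) x"
proof -
  have "nbrs (Suc m) (F k x) = F k ` nbrs m x"
    unfolding nbrs_Suc_cell[OF x, symmetric] using nbrs_Suc_in_cell only by blast
  then show ?thesis by (simp add: L_def[of "Suc m"] sum_F_nbrs)
qed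

lemma L_interior:
  assumes "x \<in> V m - V 0"
  shows "L (Suc m) u (F k x) = L m (\<lambda>y. u (F k y)) x"
proof (rule L_single_cell)
  show x: "x \<in> SG q" using assms V_subset_SG by blast
  show "l = k" if l: "F k x \<in> F l ` SG q" for l
  proof (rule ccontr)
    assume "l \<noteq> k"
    then have "x = q l" using l cells_meet(1)[OF x] by blast
    then show False using assms by auto
  qed
qed

lemma L_corner: "L (Suc m) u (q k) = L m (\<lambda>y. u (F k y)) (q k)"
proof -
  have "L (Suc m) u (F k (q k)) = L m (\<lambda>y. u (F k y)) (q k)"
  proof (rule L_single_cell)
    fix l assume "F k (q k) \<in> F l ` SG q"
    then obtain y where "y \<in> SG q" "F l y = q k" by (auto simp: F_corner)
    then show "l = k" by (rule F_eq_corner)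
  qed simp
  then show ?thesis by (simp only: F_corner)
qed

text \<open>The junction is a corner of both cells and their only common point, so its neighbours
  split disjointly between them.\<close>

lemma L_junction:
  assumes "k \<noteq> l"
  shows "L (Suc m) u (F k (q l)) = L m (\<lambda>y. u (F k y)) (q l) + L m (\<lambda>y. u (F l y)) (q k)"
proof -
  let ?N = "nbrs (Suc m) (F k (q l))"
  have k: "?N \<inter> F k ` SG q = F k ` nbrs m (q l)"
    by (rule nbrs_Suc_cell) simp
  have l: "?N \<inter> F l ` SG q = F l ` nbrs m (q k)"
    unfolding F_corner_commute[of k l] by (rule nbrs_Suc_cell) simp
  have "?N \<subseteq> F k ` SG q \<union> F l ` SG q"
  proof
    fix y assume "y \<in> ?N"
    then obtain i where i: "F k (q l) \<in> F i ` SG q" "y \<in> F i ` SG q" by (rule nbrs_Suc_in_cell)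
    then obtain z where z: "z \<in> SG q" "F k (q l) = F i z" by blast
    have "i = k \<or> i = l"
      using cells_meet(1)[OF q_in_SG z] by auto
    then show "y \<in> F k ` SG q \<union> F l ` SG q" using i by blast
  qed
  then have "?N = (?N \<inter> F k ` SG q) \<union> (?N \<inter> F l ` SG q)" by (simp add: Int_absorb2 flip: Int_Un_distrib)
  then have N: "?N = F k ` nbrs m (q l) \<union> F l ` nbrs m (q k)" by (simp only: k l)
  have disj: "F k ` nbrs m (q l) \<inter> F l ` nbrs m (q k) = {}"
  proof (rule equals0I)
    fix z assume "z \<in> F k ` nbrs m (q l) \<inter> F l ` nbrs m (q k)"
    then have z: "z \<in> ?N" "z \<in> F k ` SG q" "z \<in> F l ` SG q" unfolding k[symmetric] l[symmetric] by simp_all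
    obtain x y where "x \<in> SG q" "y \<in> SG q" "z = F k x" "F k x = F l y" using z(2,3) by blast
    then have "z = F k (q l)" using cells_meet(1)[of x y k l] assms by simp
    then show False using z(1) by (simp add: nbrs_def sg_adj_def)
  qed
  have "L (Suc m) u (F k (q l)) = (\<Sum>y\<in>F k ` nbrs m (q l). u y - u (F k (q l))) +
                                  (\<Sum>y\<in>F l ` nbrs m (q k). u y - u (F l (q k)))"
    unfolding L_def N F_corner_commute[of l k] by (rule sum.union_disjoint) (use disj in auto)
  then show ?thesis by (simp only: sum_F_nbrs)
qed

lemma L_0: "L 0 u (q j) = u (q (j + 1)) + u (q (j - 1)) - u (q j) - u (q j)"
proof -
  have "q (j + 1) \<noteq> q (j - 1)"
    using bary_corner[of "j + 1" "j + 1"] bary_corner[of "j + 1" "j - 1"] by auto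
  then show ?thesis by (simp add: L_def nbrs_0)
qed

text \<open>Up to sign this is the bracket in the definition of the normal derivative.\<close>

lemma L_corner_explicit:
  "L m u (q j) = u ((F j ^^ m) (q (j + 1))) + u ((F j ^^ m) (q (j - 1))) - u (q j) - u (q j)"
proof (induction m arbitrary: u)
  case (Suc m)
  show ?case unfolding L_corner Suc F_corner by simp
qed (simp add: L_0)

lemma L_cong:
  assumes "x \<in> SG q" "\<And>y. y \<in> SG q \<Longrightarrow> u y = v y"
  shows "L m u x = L m v x"
  unfolding L_def by (intro sum.cong refl) (simp add: assms nbrs_in_SG)

lemma L_add: "L m (\<lambda>x. u x + v x) x = L m u x + L m v x"
  unfolding L_def sum.distrib[symmetric] by (rule sum.cong) simp_all

lemma L_diff: "L m (\<lambda>x. u x - v x) x = L m u x - L m v x"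
  unfolding L_def sum_subtractf[symmetric] by (rule sum.cong) simp_all

lemma L_sum: "L m (\<lambda>x. \<Sum>i\<in>I. u i x) x = (\<Sum>i\<in>I. L m (u i) x)"
  unfolding L_def sum_subtractf[symmetric] by (rule sum.swap)

lemma L_cmult: "L m (\<lambda>x. c * u x) x = c * L m u x" for c :: "'b::ring"
  by (simp add: L_def sum_distrib_left right_diff_distrib)

lemma L_additive:
  assumes "\<And>a b. f (a - b) = f a - f b" "f 0 = 0" "\<And>a b. f (a + b) = f a + f b"
  shows "L m (\<lambda>x. f (u x)) x = f (L m u x)"
proof -
  have "f (sum g A) = (\<Sum>a\<in>A. f (g a))" if "finite A" for g :: "real^2 \<Rightarrow> _" and A
    using that by (induction A) (auto simp: assms)
  then show ?thesis by (simp add: L_def assms)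
qed

lemma L_nonpos_at_max:
  fixes u :: "real^2 \<Rightarrow> real"
  assumes "\<And>y. y \<in> V m \<Longrightarrow> u y \<le> u x"
  shows "L m u x \<le> 0"
  unfolding L_def
proof (rule sum_nonpos)
  show "u y - u x \<le> 0" if "y \<in> nbrs m x" for y
    using assms[of y] subsetD[OF nbrs_subset that] by simp
qed

section \<open>The Laplacian and the comparison principle\<close>

lemma has_laplacian_iff:
  "has_laplacian q u f \<longleftrightarrow> continuous_on (SG q) u \<and> continuous_on (SG q) f \<and>
     (\<forall>\<epsilon>>0. \<exists>N. \<forall>m\<ge>N. \<forall>x\<in>V m - V 0. \<bar>3/2 * 5^m * L m u x - f x\<bar> < \<epsilon>)"
  unfolding has_laplacian_def L_def nbrs_def by simp

lemma has_laplacian_continuous: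
  assumes "has_laplacian q u f"
  shows "continuous_on (SG q) u" "continuous_on (SG q) f"
  using assms unfolding has_laplacian_def by blast+

lemma has_laplacian_transfer:
  assumes "has_laplacian q u f" "\<And>x. x \<in> SG q \<Longrightarrow> u x = v x" "\<And>x. x \<in> SG q \<Longrightarrow> f x = g x"
  shows "has_laplacian q v g"
  unfolding has_laplacian_iff
proof (intro conjI allI impI)
  show "continuous_on (SG q) v" "continuous_on (SG q) g"
    using has_laplacian_continuous[OF assms(1)]
    by (auto intro: continuous_on_eq[OF _ assms(2)] continuous_on_eq[OF _ assms(3)])
  fix e :: real assume "e > 0"
  then obtain N where N: "\<And>m x. m \<ge> N \<Longrightarrow> x \<in> V m - V 0 \<Longrightarrow> \<bar>3/2 * 5^m * L m u x - f x\<bar> < e"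
    using assms(1) unfolding has_laplacian_iff by blast
  have "\<bar>3/2 * 5^m * L m v x - g x\<bar> < e" if "m \<ge> N" "x \<in> V m - V 0" for m x
  proof -
    have x: "x \<in> SG q" using that V_subset_SG[of m] by blast
    then have "L m u x = L m v x" "f x = g x" by (auto intro: L_cong assms)
    then show ?thesis using N[OF that] by simp
  qed
  then show "\<exists>N. \<forall>m\<ge>N. \<forall>x\<in>V m - V 0. \<bar>3/2 * 5^m * L m v x - g x\<bar> < e" by blast
qed

lemma has_laplacian_cong:
  assumes "\<And>x. x \<in> SG q \<Longrightarrow> u x = v x" "\<And>x. x \<in> SG q \<Longrightarrow> f x = g x"
  shows "has_laplacian q u f \<longleftrightarrow> has_laplacian q v g"
proof
  show "has_laplacian q v g" if "has_laplacian q u f"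
    using that by (rule has_laplacian_transfer) (simp_all add: assms)
  show "has_laplacian q u f" if "has_laplacian q v g"
    using that by (rule has_laplacian_transfer) (simp_all add: assms)
qed

lemma has_laplacian_tendsto:
  assumes "has_laplacian q u f" "x \<in> V n - V 0"
  shows "(\<lambda>m. 3/2 * 5^m * L m u x) \<longlonglongrightarrow> f x"
proof (rule LIMSEQ_I)
  fix r :: real assume "r > 0"
  then obtain N where N: "\<And>m x. m \<ge> N \<Longrightarrow> x \<in> V m - V 0 \<Longrightarrow> \<bar>3/2 * 5^m * L m u x - f x\<bar> < r"
    using assms(1) unfolding has_laplacian_iff by blast
  have "norm (3/2 * 5^m * L m u x - f x) < r" if "m \<ge> max N n" for m
    using N[of m x] that assms(2) V_mono[of n m] by auto
  then show "\<exists>no. \<forall>m\<ge>no. norm (3/2 * 5^m * L m u x - f x) < r" by blast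
qed

lemma has_laplacian_unique:
  assumes "has_laplacian q u f" "has_laplacian q u g" "x \<in> SG q"
  shows "f x = g x"
proof -
  let ?D = "\<Union>m. V m - V 0"
  have cl: "closure ?D = SG q"
    using interior_vertices_dense closure_minimal[of ?D "SG q"] V_subset_SG compact_SG
    by (auto simp: compact_imp_closed)
  have "f x - g x = 0"
  proof (rule continuous_constant_on_closure[where S = ?D and f = "\<lambda>x. f x - g x"])
    show "continuous_on (closure ?D) (\<lambda>x. f x - g x)"
      unfolding cl by (intro continuous_intros has_laplacian_continuous[OF assms(1)] has_laplacian_continuous[OF assms(2)])
    show "f y - g y = 0" if "y \<in> ?D" for y
      using that LIMSEQ_unique[OF has_laplacian_tendsto[OF assms(1)] has_laplacian_tendsto[OF assms(2)]]
      by auto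
  qed (use assms cl in auto)
  then show ?thesis by simp
qed

lemma laplacian_eq:
  assumes "has_laplacian q u f"
  shows "laplacian q u = restrict f (SG q)"
  unfolding laplacian_def
proof (rule the_equality)
  show "restrict f (SG q) \<in> extensional (SG q) \<and> has_laplacian q u (restrict f (SG q))"
    using assms has_laplacian_cong[of u u "restrict f (SG q)" f] by auto
  show "g = restrict f (SG q)" if "g \<in> extensional (SG q) \<and> has_laplacian q u g" for g
    using that has_laplacian_unique[OF _ assms]
    by (intro extensionalityI[of _ "SG q"]) auto
qed

lemma has_laplacian_add:
  assumes "has_laplacian q u f" "has_laplacian q v g"
  shows "has_laplacian q (\<lambda>x. u x + v x) (\<lambda>x. f x + g x)"
  unfolding has_laplacian_iff
proof (intro conjI allI impI)
  fix e :: real assume "e > 0"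
  then have e2: "e / 2 > 0" by simp
  obtain N where N: "\<And>m x. m \<ge> N \<Longrightarrow> x \<in> V m - V 0 \<Longrightarrow> \<bar>3/2 * 5^m * L m u x - f x\<bar> < e / 2"
    using assms(1) e2 unfolding has_laplacian_iff by blast
  obtain N' where N': "\<And>m x. m \<ge> N' \<Longrightarrow> x \<in> V m - V 0 \<Longrightarrow> \<bar>3/2 * 5^m * L m v x - g x\<bar> < e / 2"
    using assms(2) e2 unfolding has_laplacian_iff by blast
  have "\<bar>3/2 * 5^m * L m (\<lambda>x. u x + v x) x - (f x + g x)\<bar> < e"
    if "m \<ge> max N N'" "x \<in> V m - V 0" for m x
  proof -
    have "3/2 * 5^m * L m (\<lambda>x. u x + v x) x - (f x + g x) =
      (3/2 * 5^m * L m u x - f x) + (3/2 * 5^m * L m v x - g x)"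
      by (simp add: L_add algebra_simps)
    then show ?thesis using N[of m x] N'[of m x] that by linarith
  qed
  then show "\<exists>N. \<forall>m\<ge>N. \<forall>x\<in>V m - V 0. \<bar>3/2 * 5^m * L m (\<lambda>x. u x + v x) x - (f x + g x)\<bar> < e"
    by blast
qed (intro continuous_intros has_laplacian_continuous[OF assms(1)] has_laplacian_continuous[OF assms(2)])+

lemma has_laplacian_cmult:
  assumes "has_laplacian q u f"
  shows "has_laplacian q (\<lambda>x. c * u x) (\<lambda>x. c * f x)"
  unfolding has_laplacian_iff
proof (intro conjI allI impI)
  fix e :: real assume "e > 0"
  then have "e / (\<bar>c\<bar> + 1) > 0" by (auto intro: divide_pos_pos)
  then obtain N where N: "\<And>m x. m \<ge> N \<Longrightarrow> x \<in> V m - V 0 \<Longrightarrow> \<bar>3/2 * 5^m * L m u x - f x\<bar> < e / (\<bar>c\<bar> + 1)"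
    using assms(1) unfolding has_laplacian_iff by blast
  have "\<bar>3/2 * 5^m * L m (\<lambda>x. c * u x) x - c * f x\<bar> < e" if "m \<ge> N" "x \<in> V m - V 0" for m x
  proof -
    have "3/2 * 5^m * L m (\<lambda>x. c * u x) x - c * f x = c * (3/2 * 5^m * L m u x - f x)"
      by (simp add: L_cmult algebra_simps)
    then have "\<bar>3/2 * 5^m * L m (\<lambda>x. c * u x) x - c * f x\<bar> = \<bar>c\<bar> * \<bar>3/2 * 5^m * L m u x - f x\<bar>"
      by (simp only: abs_mult)
    also have "\<dots> \<le> \<bar>c\<bar> * (e / (\<bar>c\<bar> + 1))"
      using N[OF that] by (intro mult_left_mono) auto
    also have "\<dots> < e" using \<open>e > 0\<close> by (simp add: field_simps)
    finally show ?thesis .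
  qed
  then show "\<exists>N. \<forall>m\<ge>N. \<forall>x\<in>V m - V 0. \<bar>3/2 * 5^m * L m (\<lambda>x. c * u x) x - c * f x\<bar> < e" by blast
qed (intro continuous_intros has_laplacian_continuous[OF assms])+

lemma has_laplacian_diff:
  assumes "has_laplacian q u f" "has_laplacian q v g"
  shows "has_laplacian q (\<lambda>x. u x - v x) (\<lambda>x. f x - g x)"
  using has_laplacian_add[OF assms(1) has_laplacian_cmult[OF assms(2), of "-1"]] by simp

text \<open>The factor 1/5 is the shift by one level: level \<open>m\<close> inside the cell is
  level \<open>Suc m\<close> of the gasket.\<close>

lemma has_laplacian_cell:
  assumes "has_laplacian q u f"
  shows "has_laplacian q (\<lambda>x. u (F k x)) (\<lambda>x. f (F k x) / 5)"
  unfolding has_laplacian_iff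
proof (intro conjI allI impI)
  have cell: "continuous_on (SG q) (\<lambda>x. g (F k x))" if "continuous_on (SG q) g" for g :: "real^2 \<Rightarrow> real"
    by (rule continuous_on_compose2[OF that continuous_F]) auto
  show "continuous_on (SG q) (\<lambda>x. u (F k x))" "continuous_on (SG q) (\<lambda>x. f (F k x) / 5)"
    unfolding divide_inverse
    by (intro continuous_on_mult_right cell has_laplacian_continuous[OF assms])+
  fix e :: real assume "e > 0"
  then obtain N where N: "\<And>m x. m \<ge> N \<Longrightarrow> x \<in> V m - V 0 \<Longrightarrow> \<bar>3/2 * 5^m * L m u x - f x\<bar> < e"
    using assms(1) unfolding has_laplacian_iff by blast
  have "\<bar>3/2 * 5^m * L m (\<lambda>x. u (F k x)) x - f (F k x) / 5\<bar> < e" if "m \<ge> N" "x \<in> V m - V 0" for m x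
  proof -
    have "F k x \<in> V (Suc m) - V 0"
      using that F_eq_corner[of x k] V_subset_SG[of m] by auto
    then have "\<bar>3/2 * 5^Suc m * L (Suc m) u (F k x) - f (F k x)\<bar> < e"
      using N[of "Suc m" "F k x"] that(1) by simp
    then show ?thesis unfolding L_interior[OF that(2)] by simp
  qed
  then show "\<exists>N. \<forall>m\<ge>N. \<forall>x\<in>V m - V 0. \<bar>3/2 * 5^m * L m (\<lambda>x. u (F k x)) x - f (F k x) / 5\<bar> < e"
    by blast
qed

text \<open>The function \<open>g\<close> solves \<Delta> g = 1 exactly on every level. Hence
  \<open>u + (M + e) * g\<close> has positive graph Laplacian at all non-boundary vertices of a fine
  level, its maximum over that level sits at a corner, and \<open>e\<close> may tend to 0
  afterwards.\<close>

lemma comparison_upper: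
  assumes u: "has_laplacian q u f" and f: "\<And>x. x \<in> SG q \<Longrightarrow> - M \<le> f x" and b: "\<And>i. u (q i) \<le> b"
    and g: "continuous_on (SG q) g" "\<And>m x. x \<in> V m - V 0 \<Longrightarrow> 3/2 * 5^m * L m g x = 1" "\<And>i. g (q i) = 0"
    and x: "x \<in> SG q"
  shows "u x + M * g x \<le> b"
proof -
  have bound: "u y + (M + e) * g y \<le> b" if e: "e > 0" and y: "y \<in> V n" for e y n
  proof -
    obtain N where N: "\<And>m x. m \<ge> N \<Longrightarrow> x \<in> V m - V 0 \<Longrightarrow> \<bar>3/2 * 5^m * L m u x - f x\<bar> < e"
      using u e unfolding has_laplacian_iff by blast
    define m where "m = max N n"
    let ?h = "\<lambda>x. u x + (M + e) * g x"
    have "finite (?h ` V m)" "?h ` V m \<noteq> {}" using finite_V q_in_V by auto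
    then have "Max (?h ` V m) \<in> ?h ` V m" by (rule Max_in)
    then obtain z where z0: "z \<in> V m" "Max (?h ` V m) = ?h z" by blast
    have z: "z \<in> V m" "\<And>y. y \<in> V m \<Longrightarrow> ?h y \<le> ?h z"
      using z0 Max_ge[of "?h ` V m"] finite_V by simp_all
    have "z \<in> V 0"
    proof (rule ccontr)
      assume "z \<notin> V 0"
      then have z': "z \<in> V m - V 0" using z by simp
      have "3/2 * 5^m * L m ?h z = 3/2 * 5^m * L m u z + (M + e) * (3/2 * 5^m * L m g z)"
        unfolding L_add L_cmult by (simp add: algebra_simps)
      also have "\<dots> > 0"
        unfolding g(2)[OF z'] using N[OF _ z'] f[of z] z(1) V_subset_SG[of m]
        by (auto simp: m_def abs_less_iff)
      finally show False using L_nonpos_at_max[of m ?h z] z(2)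
        by (smt (verit) mult_nonneg_nonpos zero_le_power divide_nonneg_nonneg mult_nonneg_nonneg)
    qed
    then have "?h z \<le> b" using b g(3) by auto
    moreover have "?h y \<le> ?h z" using z(2) y V_mono[of n m] by (auto simp: m_def)
    ultimately show ?thesis by simp
  qed
  have "u y + M * g y \<le> b" if "y \<in> V n" for y n
  proof (rule tendsto_upperbound)
    have "((\<lambda>e. u y + (M + e) * g y) \<longlongrightarrow> u y + (M + 0) * g y) (at_right 0)"
      by (intro tendsto_intros)
    then show "((\<lambda>e. u y + (M + e) * g y) \<longlongrightarrow> u y + M * g y) (at_right 0)" by simp
    show "\<forall>\<^sub>F e in at_right 0. u y + (M + e) * g y \<le> b"
      using eventually_at_right_less[of "0::real"] by eventually_elim (use bound that in auto)
  qed simp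
  moreover have "continuous_on (SG q) (\<lambda>x. u x + M * g x)"
    by (intro continuous_intros has_laplacian_continuous[OF u] g(1))
  ultimately show ?thesis
    using x unfolding SG_eq_closure
    by (intro continuous_le_on_closure[of "\<Union>m. V m" "\<lambda>x. u x + M * g x" x b]) auto
qed

end

section \<open>Power series for spectral decimation\<close>

unbundle no vec_syntax
unbundle fps_syntax

definition dil :: "real \<Rightarrow> real fps \<Rightarrow> real fps" where
  "dil c f = Abs_fps (\<lambda>n. c ^ n * f $ n)"

lemma dil_nth [simp]: "dil c f $ n = c ^ n * f $ n"
  by (simp add: dil_def)

lemma dil_add: "dil c (f + g) = dil c f + dil c g"
  and dil_diff: "dil c (f - g) = dil c f - dil c g"
  and dil_uminus: "dil c (- f) = - dil c f"
  by (simp_all add: fps_eq_iff algebra_simps)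

lemma dil_const [simp]: "dil c (fps_const a) = fps_const a"
  by (simp add: fps_eq_iff)

lemma dil_0 [simp]: "dil c 0 = 0" and dil_1 [simp]: "dil c 1 = 1"
  by (simp_all add: fps_eq_iff)

lemma dil_numeral [simp]: "dil c (numeral n) = numeral n"
  by (simp add: numeral_fps_const)

lemma dil_of_bool [simp]: "dil c (of_bool b) = of_bool b"
  by (cases b) simp_all

lemma dil_mult: "dil c (f * g) = dil c f * dil c g"
  by (simp add: fps_eq_iff fps_mult_nth sum_distrib_left power_add[symmetric] mult_ac)

lemma dil_sum: "dil c (\<Sum>i\<in>A. f i) = (\<Sum>i\<in>A. dil c (f i))"
  by (simp add: fps_eq_iff fps_sum_nth sum_distrib_left)

lemma dil_dil: "dil a (dil b f) = dil (a * b) f"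
  by (simp add: fps_eq_iff power_mult_distrib mult.assoc)

lemma dil_one: "dil 1 f = f"
  by (simp add: fps_eq_iff)

lemma dil_X: "dil c fps_X = fps_const c * fps_X"
  by (auto simp: fps_eq_iff fps_X_def)

abbreviation D :: "real fps \<Rightarrow> real fps" where "D \<equiv> dil (1/5)"

text \<open>Comparison of coefficients in \<open>Psi(5 z) = Psi(z) (5 + Psi(z))\<close> with leading
  term \<open>z\<close>: the end terms of the convolution vanish, and the linear term moves to the
  left as \<open>5 ^ n - 5\<close>.\<close>

fun psi_coeff :: "nat \<Rightarrow> real" where
  "psi_coeff n = (if n < 2 then of_nat n
     else (\<Sum>i\<in>{1..<n}. psi_coeff i * psi_coeff (n - i)) / (5 ^ n - 5))"

declare psi_coeff.simps [simp del]

text \<open>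
  \<open>Psi\<close> is the Poincare function of the decimation polynomial \<open>z (5 + z)\<close>: on functions with
  \<open>\<Delta> u = t u\<close> the level \<open>m\<close> graph Laplacian acts as multiplication by \<open>Psi (2 t / (3 * 5 ^ m))\<close>.
\<close>

definition Psi :: "real fps" where "Psi = Abs_fps psi_coeff"

lemma Psi_nth_0 [simp]: "Psi $ 0 = 0" and Psi_nth_1 [simp]: "Psi $ Suc 0 = 1"
  by (simp_all add: Psi_def psi_coeff.simps)

lemma Psi_nth_nonneg: "Psi $ n \<ge> 0"
proof (induction n rule: less_induct)
  case (less n)
  have "(5::real) ^ 1 \<le> 5 ^ n" if "n \<ge> 2" using that by (intro power_increasing) auto
  then show ?case
    using less unfolding Psi_def
    by (subst fps_nth_Abs_fps, subst psi_coeff.simps) (auto intro!: divide_nonneg_nonneg sum_nonneg)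
qed

lemma Psi_functional_eq: "dil 5 Psi = Psi * (5 + Psi)"
proof (rule fps_ext)
  fix n :: nat
  consider "n = 0" | "n = 1" | "n \<ge> 2" by linarith
  then show "dil 5 Psi $ n = (Psi * (5 + Psi)) $ n"
  proof cases
    case 3
    have "(5::real) ^ 1 < 5 ^ n" using 3 by (intro power_strict_increasing) auto
    moreover have "Psi $ n = (\<Sum>i\<in>{1..<n}. Psi $ i * Psi $ (n - i)) / (5 ^ n - 5)"
      using 3 unfolding Psi_def fps_nth_Abs_fps by (subst psi_coeff.simps) simp
    ultimately have "(5 ^ n - 5) * Psi $ n = (\<Sum>i\<in>{1..<n}. Psi $ i * Psi $ (n - i))"
      by simp
    also have "\<dots> = (\<Sum>i = 0..n. Psi $ i * Psi $ (n - i))"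
    proof (rule sum.mono_neutral_left)
      show "\<forall>i\<in>{0..n} - {1..<n}. Psi $ i * Psi $ (n - i) = 0"
      proof
        fix i assume "i \<in> {0..n} - {1..<n}"
        then have "i = 0 \<or> i = n" by auto
        then show "Psi $ i * Psi $ (n - i) = 0" by auto
      qed
    qed auto
    also have "\<dots> = (Psi * Psi) $ n" by (simp only: fps_mult_nth)
    finally have "5 ^ n * Psi $ n = 5 * Psi $ n + (Psi * Psi) $ n" by (simp add: algebra_simps)
    moreover have "(Psi * 5) $ n = 5 * Psi $ n" by (simp add: numeral_fps_const)
    ultimately show ?thesis by (simp add: distrib_left)
  qed (simp_all add: fps_mult_nth)
qed

definition Zs :: "nat \<Rightarrow> real fps" where "Zs m = dil (2 / (3 * 5 ^ m)) Psi"

lemma Zs_nth: "Zs m $ n = (2 / (3 * 5 ^ m)) ^ n * Psi $ n"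
  by (simp add: Zs_def)

lemma Zs_nth_0 [simp]: "Zs m $ 0 = 0"
  by (simp add: Zs_def)

text \<open>Spectral decimation; after the substitution of \<open>- z\<close> for \<open>z\<close>
  the quadratic \<open>z (5 + z)\<close> becomes the familiar \<lambda> (5 - \<lambda>).\<close>

lemma Zs_rec: "Zs m = Zs (Suc m) * (5 + Zs (Suc m))"
proof -
  have "Zs m = dil (2 / (3 * 5 ^ Suc m)) (dil 5 Psi)"
    by (simp add: Zs_def dil_dil)
  then show ?thesis by (simp only: Psi_functional_eq dil_mult dil_add dil_numeral Zs_def)
qed

lemma D_Zs: "D (Zs m) = Zs (Suc m)"
  by (simp add: Zs_def dil_dil)

text \<open>\<open>G\<close> is the infinite product of the factors \<open>1 + Zs m / 3\<close> with \<open>m \<ge> 2\<close>.\<close>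

fun G_coeff :: "nat \<Rightarrow> real" where
  "G_coeff n = (if n = 0 then 1
     else (\<Sum>i\<in>{1..n}. Zs 2 $ i / 3 * (1/5) ^ (n - i) * G_coeff (n - i)) / (1 - (1/5) ^ n))"

declare G_coeff.simps [simp del]

definition G :: "real fps" where "G = Abs_fps G_coeff"

lemma G_nth_0 [simp]: "G $ 0 = 1"
  by (simp add: G_def G_coeff.simps)

lemma G_functional_eq: "3 * G = (3 + Zs 2) * D G"
proof (rule fps_ext)
  fix n :: nat
  show "(3 * G) $ n = ((3 + Zs 2) * D G) $ n"
  proof (cases "n = 0")
    case False
    have "(1/5::real) ^ n < 1" using False by (intro power_Suc_less_one power_less_one_iff[THEN iffD2]) auto
    moreover have "G $ n = (\<Sum>i\<in>{1..n}. Zs 2 $ i / 3 * (1/5) ^ (n - i) * G $ (n - i)) / (1 - (1/5) ^ n)"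
      using False unfolding G_def fps_nth_Abs_fps by (subst G_coeff.simps) simp
    ultimately have "(1 - (1/5) ^ n) * G $ n = (\<Sum>i\<in>{1..n}. Zs 2 $ i / 3 * (1/5) ^ (n - i) * G $ (n - i))"
      by simp
    then have "3 * G $ n - 3 * (1/5) ^ n * G $ n = (\<Sum>i\<in>{1..n}. Zs 2 $ i * ((1/5) ^ (n - i) * G $ (n - i)))"
      by (simp add: algebra_simps sum_distrib_left sum_divide_distrib[symmetric])
    also have "\<dots> = (Zs 2 * D G) $ n"
      by (simp add: fps_mult_nth sum.atLeast_Suc_atMost[of 0 n])
    finally show ?thesis by (simp add: distrib_right numeral_fps_const)
  qed (simp add: fps_mult_nth)
qed

text \<open>\<open>W\<close> is the infinite product of the factors \<open>1 + Zs m / 5\<close> with \<open>m \<ge> 1\<close>.\<close>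

definition W :: "real fps" where "W = fps_const (3/2) * fps_shift 1 (Zs 0)"

lemma Zs_0_eq: "Zs 0 = fps_const (2/3) * fps_X * W"
proof -
  have "fps_X * fps_shift 1 (Zs 0) = Zs 0"
    by (simp add: fps_eq_iff fps_X_mult_nth)
  moreover have "fps_const (2/3) * fps_X * W = fps_const (2/3 * (3/2)) * (fps_X * fps_shift 1 (Zs 0))"
    unfolding W_def fps_const_mult[symmetric] by (simp only: mult_ac)
  ultimately show ?thesis by simp
qed

lemma W_nth_0 [simp]: "W $ 0 = 1"
  by (simp add: W_def Zs_nth)

lemma W_functional_eq: "5 * W = (5 + Zs 1) * D W"
proof -
  have "Zs 1 = fps_const (2/15) * fps_X * D W"
    using arg_cong[OF Zs_0_eq, of D] by (simp add: D_Zs dil_mult dil_X mult.assoc[symmetric])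
  then have "fps_const (2/3) * fps_X * W = fps_const (2/15) * fps_X * D W * (5 + Zs 1)"
    using Zs_0_eq Zs_rec[of 0] by simp
  then have "fps_X * (fps_const (15/2) * fps_const (2/3) * W) = fps_X * (fps_const (15/2) * fps_const (2/15) * (D W * (5 + Zs 1)))"
    by algebra
  then have "fps_const (15/2) * fps_const (2/3) * W = fps_const (15/2) * fps_const (2/15) * (D W * (5 + Zs 1))"
    by (rule mult_left_cancel[THEN iffD1, rotated]) simp
  moreover have "fps_const (15/2) * fps_const (2/3) = (5 :: real fps)" "fps_const (15/2) * fps_const (2/15) = (1 :: real fps)"
    by (simp_all add: numeral_fps_const)
  ultimately show ?thesis by (simp only: mult_1 mult.commute)
qed

text \<open>
  Let a solution have the values \<open>v\<^sub>0, v\<^sub>1, v\<^sub>2\<close> at the corners. The level 1 eigenvalue equations make its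
  value at the midpoint of \<open>q\<^sub>0\<close> and \<open>q\<^sub>1\<close> equal to \<open>ea * (v\<^sub>0 + v\<^sub>1) + eb * v\<^sub>2\<close>.
\<close>

definition ext_den :: "real fps" where "ext_den = inverse ((2 + Zs 1) * (5 + Zs 1))"
definition ea :: "real fps" where "ea = (4 + Zs 1) * ext_den"
definition eb :: "real fps" where "eb = 2 * ext_den"

lemma ext_den: "ext_den * ((2 + Zs 1) * (5 + Zs 1)) = 1"
  unfolding ext_den_def by (rule inverse_mult_eq_1) simp

lemma ea_eb: "(3 + Zs 1) * ea - eb = 1" "(4 + Zs 1) * eb = 2 * ea"
proof -
  show "(3 + Zs 1) * ea - eb = 1" using ext_den unfolding ea_def eb_def by algebra
  show "(4 + Zs 1) * eb = 2 * ea" unfolding ea_def eb_def by (simp only: mult_ac)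
qed

lemma ea_minus_eb: "(5 + Zs 1) * (ea - eb) = 1"
  using ea_eb by algebra

lemma ea_nth_0: "ea $ 0 = 2/5" and eb_nth_0: "eb $ 0 = 1/5"
  by (simp_all add: ea_def eb_def ext_den_def)

text \<open>
  The normal derivative at \<open>q\<^sub>0\<close> is \<open>kappa * ((2 + Zs 0 / 2) * v\<^sub>0 - v\<^sub>1 - v\<^sub>2)\<close>; \<open>alpha_fps\<close>, \<open>beta_fps\<close> and
  \<open>gamma_fps\<close> are the values at \<open>q\<^sub>1\<close> of the three solutions with a unit jet at \<open>q\<^sub>0\<close>.
\<close>

definition kappa :: "real fps" where "kappa = 2 * G * inverse ((2 + Zs 1) * W)"
definition alpha_fps :: "real fps" where "alpha_fps = 1 + fps_const (1/4) * Zs 0"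
definition beta_fps :: "real fps" where "beta_fps = - fps_const (1/4) * (2 + Zs 1) * W * inverse G"
definition gamma_fps :: "real fps" where "gamma_fps = fps_const (1/2) * W"

lemma kappa_eq: "kappa * ((2 + Zs 1) * W) = 2 * G"
proof -
  have "inverse ((2 + Zs 1) * W) * ((2 + Zs 1) * W) = 1" by (rule inverse_mult_eq_1) simp
  then show ?thesis unfolding kappa_def by (simp add: mult.assoc)
qed

lemma kappa_nth_0: "kappa $ 0 = 1"
  by (simp add: kappa_def)

lemma fps_double_half: "fps_const (1/2) * 2 = (1 :: real fps)" "fps_const (1/4) * 4 = (1 :: real fps)"
  by (simp_all add: numeral_fps_const)

lemma inverse_G: "inverse G * G = 1"
  by (rule inverse_mult_eq_1) simp

lemma kappa_beta: "2 * kappa * beta_fps = - 1"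
  using fps_double_half(2) kappa_eq inverse_G unfolding beta_fps_def by algebra

lemma fps_neq_0_if_nth_0: "f $ 0 \<noteq> 0 \<Longrightarrow> f \<noteq> 0" for f :: "real fps"
  by auto

text \<open>By decimation \<open>6 + Zs 1 = (2 + Zs 2) * (3 + Zs 2)\<close>, and
  \<open>ea + eb\<close> is \<open>6 + Zs 1\<close> divided by
  \<open>(2 + Zs 1) * (5 + Zs 1)\<close>. The factors \<open>2 + Zs\<close> telescope,
  \<open>3 + Zs 2\<close> is absorbed by \<open>G\<close> and \<open>5 + Zs 1\<close> by
  \<open>W\<close>. The ratio 3/5 is the renormalisation of the normal derivative.\<close>

lemma kappa_functional_eq: "5 * (ea + eb) * D kappa = 3 * kappa"
proof -
  define z w where "z = Zs 2" and "w = D W"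
  have z1: "Zs 1 = z * (5 + z)" unfolding z_def using Zs_rec[of 1] by (simp add: numeral_2_eq_2)
  have Dk: "D kappa * ((2 + z) * w) = 2 * D G"
    using arg_cong[OF kappa_eq, of D] by (simp add: dil_mult dil_add D_Zs z_def w_def numeral_2_eq_2)
  have G: "3 * G = (3 + z) * D G" using G_functional_eq by (simp add: z_def)
  have W: "5 * W = (5 + Zs 1) * w" using W_functional_eq by (simp add: w_def)
  have ab: "(ea + eb) * ((2 + Zs 1) * (5 + Zs 1)) = 6 + Zs 1"
    unfolding ea_def eb_def using ext_den by algebra
  let ?c = "((2 + Zs 1) * (5 + Zs 1)) * ((2 + z) * w) * W"
  have "?c * (5 * (ea + eb) * D kappa) =
      5 * ((ea + eb) * ((2 + Zs 1) * (5 + Zs 1))) * (D kappa * ((2 + z) * w)) * W"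
    by (simp only: mult_ac)
  also have "\<dots> = (6 + Zs 1) * (2 * D G) * (5 * W)"
    unfolding ab Dk by (simp only: mult_ac)
  also have "\<dots> = (2 + z) * 2 * ((3 + z) * D G) * ((5 + Zs 1) * w)"
    unfolding W z1 by algebra
  also have "\<dots> = (2 + z) * 3 * (kappa * ((2 + Zs 1) * W)) * ((5 + Zs 1) * w)"
    unfolding kappa_eq G[symmetric] by (simp only: mult_ac)
  also have "\<dots> = ?c * (3 * kappa)"
    by (simp only: mult_ac)
  finally have "?c * (5 * (ea + eb) * D kappa) = ?c * (3 * kappa)" .
  moreover have "?c \<noteq> 0"
    by (rule fps_neq_0_if_nth_0) (simp add: z_def w_def)
  ultimately show ?thesis by (rule mult_left_cancel[THEN iffD1, rotated])
qed

lemma tendsto_dil_nth: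
  "(\<lambda>m. (f * dil (1 / 5 ^ m) g) $ n) \<longlonglongrightarrow> f $ n * g $ 0"
proof -
  have d: "(\<lambda>m. dil (1 / 5 ^ m) g $ k) \<longlonglongrightarrow> (if k = 0 then g $ 0 else 0)" for k
  proof (cases "k = 0")
    case False
    then have "(\<lambda>m. ((1/5) ^ k) ^ m * g $ k) \<longlonglongrightarrow> 0 * g $ k"
      by (intro tendsto_intros LIMSEQ_realpow_zero) (auto simp: power_less_one_iff)
    moreover have "((1/5) ^ k) ^ m = (1 / 5 ^ m :: real) ^ k" for m
      by (simp add: power_divide power_mult[symmetric] mult.commute)
    ultimately show ?thesis using False by simp
  qed simp
  have "(\<lambda>m. \<Sum>i = 0..n. f $ i * dil (1 / 5 ^ m) g $ (n - i)) \<longlonglongrightarrow>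
      (\<Sum>i = 0..n. f $ i * (if n - i = 0 then g $ 0 else 0))"
    by (intro tendsto_sum tendsto_mult tendsto_const d)
  also have "(\<Sum>i = 0..n. f $ i * (if n - i = 0 then g $ 0 else 0)) = (\<Sum>i = 0..n. if i = n then f $ i * g $ 0 else 0)"
    by (intro sum.cong) auto
  finally show ?thesis by (simp add: fps_mult_nth)
qed

lemma tendsto_geometric_Zs:
  assumes "\<bar>c\<bar> < 5"
  shows "(\<lambda>m. c ^ m * Zs m $ n) \<longlonglongrightarrow> 0"
proof (cases "n = 0")
  case False
  have "\<bar>c / 5 ^ n\<bar> < 1"
    using assms False self_le_power[of "5::real" n] by simp
  then have "(\<lambda>m. (c / 5 ^ n) ^ m * ((2/3) ^ n * Psi $ n)) \<longlonglongrightarrow> 0 * ((2/3) ^ n * Psi $ n)"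
    by (intro tendsto_intros LIMSEQ_power_zero) auto
  moreover have "c ^ m * Zs m $ n = (c / 5 ^ n) ^ m * ((2/3) ^ n * Psi $ n)" for m
    by (simp add: Zs_nth power_divide power_mult_distrib power_mult[symmetric] mult.commute)
  ultimately show ?thesis by simp
qed simp

lemma beta_functional_eq: "5 * (ea + eb) * beta_fps = 3 * D beta_fps"
proof -
  have "2 * D kappa * D beta_fps = - 1"
    using arg_cong[OF kappa_beta, of D] by (simp add: dil_mult dil_uminus)
  then show ?thesis using kappa_functional_eq kappa_beta by algebra
qed

lemma beta_nth_0 [simp]: "beta_fps $ 0 = - (1/2)"
  by (simp add: beta_fps_def)

lemma alpha_eq: "4 * alpha_fps = 4 + Zs 0"
proof -
  have "4 * alpha_fps = 4 + (fps_const (1/4) * 4) * Zs 0" unfolding alpha_fps_def by algebra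
  then show ?thesis unfolding fps_double_half by simp
qed

lemma gamma_eq: "2 * gamma_fps = W"
proof -
  have "2 * gamma_fps = (fps_const (1/2) * 2) * W" unfolding gamma_fps_def by algebra
  then show ?thesis unfolding fps_double_half by simp
qed

lemma inverse_W: "inverse W * W = 1"
  by (rule inverse_mult_eq_1) simp

section \<open>Fundamental solutions\<close>

text \<open>\<open>ext k l i\<close> is the value at \<open>F k (q l)\<close> of the solution with boundary values \<open>\<delta>\<^sub>i\<close>.\<close>

definition ext :: "3 \<Rightarrow> 3 \<Rightarrow> 3 \<Rightarrow> real fps" where
  "ext k l i = (if l = k then of_bool (i = k) else if i = k \<or> i = l then ea else eb)"

lemma ext_commute: "ext k l i = ext l k i"
  by (auto simp: ext_def)

text \<open>At a corner only half of a neighbourhood is present, so the unperturbed relation is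
  \<open>2 * L = Zs * u\<close>. This is the deviation from it on level 0 for the boundary values
  that are 1 at corner \<open>i\<close> and 0 elsewhere.\<close>

definition corner_defect :: "3 \<Rightarrow> 3 \<Rightarrow> real fps" where
  "corner_defect i j = (if i = j then - 4 - Zs 0 else 2)"

lemma ext_self: "ext j j i = of_bool (i = j)"
  by (simp add: ext_def)

lemma D_corner_defect: "D (corner_defect i j) = (if i = j then - 4 - Zs 1 else 2)"
  by (simp add: corner_defect_def dil_diff dil_uminus D_Zs)

text \<open>Subdivision only rescales the defect, so its form persists on all levels with the
  accumulated factors \<open>ea + eb\<close>.\<close>

lemma ext_corner_defect:
  "(\<Sum>l\<in>UNIV. ext j l i * D (corner_defect l j)) = (ea + eb) * corner_defect i j"
proof -
  have z: "Zs 0 = Zs 1 * (5 + Zs 1)" using Zs_rec[of 0] by simp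
  have 1: "1 * (- 4 - Zs 1) + ea * 2 + ea * 2 = (ea + eb) * (- 4 - Zs 0)"
    unfolding z using ea_eb by algebra
  have 2: "ea * Zs 0 + (eb * Zs 0 + (eb * 4 + ea * 8)) = Zs (Suc 0) + 4"
    using 1 unfolding One_nat_def by algebra
  show ?thesis
    using exhaust_index3[of i j]
    unfolding sum_index3[of _ j] D_corner_defect
    by (auto simp: ext_def corner_defect_def 2 algebra_simps)
qed

text \<open>This is the level 1 eigenvalue equation at the midpoint, from which \<open>ea\<close>
  and \<open>eb\<close> were determined, written as cancellation of the defects of the two adjacent
  cells.\<close>

lemma ext_junction:
  assumes "k \<noteq> l"
  shows "(\<Sum>j\<in>UNIV. ext k j i * D (corner_defect j l)) + (\<Sum>j\<in>UNIV. ext l j i * D (corner_defect j k)) = 0"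
proof -
  have *: "2 * (ea * (- 4 - Zs 1)) + (2 + (ea * 2 + eb * 2)) = 0"
    "2 * (ea * (- 4 - Zs 1)) + (eb * 2 + (2 + ea * 2)) = 0"
    "2 * (eb * (- 4 - Zs 1)) + 4 * ea = 0"
    using ea_eb by (algebra, algebra, algebra)
  have P: "(\<Sum>j\<in>UNIV. ext k j i * D (corner_defect j l)) + (\<Sum>j\<in>UNIV. ext l j i * D (corner_defect j k)) = 0"
    if "l = k + 1" for k l
    using exhaust_index3[of i k] that unfolding sum_index3[of _ k] D_corner_defect
    by (elim disjE; hypsubst; simp add: ext_def * del: One_nat_def)
  show ?thesis
    using assms
  proof (cases rule: third_index)
    case 2
    then show ?thesis using P[of k l] by (simp add: add.commute)
  qed (rule P)
qed

lemma ext_antisymmetric: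
  "(5 + Zs 1) * (ext j (j + 1) i - ext j (j - 1) i) = of_bool (i = j + 1) - of_bool (i = j - 1)"
  using exhaust_index3[of i j] ea_minus_eb by (auto simp: ext_def algebra_simps)

lemma ext_nth_0:
  "ext k l i $ 0 = (if l = k then of_bool (i = k) else if i = k \<or> i = l then 2/5 else 1/5)"
  by (simp add: ext_def ea_nth_0 eb_nth_0)

lemma sum_ext_nth_0: "(\<Sum>i\<in>UNIV. ext k l i $ 0) = 1"
  using exhaust_index3[of l k] unfolding sum_index3[of _ k] by (auto simp: ext_nth_0)

lemma abs_ext_nth_0: "\<bar>ext k l i $ 0\<bar> \<le> 1"
  by (simp add: ext_nth_0)

text \<open>At \<open>t = 0\<close> the extension is the harmonic 2/5-2/5-1/5 rule. The zero sum
  matters: it expresses \<open>d k\<close> by the other two entries, whereas a unit mass at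
  \<open>k\<close> would be preserved.\<close>

lemma harmonic_contraction:
  fixes d :: "3 \<Rightarrow> real"
  assumes "(\<Sum>i\<in>UNIV. d i) = 0"
  shows "(\<Sum>i\<in>UNIV. \<bar>\<Sum>l\<in>UNIV. ext k l i $ 0 * d l\<bar>) \<le> 3/5 * (\<Sum>i\<in>UNIV. \<bar>d i\<bar>)"
proof -
  have s: "d k + d (k + 1) + d (k - 1) = 0" using assms unfolding sum_index3[of _ k] .
  have "(\<Sum>l\<in>UNIV. ext k l k $ 0 * d l) = d k + 2/5 * d (k + 1) + 2/5 * d (k - 1)"
    "(\<Sum>l\<in>UNIV. ext k l (k + 1) $ 0 * d l) = 2/5 * d (k + 1) + 1/5 * d (k - 1)"
    "(\<Sum>l\<in>UNIV. ext k l (k - 1) $ 0 * d l) = 1/5 * d (k + 1) + 2/5 * d (k - 1)"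
    unfolding sum_index3[of _ k] by (simp_all add: ext_nth_0)
  then show ?thesis
    using s unfolding sum_index3[of _ k] by (simp add: abs_if split: if_splits)
qed

lemma fps_mult_D_nth: "(a * D f) $ n = (\<Sum>s = 0..n. a $ s * ((1/5) ^ (n - s) * f $ (n - s)))"
  by (simp add: fps_mult_nth)

section \<open>Construction of the fundamental solutions by iterated subdivision\<close>

context gasket
begin

text \<open>Glues functions given on the three cells; meaningful when \<open>g k (q l) = g l (q k)\<close>.\<close>

definition glue :: "(3 \<Rightarrow> real^2 \<Rightarrow> 'b) \<Rightarrow> real^2 \<Rightarrow> 'b" where
  "glue g x = (let k = (SOME k. x \<in> F k ` SG q) in g k (2 *\<^sub>R x - q k))"

lemma F_inverse: "2 *\<^sub>R F k x - q k = x"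
  by (simp add: sg_map_def)

lemma glue_F:
  assumes "\<And>k l. g k (q l) = g l (q k)" "x \<in> SG q"
  shows "glue g (F k x) = g k x"
proof -
  define l where "l = (SOME l. F k x \<in> F l ` SG q)"
  have "F k x \<in> F l ` SG q" unfolding l_def by (rule someI[of _ k]) (use assms in auto)
  then obtain y where y: "y \<in> SG q" "F k x = F l y" by blast
  have "glue g (F k x) = g l (2 *\<^sub>R F k x - q l)"
    by (simp add: glue_def Let_def l_def)
  also have "\<dots> = g l y"
    unfolding y(2) F_inverse ..
  also have "\<dots> = g k x"
    using cells_meet[OF assms(2) y] assms(1) y(2) by (cases "k = l") auto
  finally show ?thesis .
qed

lemma continuous_on_SG_if_cells:
  fixes f :: "real^2 \<Rightarrow> 'b::topological_space"
  assumes "\<And>k. continuous_on (SG q) (\<lambda>x. f (F k x))"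
  shows "continuous_on (SG q) f"
proof -
  have "continuous_on (\<Union>k\<in>UNIV. F k ` SG q) f"
  proof (rule continuous_on_closed_Union)
    fix k
    show "closed (F k ` SG q)"
      by (intro compact_imp_closed compact_continuous_image continuous_F compact_SG)
    have "continuous_on (F k ` SG q) (\<lambda>y. 2 *\<^sub>R y - q k)"
      by (intro continuous_intros)
    then have "continuous_on (F k ` SG q) (\<lambda>y. f (F k (2 *\<^sub>R y - q k)))"
      by (rule continuous_on_compose2[OF assms]) (auto simp: F_inverse)
    then show "continuous_on (F k ` SG q) f"
      by (rule continuous_on_eq) (auto simp: F_inverse)
  qed auto
  then show ?thesis by (subst SG_self_similar)
qed

text \<open>Fixed point iteration for the self-similarity of solutions, where \<open>D\<close>
  accounts for the parameter \<open>t / 5\<close> on a cell. The start has the right corner values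
  and sums to 1, so that increments have constant terms summing to 0.\<close>

primrec approx :: "nat \<Rightarrow> 3 \<Rightarrow> real^2 \<Rightarrow> real fps" where
  "approx 0 = (\<lambda>i x. fps_const (bary i x))"
| "approx (Suc m) = (\<lambda>i. glue (\<lambda>k y. \<Sum>l\<in>UNIV. ext k l i * D (approx m l y)))"

text \<open>The two claims need a joint induction: gluing on one level requires the corner values on
  the level before.\<close>

lemma approx_corner_F:
  "approx m i (q j) = of_bool (i = j)"
  "x \<in> SG q \<Longrightarrow> approx (Suc m) i (F k x) = (\<Sum>l\<in>UNIV. ext k l i * D (approx m l x))"
proof (induction m arbitrary: i j k x)
  case 0
  {
    case 1
    then show ?case by (simp add: bary_corner)
  next
    case 2
    show ?case unfolding approx.simps(2)
      by (rule glue_F[OF _ 2]) (simp add: bary_corner sum_index3 ext_commute of_bool_def if_distrib cong: if_cong)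
  }
next
  case (Suc m)
  {
    case 1
    have "approx (Suc m) i (F j (q j)) = (\<Sum>l\<in>UNIV. ext j l i * D (approx m l (q j)))"
      by (rule Suc.IH(2)) simp
    then show ?case
      by (simp add: F_corner Suc.IH(1) of_bool_def if_distrib ext_self cong: if_cong)
  }
  note corner = this
  {
    case 2
    show ?case unfolding approx.simps(2)[of "Suc m"]
      by (rule glue_F[OF _ 2]) (simp add: corner of_bool_def if_distrib ext_commute del: approx.simps cong: if_cong)
  }
qed

lemma continuous_approx: "continuous_on (SG q) (\<lambda>x. approx m i x $ n)"
proof (induction m arbitrary: i n)
  case 0
  then show ?case by (cases "n = 0") (auto intro: continuous_bary)
next
  case (Suc m)
  show ?case
  proof (rule continuous_on_SG_if_cells)
    fix k
    have "continuous_on (SG q) (\<lambda>x. \<Sum>l\<in>UNIV. \<Sum>s = 0..n. ext k l i $ s * ((1/5) ^ (n - s) * approx m l x $ (n - s)))"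
      by (intro continuous_intros Suc)
    then show "continuous_on (SG q) (\<lambda>x. approx (Suc m) i (F k x) $ n)"
      by (rule continuous_on_eq) (simp add: approx_corner_F(2) fps_sum_nth fps_mult_D_nth del: approx.simps)
  qed
qed

definition incr :: "nat \<Rightarrow> 3 \<Rightarrow> real^2 \<Rightarrow> real fps" where
  "incr m i x = approx (Suc m) i x - approx m i x"

lemma incr_F:
  "x \<in> SG q \<Longrightarrow> incr (Suc m) i (F k x) = (\<Sum>l\<in>UNIV. ext k l i * D (incr m l x))"
  unfolding incr_def approx_corner_F(2) dil_diff right_diff_distrib sum_subtractf ..

lemma incr_bounded_start: "\<exists>B. \<forall>i. \<forall>x\<in>SG q. \<bar>incr 0 i x $ n\<bar> \<le> B"
proof -
  have "\<exists>B. \<forall>x\<in>SG q. \<bar>incr 0 i x $ n\<bar> \<le> B" for i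
  proof -
    have "continuous_on (SG q) (\<lambda>x. incr 0 i x $ n)"
      unfolding incr_def fps_sub_nth by (intro continuous_intros continuous_approx)
    then have "bounded ((\<lambda>x. incr 0 i x $ n) ` SG q)"
      by (intro compact_imp_bounded compact_continuous_image compact_SG)
    then show ?thesis unfolding bounded_iff by auto
  qed
  then obtain B where B: "\<And>i x. x \<in> SG q \<Longrightarrow> \<bar>incr 0 i x $ n\<bar> \<le> B i" by metis
  have "\<bar>incr 0 i x $ n\<bar> \<le> (\<Sum>i\<in>UNIV. \<bar>B i\<bar>)" if "x \<in> SG q" for i x
    using B[OF that, of i] member_le_sum[of i UNIV "\<lambda>i. \<bar>B i\<bar>"] by simp
  then show ?thesis by blast
qed

lemma sum_approx_nth_0: "x \<in> SG q \<Longrightarrow> (\<Sum>i\<in>UNIV. approx m i x $ 0) = 1"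
proof (induction m arbitrary: x)
  case 0
  then show ?case by (simp add: bary_sum)
next
  case (Suc m)
  from Suc.prems obtain k y where y: "y \<in> SG q" "x = F k y" by (rule SG_cases)
  have "(\<Sum>i\<in>UNIV. approx (Suc m) i x $ 0) = (\<Sum>i\<in>UNIV. \<Sum>l\<in>UNIV. ext k l i $ 0 * approx m l y $ 0)"
    unfolding y(2) approx_corner_F(2)[OF y(1)] by (simp add: fps_sum_nth fps_mult_D_nth)
  also have "\<dots> = (\<Sum>l\<in>UNIV. (\<Sum>i\<in>UNIV. ext k l i $ 0) * approx m l y $ 0)"
    unfolding sum_distrib_right by (rule sum.swap)
  finally show ?case using Suc.IH[OF y(1)] by (simp add: sum_ext_nth_0)
qed

lemma sum_incr_nth_0: "x \<in> SG q \<Longrightarrow> (\<Sum>i\<in>UNIV. incr m i x $ 0) = 0"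
  unfolding incr_def fps_sub_nth sum_subtractf by (simp add: sum_approx_nth_0 del: approx.simps)

text \<open>\<open>D\<close> does not shrink the constant coefficient, so here the decay comes from
  \<open>harmonic_contraction\<close>. The rate 3/5 is relaxed to 4/5 to serve as the base case for
  all coefficients.\<close>

lemma incr_decay_0: "\<exists>C. \<forall>m i. \<forall>x\<in>SG q. \<bar>incr m i x $ 0\<bar> \<le> C * (4/5) ^ m"
proof -
  obtain B where B: "\<And>i x. x \<in> SG q \<Longrightarrow> \<bar>incr 0 i x $ 0\<bar> \<le> B"
    using incr_bounded_start[of 0] by blast
  have B0: "B \<ge> 0" using B[OF q_in_SG, of 0 0] by linarith
  have N: "(\<Sum>i\<in>UNIV. \<bar>incr m i x $ 0\<bar>) \<le> 3 * B * (3/5) ^ m" if "x \<in> SG q" for m x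
    using that
  proof (induction m arbitrary: x)
    case 0
    have "(\<Sum>i\<in>UNIV. \<bar>incr 0 i x $ 0\<bar>) \<le> of_nat (card (UNIV :: 3 set)) * B"
      using B[OF 0] by (intro sum_bounded_above) auto
    then show ?case by simp
  next
    case (Suc m)
    from Suc.prems obtain k y where y: "y \<in> SG q" "x = F k y" by (rule SG_cases)
    have "(\<Sum>i\<in>UNIV. \<bar>incr (Suc m) i x $ 0\<bar>) = (\<Sum>i\<in>UNIV. \<bar>\<Sum>l\<in>UNIV. ext k l i $ 0 * incr m l y $ 0\<bar>)"
      unfolding y(2) incr_F[OF y(1)] by (simp add: fps_sum_nth fps_mult_D_nth)
    also have "\<dots> \<le> 3/5 * (\<Sum>i\<in>UNIV. \<bar>incr m i y $ 0\<bar>)"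
      by (rule harmonic_contraction) (rule sum_incr_nth_0[OF y(1)])
    also have "\<dots> \<le> 3/5 * (3 * B * (3/5) ^ m)" using Suc.IH[OF y(1)] by simp
    finally show ?case by simp
  qed
  have "\<bar>incr m i x $ 0\<bar> \<le> 3 * B * (4/5) ^ m" if "x \<in> SG q" for m i x
  proof -
    have "\<bar>incr m i x $ 0\<bar> \<le> (\<Sum>i\<in>UNIV. \<bar>incr m i x $ 0\<bar>)" by (rule member_le_sum) auto
    also have "\<dots> \<le> 3 * B * (3/5) ^ m" by (rule N[OF that])
    also have "\<dots> \<le> 3 * B * (4/5) ^ m" using B0 by (intro mult_left_mono power_mono) auto
    finally show ?thesis .
  qed
  then show ?thesis by blast
qed

text \<open>For \<open>n > 0\<close> the term \<open>s = 0\<close> carries the factor 1/5 from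
  \<open>D\<close> for each of three corners, in total 3/5. The terms \<open>s > 0\<close> involve
  earlier coefficients, which already decay like \<open>(4/5) ^ m\<close>; the choice of
  \<open>C\<close> makes them contribute at most another 1/5.\<close>

lemma incr_decay: "\<exists>C. \<forall>m i. \<forall>x\<in>SG q. \<bar>incr m i x $ n\<bar> \<le> C * (4/5) ^ m"
proof (induction n rule: less_induct)
  case (less n)
  show ?case
  proof (cases "n = 0")
    case False
    obtain c where c: "\<And>n' m i x. n' < n \<Longrightarrow> x \<in> SG q \<Longrightarrow> \<bar>incr m i x $ n'\<bar> \<le> c n' * (4/5) ^ m"
      using less by metis
    obtain B where B: "\<And>i x. x \<in> SG q \<Longrightarrow> \<bar>incr 0 i x $ n\<bar> \<le> B"
      using incr_bounded_start[of n] by blast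
    define K where "K k i = (\<Sum>l\<in>UNIV. \<Sum>s = 1..n. \<bar>ext k l i $ s\<bar> * c (n - s))" for k i
    define C where "C = max B (5 * (\<Sum>k\<in>UNIV. \<Sum>i\<in>UNIV. \<bar>K k i\<bar>))"
    have C: "B \<le> C" "5 * K k i \<le> C" for k i
    proof -
      have "K k i \<le> (\<Sum>i\<in>UNIV. \<bar>K k i\<bar>)"
        using member_le_sum[of i UNIV "\<lambda>i. \<bar>K k i\<bar>"] by simp
      also have "\<dots> \<le> (\<Sum>k\<in>UNIV. \<Sum>i\<in>UNIV. \<bar>K k i\<bar>)"
        by (rule member_le_sum[of k UNIV "\<lambda>k. \<Sum>i\<in>UNIV. \<bar>K k i\<bar>"]) (auto intro: sum_nonneg)
      finally show "5 * K k i \<le> C" unfolding C_def by simp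
    qed (simp add: C_def)
    have C0: "C \<ge> 0" using B[OF q_in_SG, of 0 0] C(1) by linarith
    have "\<bar>incr m i x $ n\<bar> \<le> C * (4/5) ^ m" if "x \<in> SG q" for m i x
      using that
    proof (induction m arbitrary: i x)
      case 0
      then show ?case using B[of x i] C(1) by simp
    next
      case (Suc m)
      from Suc.prems obtain k y where y: "y \<in> SG q" "x = F k y" by (rule SG_cases)
      let ?p = "(4/5) ^ m :: real"
      let ?t = "\<lambda>l s. ext k l i $ s * ((1/5) ^ (n - s) * incr m l y $ (n - s))"
      have hd: "\<bar>?t l 0\<bar> \<le> 1/5 * (C * ?p)" for l
      proof -
        have "(1/5::real) ^ n \<le> (1/5) ^ 1" using False by (intro power_decreasing) auto
        then have "(1/5) ^ n * \<bar>incr m l y $ n\<bar> \<le> 1/5 * (C * ?p)"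
          using Suc.IH[OF y(1), of l] mult_right_mono[of "(1/5) ^ n" "1/5" "\<bar>incr m l y $ n\<bar>"] by simp
        then have "\<bar>ext k l i $ 0\<bar> * ((1/5) ^ n * \<bar>incr m l y $ n\<bar>) \<le> 1 * (1/5 * (C * ?p))"
          by (rule mult_mono[OF abs_ext_nth_0]) auto
        then show ?thesis by (simp add: abs_mult)
      qed
      have tl: "\<bar>?t l s\<bar> \<le> \<bar>ext k l i $ s\<bar> * c (n - s) * ?p" if "s \<in> {1..n}" for l s
      proof -
        have "(1/5) ^ (n - s) * \<bar>incr m l y $ (n - s)\<bar> \<le> 1 * (c (n - s) * ?p)"
          using that c[of "n - s" y m l] y(1) by (intro mult_mono power_le_one) auto
        then have "\<bar>ext k l i $ s\<bar> * ((1/5) ^ (n - s) * \<bar>incr m l y $ (n - s)\<bar>) \<le> \<bar>ext k l i $ s\<bar> * (c (n - s) * ?p)"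
          by (intro mult_left_mono) auto
        then show ?thesis by (simp add: abs_mult mult.assoc)
      qed
      have "\<bar>incr (Suc m) i x $ n\<bar> = \<bar>\<Sum>l\<in>UNIV. \<Sum>s = 0..n. ?t l s\<bar>"
        unfolding y(2) incr_F[OF y(1)] by (simp add: fps_sum_nth fps_mult_D_nth)
      also have "\<dots> \<le> (\<Sum>l\<in>UNIV. \<Sum>s = 0..n. \<bar>?t l s\<bar>)"
        by (intro order_trans[OF sum_abs] sum_mono sum_abs)
      also have "\<dots> = (\<Sum>l\<in>UNIV. \<bar>?t l 0\<bar> + (\<Sum>s = 1..n. \<bar>?t l s\<bar>))"
        by (simp add: sum.atLeast_Suc_atMost)
      also have "\<dots> \<le> (\<Sum>l\<in>(UNIV :: 3 set). 1/5 * (C * ?p) + (\<Sum>s = 1..n. \<bar>ext k l i $ s\<bar> * c (n - s) * ?p))"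
        by (intro sum_mono add_mono hd tl)
      also have "\<dots> = 3/5 * (C * ?p) + K k i * ?p"
        unfolding K_def sum.distrib sum_distrib_right by simp
      also have "\<dots> \<le> 3/5 * (C * ?p) + C / 5 * ?p"
        using C(2)[of k i] by (intro add_left_mono mult_right_mono) auto
      also have "\<dots> = C * (4/5) ^ Suc m" by simp
      finally show ?case .
    qed
    then show ?thesis by blast
  qed (use incr_decay_0 in simp)
qed

text \<open>
  \<open>fundamental i x\<close> is the formal power series in \<open>t\<close> of the solution of \<open>\<Delta> u = t u\<close> with
  boundary values \<open>u (q j) = \<delta>\<^sub>i\<^sub>j\<close>.
\<close>

definition fundamental :: "3 \<Rightarrow> real^2 \<Rightarrow> real fps" where
  "fundamental i x = Abs_fps (\<lambda>n. lim (\<lambda>m. approx m i x $ n))"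

lemma uniform_limit_approx:
  "uniform_limit (SG q) (\<lambda>m x. approx m i x $ n) (\<lambda>x. fundamental i x $ n) sequentially"
proof -
  obtain C where C: "\<And>m i x. x \<in> SG q \<Longrightarrow> \<bar>incr m i x $ n\<bar> \<le> C * (4/5) ^ m"
    using incr_decay[of n] by blast
  have "uniform_limit (SG q) (\<lambda>m x. \<Sum>j<m. incr j i x $ n) (\<lambda>x. suminf (\<lambda>j. incr j i x $ n)) sequentially"
    by (rule Weierstrass_m_test[where M = "\<lambda>m. C * (4/5) ^ m"]) (auto intro: C summable_mult summable_geometric)
  moreover have "(\<Sum>j<m. incr j i x $ n) = approx m i x $ n - approx 0 i x $ n" for m x
    unfolding incr_def fps_sub_nth by (rule sum_lessThan_telescope)
  ultimately have "uniform_limit (SG q) (\<lambda>m x. approx m i x $ n - approx 0 i x $ n)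
      (\<lambda>x. suminf (\<lambda>j. incr j i x $ n)) sequentially"
    by simp
  then have "uniform_limit (SG q) (\<lambda>m x. (approx m i x $ n - approx 0 i x $ n) + approx 0 i x $ n)
      (\<lambda>x. suminf (\<lambda>j. incr j i x $ n) + approx 0 i x $ n) sequentially"
    by (intro uniform_limit_add uniform_limit_const)
  then have u: "uniform_limit (SG q) (\<lambda>m x. approx m i x $ n)
      (\<lambda>x. suminf (\<lambda>j. incr j i x $ n) + approx 0 i x $ n) sequentially"
    by simp
  have "fundamental i x $ n = suminf (\<lambda>j. incr j i x $ n) + approx 0 i x $ n" if "x \<in> SG q" for x
    using limI[OF tendsto_uniform_limitI[OF u that]] by (simp add: fundamental_def del: approx.simps)
  then show ?thesis using u by (simp cong: uniform_limit_cong')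
qed

lemma tendsto_approx: "x \<in> SG q \<Longrightarrow> (\<lambda>m. approx m i x $ n) \<longlonglongrightarrow> fundamental i x $ n"
  by (rule tendsto_uniform_limitI[OF uniform_limit_approx])

lemma continuous_fundamental: "continuous_on (SG q) (\<lambda>x. fundamental i x $ n)"
  by (rule uniform_limit_theorem[OF _ uniform_limit_approx]) (simp_all add: continuous_approx)

lemma sum_fundamental_nth_0: "x \<in> SG q \<Longrightarrow> (\<Sum>i\<in>UNIV. fundamental i x $ 0) = 1"
proof -
  assume x: "x \<in> SG q"
  have "(\<lambda>m. \<Sum>i\<in>UNIV. approx m i x $ 0) \<longlonglongrightarrow> (\<Sum>i\<in>UNIV. fundamental i x $ 0)"
    by (intro tendsto_sum tendsto_approx x)
  then show ?thesis unfolding sum_approx_nth_0[OF x] by (simp add: LIMSEQ_const_iff)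
qed

lemma fundamental_corner: "fundamental i (q j) = of_bool (i = j)"
proof (rule fps_ext)
  fix n
  have "(\<lambda>m. approx m i (q j) $ n) \<longlonglongrightarrow> fundamental i (q j) $ n"
    by (rule tendsto_approx) simp
  then show "fundamental i (q j) $ n = of_bool (i = j) $ n"
    unfolding approx_corner_F(1) by (simp add: LIMSEQ_const_iff)
qed

lemma fundamental_F:
  assumes "x \<in> SG q"
  shows "fundamental i (F k x) = (\<Sum>l\<in>UNIV. ext k l i * D (fundamental l x))"
proof (rule fps_ext)
  fix n
  have "(\<lambda>m. \<Sum>l\<in>UNIV. \<Sum>s = 0..n. ext k l i $ s * ((1/5) ^ (n - s) * approx m l x $ (n - s))) \<longlonglongrightarrow>
      (\<Sum>l\<in>UNIV. \<Sum>s = 0..n. ext k l i $ s * ((1/5) ^ (n - s) * fundamental l x $ (n - s)))"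
    by (intro tendsto_intros tendsto_approx assms)
  then have "(\<lambda>m. approx (Suc m) i (F k x) $ n) \<longlonglongrightarrow> (\<Sum>l\<in>UNIV. ext k l i * D (fundamental l x)) $ n"
    unfolding approx_corner_F(2)[OF assms] by (simp add: fps_sum_nth fps_mult_D_nth)
  moreover have "(\<lambda>m. approx (Suc m) i (F k x) $ n) \<longlonglongrightarrow> fundamental i (F k x) $ n"
    using tendsto_approx[of "F k x" i n] assms by (intro LIMSEQ_Suc) simp
  ultimately show "fundamental i (F k x) $ n = (\<Sum>l\<in>UNIV. ext k l i * D (fundamental l x)) $ n"
    by (rule LIMSEQ_unique[rotated])
qed

primrec defect_factor :: "nat \<Rightarrow> real fps" where
  "defect_factor 0 = 1"
| "defect_factor (Suc m) = (ea + eb) * D (defect_factor m)"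

lemma L_ext_D:
  "L m (\<lambda>y. \<Sum>l\<in>UNIV. ext k l i * D (u l y)) x = (\<Sum>l\<in>UNIV. ext k l i * D (L m (u l) x))"
  unfolding L_sum L_cmult by (simp add: L_additive[of D] dil_add dil_diff)

lemma L_fundamental_cell:
  "x \<in> SG q \<Longrightarrow> L m (\<lambda>y. fundamental i (F k y)) x = (\<Sum>l\<in>UNIV. ext k l i * D (L m (fundamental l) x))"
  unfolding L_ext_D[symmetric] by (rule L_cong) (simp_all add: fundamental_F)

text \<open>Both summands reproduce themselves under subdivision: the first because cell
  \<open>j\<close> keeps its corner \<open>q j\<close>, the second by
  \<open>ext_corner_defect\<close>.\<close>

lemma L_fundamental_corner:
  "2 * L m (fundamental i) (q j) = Zs m * of_bool (i = j) + defect_factor m * corner_defect i j"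
proof (induction m arbitrary: i)
  case 0
  show ?case
    using exhaust_index3[of i j] by (auto simp: L_0 fundamental_corner corner_defect_def)
next
  case (Suc m)
  have "2 * L (Suc m) (fundamental i) (q j) = (\<Sum>l\<in>UNIV. ext j l i * D (2 * L m (fundamental l) (q j)))"
    unfolding L_corner by (simp add: L_fundamental_cell sum_distrib_left dil_mult mult_ac)
  also have "\<dots> = (\<Sum>l\<in>UNIV. Zs (Suc m) * (of_bool (l = j) * ext j l i)) +
      D (defect_factor m) * (\<Sum>l\<in>UNIV. ext j l i * D (corner_defect l j))"
    unfolding Suc by (simp add: dil_add dil_mult D_Zs sum.distrib[symmetric] sum_distrib_left algebra_simps)
  also have "(\<Sum>l\<in>UNIV. Zs (Suc m) * (of_bool (l = j) * ext j l i)) = Zs (Suc m) * of_bool (i = j)"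
    by (simp add: sum_distrib_left[symmetric] sum_index3[of _ j] ext_self)
  finally show ?case by (simp add: ext_corner_defect mult_ac)
qed

text \<open>New vertices are junctions, where the two half contributions of \<open>Zs\<close> add up
  to a full one and the defects cancel by \<open>ext_junction\<close>.\<close>

lemma L_fundamental:
  "x \<in> V m - V 0 \<Longrightarrow> L m (fundamental i) x = Zs m * fundamental i x"
proof (induction m arbitrary: i x)
  case (Suc m)
  from Suc.prems show ?case
  proof (cases rule: vertex_cases)
    case (interior k y)
    then have y: "y \<in> SG q" using V_subset_SG by blast
    have "L (Suc m) (fundamental i) x = (\<Sum>l\<in>UNIV. ext k l i * D (Zs m * fundamental l y))"
      unfolding interior(2) L_interior[OF interior(1)] L_fundamental_cell[OF y] Suc.IH[OF interior(1)] ..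
    also have "\<dots> = Zs (Suc m) * fundamental i x"
      unfolding interior(2) fundamental_F[OF y] by (simp add: dil_mult D_Zs sum_distrib_left mult_ac)
    finally show ?thesis .
  next
    case (junction k l)
    have val: "fundamental i (F k (q l)) = ext k l i" for k l
      by (simp add: fundamental_F fundamental_corner of_bool_def if_distrib cong: if_cong)
    have half: "2 * L m (\<lambda>y. fundamental i (F k y)) (q l) =
        Zs (Suc m) * ext k l i + D (defect_factor m) * (\<Sum>j\<in>UNIV. ext k j i * D (corner_defect j l))" for k l
    proof -
      have "2 * L m (\<lambda>y. fundamental i (F k y)) (q l) = (\<Sum>j\<in>UNIV. ext k j i * D (2 * L m (fundamental j) (q l)))"
        by (simp add: L_fundamental_cell sum_distrib_left dil_mult mult_ac)
      also have "\<dots> = (\<Sum>j\<in>UNIV. Zs (Suc m) * (of_bool (j = l) * ext k j i)) +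
          D (defect_factor m) * (\<Sum>j\<in>UNIV. ext k j i * D (corner_defect j l))"
        unfolding L_fundamental_corner
        by (simp add: dil_add dil_mult D_Zs sum.distrib[symmetric] sum_distrib_left algebra_simps)
      also have "(\<Sum>j\<in>UNIV. Zs (Suc m) * (of_bool (j = l) * ext k j i)) = Zs (Suc m) * ext k l i"
        by (simp add: sum_distrib_left[symmetric] sum_index3[of _ l])
      finally show ?thesis .
    qed
    have "2 * L (Suc m) (fundamental i) x = 2 * (Zs (Suc m) * ext k l i) + D (defect_factor m) *
      ((\<Sum>j\<in>UNIV. ext k j i * D (corner_defect j l)) + (\<Sum>j\<in>UNIV. ext l j i * D (corner_defect j k)))"
      unfolding junction(2) L_junction[OF junction(1)] distrib_left half
      by (simp add: ext_commute[of l k] algebra_simps)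
    then have "2 * L (Suc m) (fundamental i) x = 2 * (Zs (Suc m) * fundamental i x)"
      unfolding ext_junction[OF junction(1)] junction(2) val by simp
    then show ?thesis by simp
  qed
qed simp


section \<open>Solutions with prescribed jets\<close>

definition comb :: "(3 \<Rightarrow> real fps) \<Rightarrow> real^2 \<Rightarrow> real fps" where
  "comb v x = (\<Sum>i\<in>UNIV. v i * fundamental i x)"

lemma comb_corner [simp]: "comb v (q j) = v j"
  by (simp add: comb_def fundamental_corner of_bool_def if_distrib cong: if_cong)

lemma comb_mult: "comb (\<lambda>i. c * v i) x = c * comb v x"
  by (simp add: comb_def sum_distrib_left mult.assoc)

lemma continuous_comb: "continuous_on (SG q) (\<lambda>x. comb v x $ n)"
  unfolding comb_def fps_sum_nth fps_mult_nth by (intro continuous_intros continuous_fundamental)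

lemma L_comb: "x \<in> V m - V 0 \<Longrightarrow> L m (comb v) x = Zs m * comb v x"
  unfolding comb_def L_sum L_cmult by (simp add: L_fundamental sum_distrib_left mult_ac del: vertices.simps)

lemma L_nth: "L m (\<lambda>x. f x $ n) x = L m f x $ n" for f :: "real^2 \<Rightarrow> real fps"
  by (rule L_additive[of "\<lambda>f. f $ n"]) simp_all

text \<open>The components 1, 2, 3 are the value, the normal and the tangential derivative at \<open>q j\<close>.\<close>

definition jet :: "3 \<Rightarrow> (3 \<Rightarrow> real fps) \<Rightarrow> 3 \<Rightarrow> real fps" where
  "jet j v k = (if k = 1 then v j
     else if k = 2 then - (fps_const (1/2) * kappa * (\<Sum>i\<in>UNIV. v i * corner_defect i j))
     else inverse W * (v (j + 1) - v (j - 1)))"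

text \<open>Multiplication by \<open>beta_fps\<close> turns the product of the factors
  \<open>ea + eb\<close> into a dilation, whose behaviour for large \<open>m\<close> is
  evident.\<close>

lemma defect_factor_beta: "5 ^ m * (defect_factor m * beta_fps) = 3 ^ m * dil (1 / 5 ^ m) beta_fps"
proof (induction m)
  case 0
  show ?case by (simp add: dil_one)
next
  case (Suc m)
  have D5: "D (5 ^ m) = 5 ^ m" "D (3 ^ m) = 3 ^ m"
    by (induction m) (simp_all add: dil_mult)
  have "5 ^ m * (D (defect_factor m) * D beta_fps) = 3 ^ m * dil (1 / 5 ^ Suc m) beta_fps"
    using arg_cong[OF Suc, of D] by (simp add: dil_mult dil_dil D5)
  moreover have "5 ^ Suc m * (defect_factor (Suc m) * beta_fps) =
      5 ^ m * D (defect_factor m) * (5 * (ea + eb) * beta_fps)"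
    by (simp add: mult_ac)
  ultimately show ?case unfolding beta_functional_eq by (simp add: mult_ac)
qed

lemma corner_defect_jet: "(\<Sum>i\<in>UNIV. v i * corner_defect i j) = 4 * beta_fps * jet j v 2"
proof -
  define S where "S = (\<Sum>i\<in>UNIV. v i * corner_defect i j)"
  define h where "h = fps_const (1/2 :: real)"
  have "h * 2 = 1" unfolding h_def by (rule fps_double_half)
  then have "S = 4 * beta_fps * (- (h * kappa * S))" using kappa_beta by algebra
  then show ?thesis by (simp add: jet_def S_def h_def)
qed

lemma fps_const_power_quotient: "fps_const ((3/5) ^ m) * 5 ^ m = (3 ^ m :: real fps)"
  by (simp add: numeral_fps_const fps_const_power power_divide)

text \<open>Exact on every level, not only in the limit: the half-weighted relation at
  \<open>q j\<close> fails only by a multiple of the normal derivative. Both the value of the normal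
  derivative and the graph form of Neumann conditions come from here.\<close>

lemma L_comb_corner:
  "L m (comb v) (q j) = fps_const (1/2) * Zs m * v j +
     2 * jet j v 2 * (fps_const ((3/5) ^ m) * dil (1 / 5 ^ m) beta_fps)"
proof -
  have "2 * L m (comb v) (q j) = (\<Sum>i\<in>UNIV. v i * (2 * L m (fundamental i) (q j)))"
    unfolding comb_def L_sum L_cmult by (simp add: sum_distrib_left mult_ac)
  also have "\<dots> = Zs m * v j + defect_factor m * (\<Sum>i\<in>UNIV. v i * corner_defect i j)"
    unfolding L_fundamental_corner sum_index3[of _ j] by (simp add: algebra_simps)
  also have "defect_factor m * (\<Sum>i\<in>UNIV. v i * corner_defect i j) = 4 * jet j v 2 * (defect_factor m * beta_fps)"
    unfolding corner_defect_jet by (simp add: mult_ac)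
  finally have 1: "2 * L m (comb v) (q j) = Zs m * v j + 4 * jet j v 2 * (defect_factor m * beta_fps)" .
  have 2: "5 ^ m * (defect_factor m * beta_fps) = 5 ^ m * (fps_const ((3/5) ^ m) * dil (1 / 5 ^ m) beta_fps)"
    unfolding defect_factor_beta fps_const_power_quotient[symmetric] by (simp add: mult_ac)
  have "defect_factor m * beta_fps = fps_const ((3/5) ^ m) * dil (1 / 5 ^ m) beta_fps"
    by (rule mult_left_cancel[THEN iffD1, OF _ 2]) simp
  with 1 have 3: "2 * L m (comb v) (q j) = Zs m * v j + 4 * jet j v 2 * (fps_const ((3/5) ^ m) * dil (1 / 5 ^ m) beta_fps)"
    by simp
  have "fps_const (1/2) * (2 * L m (comb v) (q j)) = fps_const (1/2) * Zs m * v j +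
      (fps_const (1/2) * 2) * (2 * jet j v 2 * (fps_const ((3/5) ^ m) * dil (1 / 5 ^ m) beta_fps))"
    unfolding 3 by algebra
  then show ?thesis unfolding mult.assoc[symmetric] fps_double_half by simp
qed

primrec tangent_factor :: "nat \<Rightarrow> real fps" where
  "tangent_factor 0 = 1"
| "tangent_factor (Suc m) = (ea - eb) * D (tangent_factor m)"

lemma tangent_factor_W: "5 ^ m * (tangent_factor m * W) = dil (1 / 5 ^ m) W"
proof (induction m)
  case 0
  show ?case by (simp add: dil_one)
next
  case (Suc m)
  have D5: "D (5 ^ m) = 5 ^ m" by (induction m) (simp_all add: dil_mult)
  have 1: "5 ^ m * (D (tangent_factor m) * D W) = dil (1 / 5 ^ Suc m) W"
    using arg_cong[OF Suc, of D] by (simp add: dil_mult dil_dil D5)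
  have "5 ^ Suc m * (tangent_factor (Suc m) * W) = 5 ^ m * D (tangent_factor m) * ((ea - eb) * (5 * W))"
    by (simp add: mult_ac)
  also have "(ea - eb) * (5 * W) = D W"
    unfolding W_functional_eq using ea_minus_eb by algebra
  finally show ?case unfolding 1[symmetric] by (simp only: mult_ac)
qed

lemma ext_antisymmetric':
  "ext j (j + 1) i - ext j (j - 1) i = (ea - eb) * (of_bool (i = j + 1) - of_bool (i = j - 1))"
  using ext_antisymmetric[of j i] ea_minus_eb by algebra

text \<open>The difference sees only the part antisymmetric about \<open>q j\<close>, which each
  subdivision multiplies by \<open>ea - eb\<close>, the reciprocal of \<open>5 + Zs 1\<close>;
  \<open>W\<close> collects these factors.\<close>

lemma fundamental_tangent:
  "fundamental i ((F j ^^ m) (q (j + 1))) - fundamental i ((F j ^^ m) (q (j - 1))) =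
     tangent_factor m * (of_bool (i = j + 1) - of_bool (i = j - 1))"
proof (induction m arbitrary: i)
  case 0
  show ?case by (simp add: fundamental_corner)
next
  case (Suc m)
  have "fundamental i ((F j ^^ Suc m) (q (j + 1))) - fundamental i ((F j ^^ Suc m) (q (j - 1))) =
    (\<Sum>l\<in>UNIV. ext j l i * D (fundamental l ((F j ^^ m) (q (j + 1))) - fundamental l ((F j ^^ m) (q (j - 1)))))"
    by (simp add: fundamental_F iterate_F_in_SG dil_diff right_diff_distrib sum_subtractf)
  also have "\<dots> = D (tangent_factor m) * (ext j (j + 1) i - ext j (j - 1) i)"
    unfolding Suc sum_index3[of _ j] dil_mult dil_diff dil_of_bool by (simp add: algebra_simps)
  also have "\<dots> = tangent_factor (Suc m) * (of_bool (i = j + 1) - of_bool (i = j - 1))"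
    unfolding ext_antisymmetric' by (simp add: mult_ac)
  finally show ?case .
qed

lemma comb_tangent:
  "5 ^ m * (comb v ((F j ^^ m) (q (j + 1))) - comb v ((F j ^^ m) (q (j - 1)))) = jet j v 3 * dil (1 / 5 ^ m) W"
proof -
  have "comb v ((F j ^^ m) (q (j + 1))) - comb v ((F j ^^ m) (q (j - 1))) =
      (\<Sum>i\<in>UNIV. v i * (tangent_factor m * (of_bool (i = j + 1) - of_bool (i = j - 1))))"
    unfolding fundamental_tangent[symmetric] comb_def by (simp add: right_diff_distrib sum_subtractf)
  also have "\<dots> = tangent_factor m * (v (j + 1) - v (j - 1))"
    unfolding sum_index3[of _ j] by (simp add: algebra_simps)
  finally have 1: "comb v ((F j ^^ m) (q (j + 1))) - comb v ((F j ^^ m) (q (j - 1))) = tangent_factor m * (v (j + 1) - v (j - 1))" .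
  have iW: "inverse W * W = 1" by (rule inverse_mult_eq_1) simp
  show ?thesis unfolding 1 tangent_factor_W[symmetric] using iW by (simp add: jet_def mult_ac)
qed

lemma bounded_comb: "\<exists>B. \<forall>x\<in>SG q. \<bar>comb v x $ n\<bar> \<le> B"
proof -
  have "bounded ((\<lambda>x. comb v x $ n) ` SG q)"
    by (intro compact_imp_bounded compact_continuous_image compact_SG continuous_comb)
  then show ?thesis unfolding bounded_iff by auto
qed

lemma tendsto_scaled_Zs: "(\<lambda>m. 3/2 * 5 ^ m * Zs m $ s) \<longlonglongrightarrow> of_bool (s = 1)"
proof -
  consider "s = 0" | "s = 1" | r where "s = Suc (Suc r)" by (metis One_nat_def not0_implies_Suc)
  then show ?thesis
  proof cases
    case 3
    have lim: "(\<lambda>m. (1 / 5 ^ Suc r) ^ m * (3/2 * (2/3) ^ s * Psi $ s)) \<longlonglongrightarrow> 0 * (3/2 * (2/3) ^ s * Psi $ s)"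
      using one_less_power[of "5::real" "Suc r"] by (intro tendsto_intros LIMSEQ_power_zero) auto
    have eq: "3/2 * 5 ^ m * Zs m $ s = (1 / 5 ^ Suc r) ^ m * (3/2 * (2/3) ^ s * Psi $ s)" for m
    proof -
      have "(5::real) ^ m * (1 / 5 ^ m) ^ s = (1 / 5 ^ Suc r) ^ m"
        by (simp add: 3 power_divide power_mult[symmetric] power_mult_distrib power_add mult.commute)
      then have "3/2 * (2/3) ^ s * Psi $ s * ((5::real) ^ m * (1 / 5 ^ m) ^ s) = 3/2 * (2/3) ^ s * Psi $ s * (1 / 5 ^ Suc r) ^ m"
        by (rule arg_cong)
      moreover have "Zs m $ s = (2/3) ^ s * (1 / 5 ^ m) ^ s * Psi $ s"
        by (simp add: Zs_nth power_divide power_mult_distrib)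
      ultimately show ?thesis by (simp only: mult_ac)
    qed
    show ?thesis using lim unfolding eq[symmetric] by (simp only: mult_zero_left) (simp add: 3)
  qed (simp_all add: Zs_nth)
qed

text \<open>Coefficientwise \<open>3/2 * 5 ^ m * Zs m\<close> tends to \<open>fps_X\<close>. Only
  finitely many coefficients of \<open>comb v\<close> enter, each bounded on the gasket, so the
  convergence is uniform.\<close>

lemma has_laplacian_comb: "has_laplacian q (\<lambda>x. comb v x $ n) (\<lambda>x. (fps_X * comb v x) $ n)"
  unfolding has_laplacian_iff
proof (intro conjI allI impI)
  show "continuous_on (SG q) (\<lambda>x. comb v x $ n)" by (rule continuous_comb)
  show "continuous_on (SG q) (\<lambda>x. (fps_X * comb v x) $ n)"
    unfolding comb_mult[symmetric] by (rule continuous_comb)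
  fix e :: real assume e: "e > 0"
  have "\<forall>s. \<exists>B. \<forall>x\<in>SG q. \<bar>comb v x $ s\<bar> \<le> B" using bounded_comb by blast
  then obtain B where B: "\<And>s x. x \<in> SG q \<Longrightarrow> \<bar>comb v x $ s\<bar> \<le> B s" by metis
  let ?a = "\<lambda>m s. 3/2 * 5 ^ m * Zs m $ s"
  have "(\<lambda>m. \<Sum>s = 0..n. \<bar>?a m s - of_bool (s = 1)\<bar> * B (n - s)) \<longlonglongrightarrow>
      (\<Sum>s = 0..n. \<bar>of_bool (s = 1) - of_bool (s = 1)\<bar> * B (n - s))"
    by (intro tendsto_intros tendsto_scaled_Zs)
  then have "(\<lambda>m. \<Sum>s = 0..n. \<bar>?a m s - of_bool (s = 1)\<bar> * B (n - s)) \<longlonglongrightarrow> 0" by simp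
  then obtain N where N: "\<And>m. m \<ge> N \<Longrightarrow> \<bar>\<Sum>s = 0..n. \<bar>?a m s - of_bool (s = 1)\<bar> * B (n - s)\<bar> < e"
    using e unfolding LIMSEQ_iff by auto
  have "\<bar>3/2 * 5 ^ m * L m (\<lambda>x. comb v x $ n) x - (fps_X * comb v x) $ n\<bar> < e"
    if m: "m \<ge> N" and x: "x \<in> V m - V 0" for m x
  proof -
    have xS: "x \<in> SG q" using x V_subset_SG by blast
    have X: "(fps_X * comb v x) $ n = (\<Sum>s = 0..n. of_bool (s = 1) * comb v x $ (n - s))"
      unfolding fps_mult_nth by (intro sum.cong) (auto simp: fps_X_def)
    have "3/2 * 5 ^ m * L m (\<lambda>x. comb v x $ n) x = (\<Sum>s = 0..n. ?a m s * comb v x $ (n - s))"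
      unfolding L_nth L_comb[OF x] fps_mult_nth sum_distrib_left by (simp add: mult.assoc)
    then have "3/2 * 5 ^ m * L m (\<lambda>x. comb v x $ n) x - (fps_X * comb v x) $ n =
        (\<Sum>s = 0..n. (?a m s - of_bool (s = 1)) * comb v x $ (n - s))"
      unfolding X left_diff_distrib sum_subtractf by simp
    also have "\<bar>\<dots>\<bar> \<le> (\<Sum>s = 0..n. \<bar>?a m s - of_bool (s = 1)\<bar> * B (n - s))"
      by (rule order_trans[OF sum_abs]) (auto simp: abs_mult intro!: sum_mono mult_left_mono B[OF xS])
    also have "\<dots> < e" using N[OF m] by simp
    finally show ?thesis .
  qed
  then show "\<exists>N. \<forall>m\<ge>N. \<forall>x\<in>V m - V 0. \<bar>3/2 * 5 ^ m * L m (\<lambda>x. comb v x $ n) x - (fps_X * comb v x) $ n\<bar> < e"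
    by blast
qed

lemma has_normal_deriv_iff:
  "has_normal_deriv q u j d \<longleftrightarrow> (\<lambda>m. - ((5/3) ^ m * L m u (q j))) \<longlonglongrightarrow> d"
proof -
  have "(5/3) ^ m * (2 * u (q j) - u ((F j ^^ m) (q (j + 1))) - u ((F j ^^ m) (q (j - 1)))) =
      - ((5/3) ^ m * L m u (q j))" for m
    unfolding L_corner_explicit mult_minus_right[symmetric] by simp
  then show ?thesis unfolding has_normal_deriv_def by simp
qed

lemma tendsto_geometric_Zs_mult:
  assumes "\<bar>c\<bar> < 5"
  shows "(\<lambda>m. c ^ m * (Zs m * f) $ n) \<longlonglongrightarrow> 0"
proof -
  have "(\<lambda>m. \<Sum>s = 0..n. (c ^ m * Zs m $ s) * f $ (n - s)) \<longlonglongrightarrow> (\<Sum>s = 0..n. 0 * f $ (n - s))"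
    by (intro tendsto_intros tendsto_geometric_Zs assms)
  then show ?thesis by (simp add: fps_mult_nth sum_distrib_left mult.assoc)
qed

lemma has_normal_deriv_comb: "has_normal_deriv q (\<lambda>x. comb v x $ n) j (jet j v 2 $ n)"
proof -
  have "(\<lambda>m. - (1/2 * ((5/3) ^ m * (Zs m * v j) $ n)) - 2 * (jet j v 2 * dil (1 / 5 ^ m) beta_fps) $ n)
      \<longlonglongrightarrow> - (1/2 * 0) - 2 * (jet j v 2 $ n * beta_fps $ 0)"
    by (intro tendsto_intros tendsto_geometric_Zs_mult tendsto_dil_nth) simp
  moreover have "- (1/2 * ((5/3) ^ m * (Zs m * v j) $ n)) - 2 * (jet j v 2 * dil (1 / 5 ^ m) beta_fps) $ n =
      - ((5/3) ^ m * L m (\<lambda>x. comb v x $ n) (q j))" for m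
  proof -
    have "L m (comb v) (q j) = fps_const (1/2) * (Zs m * v j) +
        fps_const (2 * (3/5) ^ m) * (jet j v 2 * dil (1 / 5 ^ m) beta_fps)"
      unfolding L_comb_corner fps_const_mult[symmetric] by (simp add: numeral_fps_const mult_ac)
    then have "L m (comb v) (q j) $ n = 1/2 * (Zs m * v j) $ n +
        2 * (3/5) ^ m * (jet j v 2 * dil (1 / 5 ^ m) beta_fps) $ n"
      by (simp only: fps_add_nth fps_mult_left_const_nth)
    moreover have "(5/3) ^ m * (3/5) ^ m = (1::real)" by (simp add: power_mult_distrib[symmetric])
    ultimately show ?thesis unfolding L_nth by (simp add: algebra_simps)
  qed
  ultimately show ?thesis unfolding has_normal_deriv_iff by simp
qed

lemma has_tangential_deriv_comb: "has_tangential_deriv q (\<lambda>x. comb v x $ n) j (jet j v 3 $ n)"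
proof -
  have "(5 ^ m * f) $ n = 5 ^ m * f $ n" for m and f :: "real fps"
    by (simp add: numeral_fps_const fps_const_power)
  then have "5 ^ m * (comb v ((F j ^^ m) (q (j + 1))) $ n - comb v ((F j ^^ m) (q (j - 1))) $ n) =
      (jet j v 3 * dil (1 / 5 ^ m) W) $ n" for m
    unfolding comb_tangent[symmetric] by simp
  then show ?thesis
    unfolding has_tangential_deriv_def using tendsto_dil_nth[of "jet j v 3" W n] by simp
qed

section \<open>Sup-norm bounds, Dirichlet uniqueness and jet uniqueness\<close>

lemma comparison:
  obtains c where "c \<ge> 0"
    "\<And>u f b M x. \<lbrakk>has_laplacian q u f; \<And>x. x \<in> SG q \<Longrightarrow> \<bar>f x\<bar> \<le> M; \<And>i. \<bar>u (q i)\<bar> \<le> b; x \<in> SG q\<rbrakk>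
       \<Longrightarrow> \<bar>u x\<bar> \<le> b + c * M"
proof -
  \<comment> \<open>The linear coefficient of the solution with all boundary values 1. Its constant
    coefficient is 1 and \<open>Zs m\<close> has no constant term, so \<open>L m ?g\<close> is the
    linear coefficient of \<open>Zs m\<close>, exactly \<open>2 / (3 * 5 ^ m)\<close>.\<close>
  let ?g = "\<lambda>x. comb (\<lambda>_. 1) x $ 1"
  have g0: "comb (\<lambda>_. 1) x $ 0 = 1" if "x \<in> SG q" for x
    using sum_fundamental_nth_0[OF that] by (simp add: comb_def fps_sum_nth)
  have g: "continuous_on (SG q) ?g" "\<And>i. ?g (q i) = 0"
    "3/2 * 5 ^ m * L m ?g x = 1" if "x \<in> V m - V 0" for m x
  proof -
    have "x \<in> SG q" using that V_subset_SG by blast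
    then show "3/2 * 5 ^ m * L m ?g x = 1"
      unfolding L_nth L_comb[OF that] by (simp add: fps_mult_nth g0 Zs_nth)
  qed (simp_all add: continuous_comb)
  obtain c where c: "\<And>x. x \<in> SG q \<Longrightarrow> \<bar>?g x\<bar> \<le> c" using bounded_comb[of "\<lambda>_. 1" 1] by blast
  have c0: "c \<ge> 0" using c[OF q_in_SG[of 0]] by linarith
  have cont: "continuous_on (SG q) ?g" by (rule continuous_comb)
  have upper: "u x \<le> b + c * M"
    if "has_laplacian q u f" "\<And>x. x \<in> SG q \<Longrightarrow> \<bar>f x\<bar> \<le> M" "\<And>i. \<bar>u (q i)\<bar> \<le> b" "x \<in> SG q" for u f b M x
  proof -
    have M0: "M \<ge> 0" using that(2)[OF that(4)] by linarith
    have "u x + M * ?g x \<le> b"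
    proof (rule comparison_upper[OF that(1) _ _ cont _ _ that(4)])
      show "- M \<le> f x" if "x \<in> SG q" for x using \<open>\<And>x. x \<in> SG q \<Longrightarrow> \<bar>f x\<bar> \<le> M\<close>[OF that] by linarith
      show "u (q i) \<le> b" for i using that(3)[of i] by linarith
    qed (use g in auto)
    moreover have "\<bar>M * ?g x\<bar> \<le> M * c"
      unfolding abs_mult using M0 c[OF that(4)] by (intro mult_mono) auto
    ultimately show ?thesis by (simp add: mult.commute abs_le_iff)
  qed
  show ?thesis
  proof
    fix u f b M x
    assume A: "has_laplacian q u f" "\<And>x. x \<in> SG q \<Longrightarrow> \<bar>f x\<bar> \<le> M" "\<And>i. \<bar>u (q i)\<bar> \<le> b" "x \<in> SG q"
    have "- u x \<le> b + c * M"
      using upper[of "\<lambda>x. - u x" "\<lambda>x. - f x" M b x] has_laplacian_cmult[OF A(1), of "-1"] A by simp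
    then show "\<bar>u x\<bar> \<le> b + c * M" using upper[OF A] by linarith
  qed (rule c0)
qed

lemma dirichlet_zero:
  assumes "has_laplacian q u f" "\<And>x. x \<in> SG q \<Longrightarrow> f x = 0" "\<And>i. u (q i) = 0" "x \<in> SG q"
  shows "u x = 0"
  using comparison[of "u x = 0"] assms by (metis abs_le_zero_iff abs_zero add.right_neutral mult_zero_right order_refl)

text \<open>A harmonic function is the constant coefficient of a \<open>comb\<close> by Dirichlet
  uniqueness. Vanishing value and derivatives at \<open>q l\<close> then say that the two other
  corner values have sum 0 and difference 0.\<close>

lemma jet_uniqueness:
  assumes u: "has_laplacian q u f" "\<And>x. x \<in> SG q \<Longrightarrow> f x = 0"
    and j: "u (q l) = 0" "has_normal_deriv q u l 0" "has_tangential_deriv q u l 0"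
    and x: "x \<in> SG q"
  shows "u x = 0"
proof -
  define v where "v i = fps_const (u (q i))" for i
  have v: "has_laplacian q (\<lambda>x. comb v x $ 0) (\<lambda>x. (fps_X * comb v x) $ 0)"
    by (rule has_laplacian_comb)
  have eq: "u x = comb v x $ 0" if "x \<in> SG q" for x
    using dirichlet_zero[OF has_laplacian_diff[OF u(1) v] _ _ that] u(2) by (simp add: v_def)
  have it: "(F j ^^ m) (q i) \<in> SG q" for j m i by (simp add: iterate_F_in_SG)
  have "has_normal_deriv q (\<lambda>x. comb v x $ 0) l 0" "has_tangential_deriv q (\<lambda>x. comb v x $ 0) l 0"
    using j(2,3) unfolding has_normal_deriv_def has_tangential_deriv_def by (simp_all add: eq[symmetric] it del: comb_corner)
  then have "jet l v 2 $ 0 = 0" "jet l v 3 $ 0 = 0"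
    using has_normal_deriv_comb[of v 0 l] has_tangential_deriv_comb[of v 0 l]
    unfolding has_normal_deriv_def has_tangential_deriv_def by (auto dest: LIMSEQ_unique)
  then have "2 * v (l + 1) $ 0 + 2 * v (l - 1) $ 0 = 0" "v (l + 1) $ 0 = v (l - 1) $ 0"
    using j(1) by (simp_all add: jet_def sum_index3[of _ l] corner_defect_def kappa_nth_0 v_def)
  then have "u (q (l + 1)) = 0" "u (q (l - 1)) = 0" by (simp_all add: v_def)
  then have "u (q i) = 0" for i using j(1) exhaust_index3[of i l] by auto
  then show ?thesis using dirichlet_zero[OF u _ x] by simp
qed

definition jet_basis :: "3 \<Rightarrow> 3 \<Rightarrow> 3 \<Rightarrow> real fps" where
  "jet_basis l k i = (if k = 1 then (if i = l then 1 else alpha_fps)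
     else if k = 2 then (if i = l then 0 else beta_fps)
     else if i = l then 0 else if i = l + 1 then gamma_fps else - gamma_fps)"

abbreviation sol :: "3 \<Rightarrow> 3 \<Rightarrow> real^2 \<Rightarrow> real fps" where
  "sol l k \<equiv> comb (jet_basis l k)"

lemma jet_basis_expansion: "v i = (\<Sum>k\<in>UNIV. jet j v k * jet_basis j k i)"
proof -
  define h where "h = fps_const (1/2 :: real)"
  have h: "h * 2 = 1" unfolding h_def by (rule fps_double_half)
  have j2: "jet j v 2 = - (h * kappa * (v j * (- 4 - Zs 0) + v (j + 1) * 2 + v (j - 1) * 2))"
    by (simp add: jet_def sum_index3[of _ j] corner_defect_def h_def)
  have j3: "jet j v 3 = inverse W * (v (j + 1) - v (j - 1))" and j1: "jet j v 1 = v j"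
    by (simp_all add: jet_def)
  have a: "v (j + 1) = v j * alpha_fps + jet j v 2 * beta_fps + jet j v 3 * gamma_fps"
  proof -
    \<comment> \<open>The factor 4 clears the constant fractions, which leaves an identity in the
      ring generated by the known relations.\<close>
    have "4 * v (j + 1) = 4 * (v j * alpha_fps + jet j v 2 * beta_fps + jet j v 3 * gamma_fps)"
      unfolding j2 j3 using h kappa_beta alpha_eq gamma_eq inverse_W by algebra
    then show ?thesis by (rule mult_left_cancel[THEN iffD1, rotated]) simp
  qed
  have b: "v (j - 1) = v j * alpha_fps + jet j v 2 * beta_fps - jet j v 3 * gamma_fps"
  proof -
    have "4 * v (j - 1) = 4 * (v j * alpha_fps + jet j v 2 * beta_fps - jet j v 3 * gamma_fps)"
      unfolding j2 j3 using h kappa_beta alpha_eq gamma_eq inverse_W by algebra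
    then show ?thesis by (rule mult_left_cancel[THEN iffD1, rotated]) simp
  qed
  show ?thesis
    using exhaust_index3[of i j] a b by (auto simp: sum_3 jet_basis_def j1)
qed

text \<open>With \<open>v\<close> the basis at another corner this is the change of expansion point
  for generating functions; the jets that occur are the entries of the connection matrix.\<close>

lemma comb_expansion: "comb v x = (\<Sum>k\<in>UNIV. jet j v k * sol j k x)"
proof -
  have "comb v x = (\<Sum>i\<in>UNIV. \<Sum>k\<in>UNIV. jet j v k * jet_basis j k i * fundamental i x)"
    unfolding comb_def by (subst jet_basis_expansion[of v _ j]) (simp add: sum_distrib_right)
  also have "\<dots> = (\<Sum>k\<in>UNIV. \<Sum>i\<in>UNIV. jet j v k * jet_basis j k i * fundamental i x)"
    by (rule sum.swap)
  finally show ?thesis by (simp add: comb_def sum_distrib_left mult.assoc)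
qed

lemma jet_jet_basis: "jet l (jet_basis l k) k' = of_bool (k = k')"
proof -
  define h where "h = fps_const (1/2 :: real)"
  have h: "h * 2 = 1" unfolding h_def by (rule fps_double_half)
  have "- 4 - Zs 0 + alpha_fps * 2 + alpha_fps * 2 = 0" using alpha_eq by algebra
  moreover have "- (h * kappa * (beta_fps * 2 + beta_fps * 2)) = 1" using h kappa_beta by algebra
  moreover have "inverse W * (gamma_fps + gamma_fps) = 1"
    unfolding mult_2[symmetric] gamma_eq by (rule inverse_W)
  ultimately show ?thesis
    using exhaust_3[of k] exhaust_3[of k']
    by (elim disjE) (simp_all add: jet_def sum_index3[of _ l] jet_basis_def corner_defect_def flip: h_def)
qed

section \<open>The monomials\<close>

lemma laplacian_power_comb:
  "(laplacian q ^^ m) (restrict (\<lambda>x. comb v x $ n) (SG q)) = restrict (\<lambda>x. (fps_X ^ m * comb v x) $ n) (SG q)"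
proof (induction m)
  case (Suc m)
  have "has_laplacian q (restrict (\<lambda>x. (fps_X ^ m * comb v x) $ n) (SG q)) (\<lambda>x. (fps_X ^ Suc m * comb v x) $ n)"
    using has_laplacian_comb[of "\<lambda>i. fps_X ^ m * v i" n] unfolding comb_mult
    by (subst has_laplacian_cong) (auto simp: mult.assoc)
  then show ?case unfolding funpow.simps(2) o_apply Suc by (rule laplacian_eq)
qed simp

lemma multiharmonic_step:
  assumes "P \<in> multiharmonic q j" "m \<le> j"
  shows "has_laplacian q ((laplacian q ^^ m) P) ((laplacian q ^^ Suc m) P)"
proof -
  obtain f where f: "has_laplacian q ((laplacian q ^^ m) P) f"
    using assms unfolding multiharmonic_def dom_laplacian_def by blast
  have "(laplacian q ^^ Suc m) P = restrict f (SG q)"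
    using laplacian_eq[OF f] by simp
  then show ?thesis using f by (auto intro: has_laplacian_transfer)
qed

definition monomial_jets :: "3 \<Rightarrow> nat \<Rightarrow> 3 \<Rightarrow> (real^2 \<Rightarrow> real) \<Rightarrow> bool" where
  "monomial_jets l j k P \<longleftrightarrow> (\<forall>m\<le>j. (laplacian q ^^ m) P (q l) = of_bool (m = j \<and> k = 1) \<and>
     has_normal_deriv q ((laplacian q ^^ m) P) l (of_bool (m = j \<and> k = 2)) \<and>
     has_tangential_deriv q ((laplacian q ^^ m) P) l (of_bool (m = j \<and> k = 3)))"

lemma has_normal_deriv_diff:
  "has_normal_deriv q u j d \<Longrightarrow> has_normal_deriv q v j d' \<Longrightarrow> has_normal_deriv q (\<lambda>x. u x - v x) j (d - d')"
  unfolding has_normal_deriv_iff L_diff by (drule (1) tendsto_diff) (simp add: algebra_simps)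

lemma has_tangential_deriv_diff:
  "has_tangential_deriv q u j d \<Longrightarrow> has_tangential_deriv q v j d' \<Longrightarrow>
   has_tangential_deriv q (\<lambda>x. u x - v x) j (d - d')"
  unfolding has_tangential_deriv_def by (drule (1) tendsto_diff) (simp add: algebra_simps)

text \<open>Downward in the power of the Laplacian: once \<open>P\<close> and \<open>Q\<close> agree
  after \<open>m + 1\<close> applications, their difference after \<open>m\<close> applications is
  harmonic with zero jet.\<close>

lemma monomial_unique:
  assumes "P \<in> multiharmonic q j" "monomial_jets l j k P"
    and "Q \<in> multiharmonic q j" "monomial_jets l j k Q"
    and "x \<in> SG q"
  shows "P x = Q x"
proof -
  have "\<forall>x\<in>SG q. (laplacian q ^^ (Suc j - i)) P x = (laplacian q ^^ (Suc j - i)) Q x" if "i \<le> Suc j" for i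
    using that
  proof (induction i)
    case 0
    show ?case using assms(1,3) by (simp add: multiharmonic_def)
  next
    case (Suc i)
    define m where "m = j - i"
    have m: "Suc j - Suc i = m" "Suc j - i = Suc m" "m \<le> j" using Suc.prems by (auto simp: m_def)
    let ?P = "(laplacian q ^^ m) P" and ?Q = "(laplacian q ^^ m) Q"
    have "?P x - ?Q x = 0" if "x \<in> SG q" for x
    proof (rule jet_uniqueness[where u = "\<lambda>x. ?P x - ?Q x", OF _ _ _ _ _ that])
      show "has_laplacian q (\<lambda>x. ?P x - ?Q x) (\<lambda>x. (laplacian q ^^ Suc m) P x - (laplacian q ^^ Suc m) Q x)"
        by (intro has_laplacian_diff multiharmonic_step[OF assms(1)] multiharmonic_step[OF assms(3)] m)
      show "(laplacian q ^^ Suc m) P x - (laplacian q ^^ Suc m) Q x = 0" if "x \<in> SG q" for x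
        using Suc that unfolding m by simp
      show "?P (q l) - ?Q (q l) = 0"
        using assms(2,4) m(3) unfolding monomial_jets_def by simp
      show "has_normal_deriv q (\<lambda>x. ?P x - ?Q x) l 0"
        using has_normal_deriv_diff[of ?P l _ ?Q] assms(2,4) m(3) unfolding monomial_jets_def by fastforce
      show "has_tangential_deriv q (\<lambda>x. ?P x - ?Q x) l 0"
        using has_tangential_deriv_diff[of ?P l _ ?Q] assms(2,4) m(3) unfolding monomial_jets_def by fastforce
    qed
    then show ?case unfolding m by simp
  qed
  from this[of "Suc j"] show ?thesis using assms(5) by simp
qed

lemma normal_tangential_restrict:
  "has_normal_deriv q (restrict u (SG q)) j d \<longleftrightarrow> has_normal_deriv q u j d"
  "has_tangential_deriv q (restrict u (SG q)) j d \<longleftrightarrow> has_tangential_deriv q u j d"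
  unfolding has_normal_deriv_def has_tangential_deriv_def by (simp_all add: iterate_F_in_SG)

text \<open>The Laplacian multiplies the generating function by \<open>fps_X\<close>, so
  \<open>m\<close> applications turn coefficient \<open>j\<close> into coefficient
  \<open>j - m\<close>; the jet of the generating function is constant, hence nonzero only for
  \<open>m = j\<close>.\<close>

theorem monomial_eq: "monomial q l j k = restrict (\<lambda>x. sol l k x $ j) (SG q)"
proof -
  let ?P = "restrict (\<lambda>x. sol l k x $ j) (SG q)"
  have lap: "(laplacian q ^^ m) ?P = restrict (\<lambda>x. comb (\<lambda>i. fps_X ^ m * jet_basis l k i) x $ j) (SG q)" for m
    unfolding comb_mult by (rule laplacian_power_comb)
  have mh: "?P \<in> multiharmonic q j"
  proof -
    have "has_laplacian q (restrict (\<lambda>x. comb v x $ n) (SG q)) (\<lambda>x. (fps_X * comb v x) $ n)" for v n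
      by (rule has_laplacian_transfer[OF has_laplacian_comb]) auto
    then have "(laplacian q ^^ m) ?P \<in> dom_laplacian q" for m
      unfolding lap dom_laplacian_def by blast
    moreover have "(laplacian q ^^ (j + 1)) ?P x = 0" if "x \<in> SG q" for x
      unfolding laplacian_power_comb using that by (simp only: restrict_apply' fps_X_power_mult_nth) simp
    ultimately show ?thesis unfolding multiharmonic_def by blast
  qed
  have jet_X: "jet l (\<lambda>i. fps_X ^ m * v i) k' = fps_X ^ m * jet l v k'" for m v k'
    unfolding jet_def by (simp add: sum_distrib_left algebra_simps)
  have jets: "jet l (\<lambda>i. fps_X ^ m * jet_basis l k i) k' $ j = of_bool (m = j \<and> k = k')" if "m \<le> j" for m k'
    unfolding jet_X jet_jet_basis using that by (auto simp: fps_X_power_mult_nth)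
  have mj: "monomial_jets l j k ?P"
    unfolding monomial_jets_def lap normal_tangential_restrict
  proof (intro allI impI conjI)
    fix m assume m: "m \<le> j"
    let ?v = "\<lambda>i. fps_X ^ m * jet_basis l k i"
    have "comb ?v (q l) = jet l ?v 1" by (simp add: jet_def)
    then show "restrict (\<lambda>x. comb ?v x $ j) (SG q) (q l) = of_bool (m = j \<and> k = 1)"
      using jets[OF m, of 1] by (simp only: restrict_apply' q_in_SG)
    show "has_normal_deriv q (\<lambda>x. comb ?v x $ j) l (of_bool (m = j \<and> k = 2))"
      using has_normal_deriv_comb[of ?v j l] unfolding jets[OF m] .
    show "has_tangential_deriv q (\<lambda>x. comb ?v x $ j) l (of_bool (m = j \<and> k = 3))"
      using has_tangential_deriv_comb[of ?v j l] unfolding jets[OF m] .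
  qed
  show ?thesis
    unfolding monomial_def monomial_jets_def[symmetric]
  proof (rule the_equality)
    show "?P \<in> extensional (SG q) \<and> ?P \<in> multiharmonic q j \<and> monomial_jets l j k ?P"
      using mh mj by simp
    show "P = ?P" if "P \<in> extensional (SG q) \<and> P \<in> multiharmonic q j \<and> monomial_jets l j k P" for P
      using that monomial_unique[OF _ _ mh mj] by (intro extensionalityI[of _ "SG q"]) auto
  qed
qed

end

section \<open>Radii of convergence\<close>

text \<open>The weighted absolute-sum norm at radius \<open>r\<close>, stated through partial sums
  so that it makes sense before convergence is known. It is submultiplicative.\<close>

definition coeffs_bounded :: "real \<Rightarrow> real fps \<Rightarrow> real \<Rightarrow> bool" where
  "coeffs_bounded r f C \<longleftrightarrow> (\<forall>n. (\<Sum>j<n. \<bar>f $ j\<bar> * r ^ j) \<le> C)"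

lemma coeffs_bounded_nonneg: "coeffs_bounded r f C \<Longrightarrow> C \<ge> 0"
  unfolding coeffs_bounded_def by (drule spec[of _ 0]) simp

lemma coeffs_bounded_mono: "coeffs_bounded r f C \<Longrightarrow> C \<le> C' \<Longrightarrow> coeffs_bounded r f C'"
  unfolding coeffs_bounded_def by (meson order_trans)

lemma coeffs_bounded_radius_mono:
  "coeffs_bounded r f C \<Longrightarrow> 0 \<le> r' \<Longrightarrow> r' \<le> r \<Longrightarrow> coeffs_bounded r' f C"
  unfolding coeffs_bounded_def
  by (meson abs_ge_zero mult_left_mono order_trans power_mono sum_mono)

lemma coeffs_bounded_add:
  assumes "coeffs_bounded r f A" "coeffs_bounded r g B" "r \<ge> 0"
  shows "coeffs_bounded r (f + g) (A + B)"
  unfolding coeffs_bounded_def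
proof
  fix n
  have "(\<Sum>j<n. \<bar>(f + g) $ j\<bar> * r ^ j) \<le> (\<Sum>j<n. \<bar>f $ j\<bar> * r ^ j + \<bar>g $ j\<bar> * r ^ j)"
    using assms(3) by (intro sum_mono) (auto simp: distrib_right[symmetric] intro!: mult_right_mono abs_triangle_ineq)
  also have "\<dots> \<le> A + B"
    using assms unfolding coeffs_bounded_def sum.distrib by (intro add_mono) auto
  finally show "(\<Sum>j<n. \<bar>(f + g) $ j\<bar> * r ^ j) \<le> A + B" .
qed

lemma coeffs_bounded_sum:
  assumes "\<And>i. i \<in> I \<Longrightarrow> coeffs_bounded r (f i) (A i)" "r \<ge> 0" "finite I"
  shows "coeffs_bounded r (\<Sum>i\<in>I. f i) (\<Sum>i\<in>I. A i)"
  using assms(3,1)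
proof (induction I)
  case empty
  show ?case by (simp add: coeffs_bounded_def)
qed (simp add: coeffs_bounded_add assms(2))

lemma coeffs_bounded_mult:
  assumes "coeffs_bounded r f A" "coeffs_bounded r g B" "r \<ge> 0"
  shows "coeffs_bounded r (f * g) (A * B)"
  unfolding coeffs_bounded_def
proof
  fix n
  let ?a = "\<lambda>j. \<bar>f $ j\<bar> * r ^ j" and ?b = "\<lambda>j. \<bar>g $ j\<bar> * r ^ j"
  have nn: "?a i \<ge> 0" "?b i \<ge> 0" for i using assms(3) by auto
  have "\<bar>(f * g) $ j\<bar> * r ^ j \<le> (\<Sum>i\<le>j. ?a i * ?b (j - i))" for j
  proof -
    have "\<bar>(f * g) $ j\<bar> * r ^ j \<le> (\<Sum>i\<le>j. \<bar>f $ i * g $ (j - i)\<bar>) * r ^ j"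
      unfolding fps_mult_nth atLeast0AtMost using assms(3) by (intro mult_right_mono sum_abs) auto
    also have "\<dots> = (\<Sum>i\<le>j. ?a i * ?b (j - i))"
      unfolding sum_distrib_right
    proof (intro sum.cong refl)
      fix i assume "i \<in> {..j}"
      then have "r ^ j = r ^ i * r ^ (j - i)" by (simp add: power_add[symmetric])
      then show "\<bar>f $ i * g $ (j - i)\<bar> * r ^ j = ?a i * ?b (j - i)" by (simp add: abs_mult mult_ac)
    qed
    finally show ?thesis .
  qed
  then have "(\<Sum>j<n. \<bar>(f * g) $ j\<bar> * r ^ j) \<le> (\<Sum>j<n. \<Sum>i\<le>j. ?a i * ?b (j - i))"
    by (rule sum_mono)
  also have "\<dots> = (\<Sum>(i,j)\<in>{(i,j). i + j < n}. ?a i * ?b j)"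
    by (rule sum.triangle_reindex[symmetric])
  also have "\<dots> \<le> (\<Sum>(i,j)\<in>{..<n} \<times> {..<n}. ?a i * ?b j)"
    using nn by (intro sum_mono2) auto
  also have "\<dots> = (\<Sum>i<n. ?a i) * (\<Sum>j<n. ?b j)"
    by (simp add: sum_product sum.cartesian_product)
  also have "\<dots> \<le> A * B"
    using assms nn coeffs_bounded_nonneg[OF assms(1)] unfolding coeffs_bounded_def
    by (intro mult_mono sum_nonneg) auto
  finally show "(\<Sum>j<n. \<bar>(f * g) $ j\<bar> * r ^ j) \<le> A * B" .
qed

lemma coeffs_bounded_const: "\<bar>c\<bar> \<le> C \<Longrightarrow> coeffs_bounded r (fps_const c) C"
  unfolding coeffs_bounded_def
proof
  fix n assume c: "\<bar>c\<bar> \<le> C"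
  have "(\<Sum>j<n. \<bar>fps_const c $ j\<bar> * r ^ j) = (\<Sum>j<n. if j = 0 then \<bar>c\<bar> else 0)"
    by (intro sum.cong) auto
  also have "\<dots> \<le> C" using c order_trans[OF abs_ge_zero c] by simp
  finally show "(\<Sum>j<n. \<bar>fps_const c $ j\<bar> * r ^ j) \<le> C" .
qed

lemma coeffs_bounded_dil:
  assumes "c \<ge> 0"
  shows "coeffs_bounded r (dil c f) C \<longleftrightarrow> coeffs_bounded (c * r) f C"
  using assms by (simp add: coeffs_bounded_def abs_mult power_mult_distrib mult_ac)

lemma coeffs_bounded_if_geometric:
  assumes "\<And>j. \<bar>f $ j\<bar> \<le> K * s ^ j" "r * s = 1/2" "s \<ge> 0" "r \<ge> 0" "K \<ge> 0"
  shows "coeffs_bounded r f (2 * K)"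
  unfolding coeffs_bounded_def
proof
  fix n
  have "(\<Sum>j<n. \<bar>f $ j\<bar> * r ^ j) \<le> (\<Sum>j<n. K * (1/2) ^ j)"
  proof (rule sum_mono)
    fix j
    have "\<bar>f $ j\<bar> * r ^ j \<le> K * s ^ j * r ^ j"
      using assms by (intro mult_right_mono) auto
    also have "\<dots> = K * (1/2) ^ j" unfolding assms(2)[symmetric] by (simp add: power_mult_distrib mult_ac)
    finally show "\<bar>f $ j\<bar> * r ^ j \<le> K * (1/2) ^ j" .
  qed
  also have "\<dots> = K * (2 - 2 * (1/2) ^ n)"
    unfolding sum_distrib_left[symmetric] by (simp add: sum_gp_strict)
  also have "\<dots> \<le> K * 2" using assms(5) by (intro mult_left_mono) auto
  finally show "(\<Sum>j<n. \<bar>f $ j\<bar> * r ^ j) \<le> 2 * K" by simp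
qed

lemma coeffs_bounded_nth:
  assumes "coeffs_bounded r f C" "r > 0"
  shows "\<bar>f $ j\<bar> \<le> C * (1 / r) ^ j"
proof -
  have "\<bar>f $ j\<bar> * r ^ j \<le> (\<Sum>j<Suc j. \<bar>f $ j\<bar> * r ^ j)"
    using assms(2) by (intro member_le_sum) auto
  also have "\<dots> \<le> C" using assms(1) unfolding coeffs_bounded_def by blast
  finally show ?thesis using assms(2) by (simp add: field_simps power_divide)
qed

lemma coeffs_bounded_if_radius:
  assumes "ereal r < fps_conv_radius f" "r \<ge> 0"
  shows "\<exists>C. coeffs_bounded r f C"
proof -
  have "summable (\<lambda>n. norm (f $ n * r ^ n))"
    using assms by (intro abs_summable_in_conv_radius) (simp add: fps_conv_radius_def)
  then have "summable (\<lambda>n. \<bar>f $ n\<bar> * r ^ n)" using assms(2) by (simp add: abs_mult)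
  then have "(\<Sum>j<n. \<bar>f $ j\<bar> * r ^ j) \<le> suminf (\<lambda>n. \<bar>f $ n\<bar> * r ^ n)" for n
    using assms(2) by (intro sum_le_suminf) auto
  then show ?thesis unfolding coeffs_bounded_def by blast
qed

lemma radius_if_coeffs_bounded:
  assumes "coeffs_bounded r f C" "r \<ge> 0"
  shows "fps_conv_radius f \<ge> ereal r"
proof -
  have "summable (\<lambda>n. \<bar>f $ n\<bar> * r ^ n)"
  proof (rule summableI_nonneg_bounded)
    show "(\<Sum>j<n. \<bar>f $ j\<bar> * r ^ j) \<le> C" for n using assms(1) unfolding coeffs_bounded_def by blast
  qed (use assms(2) in auto)
  then have "summable (\<lambda>n. norm (f $ n * r ^ n))" using assms(2) by (simp add: abs_mult)
  then have "summable (\<lambda>n. f $ n * r ^ n)" by (rule summable_norm_cancel)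
  from conv_radius_geI[OF this] show ?thesis using assms(2) by (simp add: fps_conv_radius_def)
qed

text \<open>The radii \<open>5 ^ k / 2\<close> fit the functional equations, each use of which
  enlarges the radius by the factor 5.\<close>

lemma radius_infinite:
  assumes "\<And>k. \<exists>C. coeffs_bounded (5 ^ k / 2) f C"
  shows "fps_conv_radius f = \<infinity>"
proof (rule ereal_top)
  fix B :: real
  obtain k where k: "2 * B < 5 ^ k" using real_arch_pow[of 5 "2 * B"] by auto
  obtain C where "coeffs_bounded (5 ^ k / 2) f C" using assms by blast
  then have "ereal (5 ^ k / 2) \<le> fps_conv_radius f" by (rule radius_if_coeffs_bounded) simp
  moreover have "ereal B \<le> ereal (5 ^ k / 2)" using k by simp
  ultimately show "ereal B \<le> fps_conv_radius f" by (rule order_trans[rotated])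
qed

text \<open>The convolution has \<open>n - 1\<close> terms, each at most 1, and \<open>n - 1\<close>
  does not exceed the denominator \<open>5 ^ n - 5\<close>.\<close>

lemma Psi_le_1: "Psi $ n \<le> 1"
proof (induction n rule: less_induct)
  case (less n)
  show ?case
  proof (cases "n < 2")
    case False
    have pow: "real n + 4 \<le> 5 ^ n"
      using False
    proof (induction n)
      case (Suc n)
      show ?case
      proof (cases "n < 2")
        case True
        with Suc.prems have "n = 1" by simp
        then show ?thesis by simp
      qed (use Suc in simp)
    qed simp
    have "Psi $ n = (\<Sum>i\<in>{1..<n}. Psi $ i * Psi $ (n - i)) / (5 ^ n - 5)"
      using False unfolding Psi_def fps_nth_Abs_fps by (subst psi_coeff.simps) simp
    moreover have "(\<Sum>i\<in>{1..<n}. Psi $ i * Psi $ (n - i)) \<le> (\<Sum>i\<in>{1..<n}. 1)"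
      using less Psi_nth_nonneg by (intro sum_mono mult_le_one) auto
    moreover have "(\<Sum>i\<in>{1..<n}. 1) \<le> (5 ^ n - 5 :: real)" using pow False by simp
    ultimately show ?thesis using pow False by (simp add: divide_le_eq_1)
  qed (auto simp: Psi_def psi_coeff.simps)
qed

lemma radius_Psi: "fps_conv_radius Psi = \<infinity>"
proof (rule radius_infinite)
  fix k
  show "\<exists>C. coeffs_bounded (5 ^ k / 2) Psi C"
  proof (induction k)
    case 0
    have "coeffs_bounded (1/2) Psi (2 * 1)"
      by (rule coeffs_bounded_if_geometric[where s = 1]) (use Psi_le_1 Psi_nth_nonneg in auto)
    then show ?case by auto
  next
    case (Suc k)
    then obtain C where C: "coeffs_bounded (5 ^ k / 2) Psi C" by blast
    have "coeffs_bounded (5 ^ k / 2) (Psi * (fps_const 5 + Psi)) (C * (5 + C))"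
      by (intro coeffs_bounded_mult coeffs_bounded_add coeffs_bounded_const C) auto
    then have "coeffs_bounded (5 ^ k / 2) (dil 5 Psi) (C * (5 + C))"
      unfolding Psi_functional_eq by (simp add: numeral_fps_const)
    then show ?case by (auto simp: coeffs_bounded_dil)
  qed
qed

lemma radius_dil_infinite:
  assumes "fps_conv_radius f = \<infinity>" "c \<ge> 0"
  shows "fps_conv_radius (dil c f) = \<infinity>"
proof (rule radius_infinite)
  fix k
  show "\<exists>C. coeffs_bounded (5 ^ k / 2) (dil c f) C"
    unfolding coeffs_bounded_dil[OF assms(2)]
    by (rule coeffs_bounded_if_radius) (use assms in auto)
qed

lemma radius_Zs: "fps_conv_radius (Zs m) = \<infinity>"
  unfolding Zs_def by (rule radius_dil_infinite[OF radius_Psi]) simp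

text \<open>The sum in the recursion is dominated by a geometric series of total at most 1/3, while
  the denominator is at least 4/5.\<close>

lemma abs_G_le_1: "\<bar>G $ n\<bar> \<le> 1"
proof (induction n rule: less_induct)
  case (less n)
  show ?case
  proof (cases "n = 0")
    case False
    have p: "(1/5::real) ^ n \<le> (1/5) ^ 1" using False by (intro power_decreasing) auto
    have geo: "(\<Sum>i\<in>{1..m}. (1/2::real) ^ i) = 1 - (1/2) ^ m" for m
      by (induction m) (auto simp: atLeastAtMostSuc_conv)
    have "\<bar>Zs 2 $ i / 3 * (1/5) ^ (n - i) * G $ (n - i)\<bar> \<le> (1/2) ^ i * (1/3)" if "i \<in> {1..n}" for i
    proof -
      have "\<bar>Zs 2 $ i\<bar> \<le> (1/2) ^ i * 1"
        unfolding Zs_nth abs_mult using Psi_nth_nonneg Psi_le_1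
        by (intro mult_mono) (auto simp: power_abs intro!: power_mono)
      moreover have "\<bar>(1/5) ^ (n - i) * G $ (n - i)\<bar> \<le> 1"
        using less[of "n - i"] that unfolding abs_mult by (intro mult_le_one) (auto simp: power_abs intro: power_le_one)
      ultimately have "\<bar>Zs 2 $ i / 3\<bar> * \<bar>(1/5) ^ (n - i) * G $ (n - i)\<bar> \<le> ((1/2) ^ i * (1/3)) * 1"
        by (intro mult_mono) auto
      then show ?thesis by (simp add: abs_mult mult.assoc)
    qed
    then have "\<bar>\<Sum>i\<in>{1..n}. Zs 2 $ i / 3 * (1/5) ^ (n - i) * G $ (n - i)\<bar> \<le> (\<Sum>i\<in>{1..n}. (1/2) ^ i * (1/3))"
      by (intro order_trans[OF sum_abs] sum_mono)
    also have "\<dots> \<le> 1/3" unfolding sum_distrib_right[symmetric] geo by simp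
    finally have "\<bar>\<Sum>i\<in>{1..n}. Zs 2 $ i / 3 * (1/5) ^ (n - i) * G $ (n - i)\<bar> \<le> 1 - (1/5) ^ n"
      using p by simp
    moreover have "G $ n = (\<Sum>i\<in>{1..n}. Zs 2 $ i / 3 * (1/5) ^ (n - i) * G $ (n - i)) / (1 - (1/5) ^ n)"
      using False unfolding G_def fps_nth_Abs_fps by (subst G_coeff.simps) simp
    ultimately show ?thesis using p by (simp add: abs_divide divide_le_eq_1)
  qed simp
qed

lemma radius_G: "fps_conv_radius G = \<infinity>"
proof (rule radius_infinite)
  fix k
  show "\<exists>C. coeffs_bounded (5 ^ k / 2) G C"
  proof (induction k)
    case 0
    have "coeffs_bounded (1/2) G (2 * 1)"
      by (rule coeffs_bounded_if_geometric[where s = 1]) (use abs_G_le_1 in auto)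
    then show ?case by auto
  next
    case (Suc k)
    then obtain C where C: "coeffs_bounded (5 ^ k / 2) G C" by blast
    obtain B where B: "coeffs_bounded (5 ^ Suc k / 2) (fps_const (1/3) * (3 + Zs 2)) B"
      using coeffs_bounded_if_radius[of "5 ^ Suc k / 2" "fps_const (1/3) * (3 + Zs 2)"]
        fps_conv_radius_add[of 3 "Zs 2"] by (auto simp: radius_Zs fps_conv_radius_cmult_left)
    have "coeffs_bounded (5 ^ Suc k / 2) (D G) C" using C by (simp add: coeffs_bounded_dil)
    then have "coeffs_bounded (5 ^ Suc k / 2) (fps_const (1/3) * (3 + Zs 2) * D G) (B * C)"
      by (intro coeffs_bounded_mult B) auto
    moreover have "fps_const (1/3) * (3 + Zs 2) * D G = G"
      using arg_cong[OF G_functional_eq, of "(*) (fps_const (1/3))"]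
      by (simp add: mult.assoc[symmetric] numeral_fps_const)
    ultimately show ?case by auto
  qed
qed

lemma radius_W: "fps_conv_radius W = \<infinity>"
  unfolding W_def by (simp add: fps_conv_radius_cmult_left radius_Zs)

text \<open>
  In the variable of \<open>Psi\<close> the point \<open>- sigma3\<close> is the solution of \<open>Psi = -3\<close> closest to 0; for
  \<open>Zs 2\<close>, which is \<open>Psi (2 t / 75)\<close>, it corresponds to \<open>t = - lambda_star\<close>.
\<close>

definition phi :: "real \<Rightarrow> real" where "phi s = - eval_fps Psi (- s)"

definition sigma3 :: real where "sigma3 = Inf {s. 0 \<le> s \<and> phi s = 3}"

definition lambda_star :: real where "lambda_star = 75 / 2 * sigma3"

lemma eval_dil: "eval_fps (dil c f) z = eval_fps f (c * z)"
  by (simp add: eval_fps_def power_mult_distrib mult_ac)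

lemma phi_functional_eq: "phi (5 * s) = phi s * (5 - phi s)"
proof -
  have "eval_fps (dil 5 Psi) (- s) = eval_fps (Psi * (5 + Psi)) (- s)"
    by (simp only: Psi_functional_eq)
  moreover have "fps_conv_radius (5 + Psi) = \<infinity>"
    using fps_conv_radius_add[of 5 Psi] by (simp add: radius_Psi)
  ultimately have "eval_fps Psi (5 * (- s)) = eval_fps Psi (- s) * (5 + eval_fps Psi (- s))"
    by (simp add: eval_dil eval_fps_mult eval_fps_add radius_Psi)
  then show ?thesis by (simp add: phi_def algebra_simps)
qed

lemma continuous_phi: "continuous_on A phi"
  unfolding phi_def by (intro continuous_intros) (auto simp: radius_Psi)

lemma phi_0 [simp]: "phi 0 = 0"
  by (simp add: phi_def eval_fps_at_0)

lemma phi_deriv_0: "(phi has_field_derivative 1) (at 0)"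
proof -
  have *: "(eval_fps Psi has_field_derivative eval_fps (fps_deriv Psi) (- 0)) (at (- 0))"
    by (rule has_field_derivative_eval_fps) (simp add: radius_Psi)
  have "((\<lambda>s. - eval_fps Psi (- s)) has_field_derivative - (eval_fps (fps_deriv Psi) (- 0) * (- 1))) (at 0)"
    by (intro DERIV_minus DERIV_chain2[where f = "eval_fps Psi" and g = uminus] *) (auto intro!: derivative_eq_intros)
  moreover have "eval_fps (fps_deriv Psi) (- 0) = 1"
    by (simp add: eval_fps_at_0)
  ultimately show ?thesis unfolding phi_def by simp
qed

text \<open>If \<open>phi\<close> stayed below 3, then
  \<open>phi (5 * s) = phi s * (5 - phi s)\<close> would be at least \<open>2 * phi s\<close>
  wherever \<open>phi s\<close> is positive. Iteration from a small \<open>s\<close> with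
  \<open>phi s > 0\<close> then contradicts the bound 3.\<close>

lemma phi_attains_3: "\<exists>s\<ge>0. phi s = 3"
proof (rule ccontr)
  assume no: "\<not> (\<exists>s\<ge>0. phi s = 3)"
  have lt: "phi s < 3" if "s \<ge> 0" for s
  proof (rule ccontr)
    assume "\<not> phi s < 3"
    then have "\<exists>x. 0 \<le> x \<and> x \<le> s \<and> phi x = 3"
      using that by (intro IVT') (auto intro: continuous_phi)
    then show False using no by blast
  qed
  obtain d where d: "d > 0" "\<And>h. 0 < h \<Longrightarrow> h < d \<Longrightarrow> phi 0 < phi (0 + h)"
    using DERIV_pos_inc_right[OF phi_deriv_0] by auto
  define s where "s = d / 2"
  have s: "s > 0" "phi s > 0" using d(1) d(2)[of s] by (auto simp: s_def)
  have grow: "phi (5 ^ k * s) \<ge> 2 ^ k * phi s" for k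
  proof (induction k)
    case (Suc k)
    let ?p = "phi (5 ^ k * s)"
    have p: "?p > 0" using Suc s(2) by (smt (verit) mult_pos_pos zero_less_power)
    have "2 * ?p \<le> ?p * (5 - ?p)"
      using p lt[of "5 ^ k * s"] s(1) mult_left_mono[of 2 "5 - ?p" ?p] by (simp add: mult.commute)
    also have "\<dots> = phi (5 ^ Suc k * s)" using phi_functional_eq[of "5 ^ k * s"] by (simp add: mult.assoc)
    finally show ?case using Suc by simp
  qed simp
  obtain k where "3 / phi s < 2 ^ k" using real_arch_pow[of 2 "3 / phi s"] by auto
  then have "3 < 2 ^ k * phi s" using s(2) by (simp add: field_simps)
  then show False using grow[of k] lt[of "5 ^ k * s"] s(1) by simp
qed

lemma sigma3: "phi sigma3 = 3" "sigma3 > 0" "\<And>s. 0 \<le> s \<Longrightarrow> phi s = 3 \<Longrightarrow> sigma3 \<le> s"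
proof -
  let ?S = "{s. 0 \<le> s \<and> phi s = 3}"
  have "closed ({0..} \<inter> phi -` {3})"
    by (rule continuous_closed_preimage) (auto intro: continuous_phi)
  moreover have "{0..} \<inter> phi -` {3} = ?S" by auto
  ultimately have "closed ?S" by simp
  moreover have "?S \<noteq> {}" using phi_attains_3 by blast
  moreover have bdd: "bdd_below ?S" by (rule bdd_belowI[of _ 0]) auto
  ultimately have "sigma3 \<in> ?S" unfolding sigma3_def by (intro closed_contains_Inf) auto
  moreover from this have "sigma3 \<noteq> 0" by auto
  ultimately show "phi sigma3 = 3" "sigma3 > 0" by auto
  show "sigma3 \<le> s" if "0 \<le> s" "phi s = 3" for s
    unfolding sigma3_def using that bdd by (intro cInf_lower) auto
qed

lemma lambda_star_pos: "lambda_star > 0"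
  using sigma3(2) by (simp add: lambda_star_def)

section \<open>Complex zeros of \<open>3 + Zs 2\<close>\<close>

definition cfps :: "real fps \<Rightarrow> complex fps" where
  "cfps f = Abs_fps (\<lambda>n. complex_of_real (f $ n))"

lemma cfps_nth [simp]: "cfps f $ n = complex_of_real (f $ n)"
  by (simp add: cfps_def)

lemma cfps_add: "cfps (f + g) = cfps f + cfps g"
  and cfps_mult: "cfps (f * g) = cfps f * cfps g"
  and cfps_1: "cfps 1 = 1"
  and cfps_const: "cfps (fps_const c) = fps_const (complex_of_real c)"
  by (simp_all add: fps_eq_iff fps_mult_nth)

lemma cfps_numeral: "cfps (numeral n) = numeral n"
  by (simp add: numeral_fps_const cfps_const)

lemma radius_cfps: "fps_conv_radius (cfps f) = fps_conv_radius f"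
proof -
  have "fps_conv_radius (cfps f) = fps_conv_radius (Abs_fps (\<lambda>n. norm (cfps f $ n)))"
    by (rule fps_conv_radius_norm[symmetric])
  also have "Abs_fps (\<lambda>n. norm (cfps f $ n)) = Abs_fps (\<lambda>n. norm (f $ n))" by simp
  also have "fps_conv_radius \<dots> = fps_conv_radius f" by (rule fps_conv_radius_norm)
  finally show ?thesis .
qed

lemma cfps_inverse:
  assumes "f $ 0 \<noteq> 0"
  shows "cfps (inverse f) = inverse (cfps f)"
proof (rule fps_inverse_unique[symmetric])
  have "f * inverse f = 1" using assms by (rule inverse_mult_eq_1')
  then show "cfps f * cfps (inverse f) = 1" by (simp only: cfps_mult[symmetric] cfps_1)
qed

definition PsiC :: "complex \<Rightarrow> complex" where "PsiC z = eval_fps (cfps Psi) z"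

lemma PsiC_sums: "(\<lambda>n. complex_of_real (Psi $ n) * z ^ n) sums PsiC z"
proof -
  have "(\<lambda>n. cfps Psi $ n * z ^ n) sums eval_fps (cfps Psi) z"
    by (rule sums_eval_fps) (simp add: radius_cfps radius_Psi)
  then show ?thesis by (simp add: PsiC_def)
qed

lemma PsiC_functional_eq: "PsiC (5 * z) = PsiC z * (5 + PsiC z)"
proof -
  have "cfps (dil 5 Psi) = cfps Psi * (5 + cfps Psi)"
    unfolding Psi_functional_eq cfps_mult cfps_add cfps_numeral ..
  then have "eval_fps (cfps (dil 5 Psi)) z = eval_fps (cfps Psi * (5 + cfps Psi)) z" by simp
  moreover have "fps_conv_radius (5 + cfps Psi) = \<infinity>"
    using fps_conv_radius_add[of 5 "cfps Psi"] by (simp add: radius_Psi radius_cfps)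
  moreover have "eval_fps (cfps (dil 5 Psi)) z = PsiC (5 * z)"
    by (simp add: PsiC_def eval_fps_def power_mult_distrib mult_ac)
  ultimately show ?thesis
    by (simp add: PsiC_def eval_fps_mult eval_fps_add radius_Psi radius_cfps)
qed

lemma PsiC_cnj: "PsiC (cnj z) = cnj (PsiC z)"
proof -
  have "(\<lambda>n. cnj (complex_of_real (Psi $ n) * z ^ n)) sums cnj (PsiC z)"
    by (rule sums_cnj[THEN iffD2]) (rule PsiC_sums)
  then have "(\<lambda>n. complex_of_real (Psi $ n) * cnj z ^ n) sums cnj (PsiC z)" by simp
  then show ?thesis using PsiC_sums[of "cnj z"] by (rule sums_unique2[symmetric])
qed

lemma PsiC_of_real: "PsiC (complex_of_real x) = complex_of_real (eval_fps Psi x)"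
proof -
  have "(\<lambda>n. Psi $ n * x ^ n) sums eval_fps Psi x"
    by (rule sums_eval_fps) (simp add: radius_Psi)
  then have "(\<lambda>n. complex_of_real (Psi $ n * x ^ n)) sums complex_of_real (eval_fps Psi x)"
    by (rule sums_of_real)
  then have "(\<lambda>n. complex_of_real (Psi $ n) * complex_of_real x ^ n) sums complex_of_real (eval_fps Psi x)"
    by simp
  then show ?thesis using PsiC_sums by (rule sums_unique2[symmetric])
qed

lemma PsiC_locally_injective: obtains d where "d > 0" "inj_on PsiC (ball 0 d)"
proof -
  have hol: "PsiC holomorphic_on UNIV"
    unfolding PsiC_def by (intro holomorphic_intros) (simp add: radius_cfps radius_Psi)
  have "(PsiC has_field_derivative eval_fps (fps_deriv (cfps Psi)) 0) (at 0)"
    unfolding PsiC_def by (rule has_field_derivative_eval_fps) (simp add: radius_cfps radius_Psi)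
  then have "deriv PsiC 0 = 1" by (simp add: DERIV_imp_deriv eval_fps_at_0)
  then show ?thesis
    using has_complex_derivative_locally_injective[OF hol, of 0] that by auto
qed

lemma eval_Psi_pos: "x > 0 \<Longrightarrow> eval_fps Psi x > 0"
proof -
  assume x: "x > 0"
  have s: "(\<lambda>n. Psi $ n * x ^ n) sums eval_fps Psi x"
    by (rule sums_eval_fps) (simp add: radius_Psi)
  have "(\<Sum>n\<in>{1}. Psi $ n * x ^ n) \<le> suminf (\<lambda>n. Psi $ n * x ^ n)"
    using x by (intro sum_le_suminf sums_summable[OF s]) (auto intro: mult_nonneg_nonneg Psi_nth_nonneg)
  then show ?thesis using x sums_unique[OF s] by simp
qed

text \<open>For \<open>y\<close> in [0, 5] the discriminant \<open>25 - 4 * y\<close> lies between 5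
  and 25, so both roots are real and stay in [-5, 0].\<close>

lemma quadratic_preimage:
  fixes a :: complex
  assumes "a * (5 + a) = - complex_of_real y" "0 \<le> y" "y \<le> 5"
  shows "\<exists>y'. 0 \<le> y' \<and> y' \<le> 5 \<and> a = - complex_of_real y'"
proof -
  define d where "d = sqrt (25 - 4 * y)"
  have d2: "d\<^sup>2 = 25 - 4 * y" and d: "0 \<le> d" using assms(2,3) by (simp_all add: d_def)
  have "d\<^sup>2 \<le> 5\<^sup>2" using d2 assms(2) by simp
  then have d5: "d \<le> 5" by (rule power2_le_imp_le) simp
  have "(a + complex_of_real ((5 - d) / 2)) * (a + complex_of_real ((5 + d) / 2)) =
      a * (5 + a) + complex_of_real ((25 - d\<^sup>2) / 4)"
    by (simp add: field_simps power2_eq_square)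
  also have "\<dots> = 0" using assms(1) d2 by simp
  finally have "a = - complex_of_real ((5 - d) / 2) \<or> a = - complex_of_real ((5 + d) / 2)"
    by (simp only: mult_eq_0_iff eq_neg_iff_add_eq_0)
  then show ?thesis using d d5
    by (elim disjE) (rule exI[of _ "(5 - d) / 2"], simp, rule exI[of _ "(5 + d) / 2"], simp)
qed

text \<open>
  Preimages of \<open>[-5, 0]\<close> under \<open>z (5 + z)\<close> stay in \<open>[-5, 0]\<close>, so the claim reduces to small \<open>w\<close>,
  where \<open>PsiC\<close> is injective and commutes with conjugation.
\<close>

lemma PsiC_real_preimage:
  assumes "PsiC w = - complex_of_real y" "0 \<le> y" "y \<le> 5"
  shows "\<exists>s\<ge>0. w = - complex_of_real s"
proof -
  have pre: "\<exists>y'. 0 \<le> y' \<and> y' \<le> 5 \<and> PsiC (w / 5 ^ k) = - complex_of_real y'" for k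
  proof (induction k)
    case (Suc k)
    then obtain y' where y': "0 \<le> y'" "y' \<le> 5" "PsiC (w / 5 ^ k) = - complex_of_real y'" by blast
    have "PsiC (w / 5 ^ k) = PsiC (w / 5 ^ Suc k) * (5 + PsiC (w / 5 ^ Suc k))"
      using PsiC_functional_eq[of "w / 5 ^ Suc k"] by simp
    then show ?case using quadratic_preimage[of "PsiC (w / 5 ^ Suc k)" y'] y' by simp
  qed (use assms in auto)
  obtain d where d: "d > 0" "inj_on PsiC (ball 0 d)" by (rule PsiC_locally_injective)
  obtain k where k: "norm w / d < 5 ^ k" using real_arch_pow[of 5 "norm w / d"] by auto
  define z where "z = w / 5 ^ k"
  obtain y' where y': "0 \<le> y'" "PsiC z = - complex_of_real y'" unfolding z_def using pre[of k] by blast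
  have nz: "norm z < d" using k d(1) by (simp add: z_def norm_divide norm_power field_simps)
  have "PsiC (cnj z) = PsiC z" unfolding PsiC_cnj y'(2) by simp
  then have "cnj z = z" by (rule inj_onD[OF d(2)]) (use nz in auto)
  then have "z \<in> \<real>" by (simp add: Reals_cnj_iff)
  then obtain x where x: "z = complex_of_real x" by (auto elim: Reals_cases)
  \<comment> \<open>The coefficients of \<open>Psi\<close> are nonnegative, so \<open>Psi\<close> is
    positive on the positive axis.\<close>
  have "x \<le> 0"
  proof (rule ccontr)
    assume "\<not> x \<le> 0"
    then have "eval_fps Psi x > 0" by (intro eval_Psi_pos) simp
    moreover have "complex_of_real (eval_fps Psi x) = complex_of_real (- y')"
      using y'(2) unfolding x PsiC_of_real by simp
    ultimately show False using y'(1) by (simp only: of_real_eq_iff)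
  qed
  moreover have "w = - complex_of_real (5 ^ k * (- x))"
    using x by (simp add: z_def field_simps)
  ultimately show ?thesis by (intro exI[of _ "5 ^ k * (- x)"]) (auto intro: mult_nonneg_nonneg mult_nonneg_nonpos)
qed

lemma PsiC_neq_minus_3:
  assumes "norm w < sigma3"
  shows "PsiC w \<noteq> - 3"
proof
  assume "PsiC w = - 3"
  then obtain s where s: "s \<ge> 0" "w = - complex_of_real s"
    using PsiC_real_preimage[of w 3] by auto
  have "complex_of_real (eval_fps Psi (- s)) = PsiC w" using PsiC_of_real[of "- s"] s(2) by simp
  then have "complex_of_real (eval_fps Psi (- s)) = complex_of_real (- 3)" using \<open>PsiC w = - 3\<close> by simp
  then have "phi s = 3" unfolding of_real_eq_iff phi_def by simp
  then show False using sigma3(3)[OF s(1)] assms s by simp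
qed

lemma radius_inverse_3_Zs: "fps_conv_radius (inverse (3 + Zs 2)) \<ge> ereal lambda_star"
proof -
  have r: "fps_conv_radius (cfps (3 + Zs 2)) = \<infinity>"
    unfolding radius_cfps using fps_conv_radius_add[of 3 "Zs 2"] by (simp add: radius_Zs)
  have "eval_fps (cfps (3 + Zs 2)) z = 3 + PsiC (complex_of_real (2/75) * z)" for z
  proof -
    have "eval_fps (cfps (3 + Zs 2)) z = 3 + eval_fps (cfps (Zs 2)) z"
      unfolding cfps_add cfps_numeral by (subst eval_fps_add) (auto simp: radius_cfps radius_Zs)
    also have "eval_fps (cfps (Zs 2)) z = PsiC (complex_of_real (2/75) * z)"
      by (simp add: PsiC_def eval_fps_def Zs_nth power_mult_distrib power_divide mult_ac)
    finally show ?thesis .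
  qed
  moreover have "3 + PsiC (complex_of_real (2/75) * z) \<noteq> 0" if "ereal (norm z) < ereal lambda_star" for z
  proof -
    have "norm (complex_of_real (2/75) * z) < sigma3"
      using that by (simp add: norm_mult lambda_star_def del: of_real_divide)
    then show ?thesis using PsiC_neq_minus_3 by (metis add.commute add_eq_0_iff)
  qed
  ultimately have "min (ereal lambda_star) (fps_conv_radius (cfps (3 + Zs 2))) \<le>
      fps_conv_radius (inverse (cfps (3 + Zs 2)))"
    by (intro fps_conv_radius_inverse) simp
  then have "ereal lambda_star \<le> fps_conv_radius (inverse (cfps (3 + Zs 2)))" by (simp add: r)
  also have "inverse (cfps (3 + Zs 2)) = cfps (inverse (3 + Zs 2))"
    by (rule cfps_inverse[symmetric]) simp
  finally show ?thesis by (simp add: radius_cfps)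
qed

section \<open>Radius of convergence of \<open>inverse G\<close>\<close>

lemma inverse_G_functional_eq: "inverse G = fps_const 3 * inverse (3 + Zs 2) * D (inverse G)"
proof -
  have i3: "inverse (3 + Zs 2) * (3 + Zs 2) = 1" by (rule inverse_mult_eq_1) simp
  have DG: "D (inverse G) * D G = 1"
    using arg_cong[OF inverse_G, of D] by (simp add: dil_mult)
  have "inverse G = 3 * inverse (3 + Zs 2) * D (inverse G)"
    using i3 DG inverse_G G_functional_eq by algebra
  then show ?thesis by (simp add: numeral_fps_const)
qed

lemma radius_ge_if_coeffs_bounded:
  assumes "\<And>r. 0 \<le> r \<Longrightarrow> r < R \<Longrightarrow> \<exists>C. coeffs_bounded r f C" "R > 0"
  shows "fps_conv_radius f \<ge> ereal R"
proof (rule ereal_le_real)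
  fix z assume fz: "fps_conv_radius f \<le> ereal z"
  show "ereal R \<le> ereal z"
  proof (rule ccontr)
    assume "\<not> ereal R \<le> ereal z"
    then have z: "z < R" by simp
    define y where "y = max 0 ((z + R) / 2)"
    have y: "0 \<le> y" "y < R" using z assms(2) by (auto simp: y_def)
    have "z < (z + R) / 2" using z by simp
    also have "\<dots> \<le> y" by (simp add: y_def)
    finally have "z < y" .
    have "ereal y \<le> fps_conv_radius f"
      using assms(1)[OF y] radius_if_coeffs_bounded[OF _ y(1)] by blast
    then have "ereal y \<le> ereal z" using fz by (rule order_trans)
    then show False using \<open>z < y\<close> by simp
  qed
qed

text \<open>\<open>inverse G\<close> at \<open>t\<close> is its value at \<open>t / 5\<close> times
  a function analytic for |t| < \<Lambda>. Starting from some positive radius, each use of this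
  gains a factor 5 until \<Lambda> is reached.\<close>

lemma radius_inverse_G: "fps_conv_radius (inverse G) \<ge> ereal lambda_star"
proof -
  have "fps_conv_radius (inverse G) > 0"
    by (rule fps_conv_radius_inverse_pos) (simp_all add: radius_G)
  then obtain r0 where r0: "0 < ereal r0" "ereal r0 < fps_conv_radius (inverse G)"
    using ereal_dense2[of 0 "fps_conv_radius (inverse G)"] by blast
  then have r0: "r0 > 0" "ereal r0 < fps_conv_radius (inverse G)" by auto
  have bnd: "\<exists>C. coeffs_bounded r (inverse G) C" if "r \<ge> 0" "r < lambda_star" "r \<le> 5 ^ k * r0" for k r
    using that
  proof (induction k arbitrary: r)
    case 0
    then show ?case
      using coeffs_bounded_if_radius[of r0 "inverse G"] r0 by (auto intro: coeffs_bounded_radius_mono)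
  next
    case (Suc k)
    have "\<exists>C. coeffs_bounded (r / 5) (inverse G) C"
      by (rule Suc.IH) (use Suc.prems in auto)
    then obtain C where C: "coeffs_bounded (r / 5) (inverse G) C" by blast
    then have DC: "coeffs_bounded r (D (inverse G)) C" by (simp add: coeffs_bounded_dil)
    have "ereal r < fps_conv_radius (inverse (3 + Zs 2))"
      using Suc.prems(2) radius_inverse_3_Zs by (meson ereal_less(2) less_ereal.simps(1) less_le_trans)
    then obtain B where "coeffs_bounded r (inverse (3 + Zs 2)) B"
      using coeffs_bounded_if_radius Suc.prems(1) by blast
    then have "coeffs_bounded r (fps_const 3 * inverse (3 + Zs 2) * D (inverse G)) (3 * B * C)"
      using Suc.prems(1) by (intro coeffs_bounded_mult coeffs_bounded_const DC) auto
    then show ?case unfolding inverse_G_functional_eq[symmetric] by blast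
  qed
  show ?thesis
  proof (rule radius_ge_if_coeffs_bounded[OF _ lambda_star_pos])
    fix r assume r: "0 \<le> r" "r < lambda_star"
    obtain k where "r / r0 < 5 ^ k" using real_arch_pow[of 5 "r / r0"] by auto
    then have "r \<le> 5 ^ k * r0" using r0(1) by (simp add: field_simps)
    then show "\<exists>C. coeffs_bounded r (inverse G) C" using bnd r by blast
  qed
qed

section \<open>The connection matrices between corners\<close>

definition n_fps :: "real fps" where "n_fps = fps_const (1/6) * fps_X * (3 + Zs 1) * G"
definition tau_fps :: "real fps" where "tau_fps = - fps_const (1/4) * (2 + Zs 1) * inverse G"

text \<open>
  The power series with coefficients \<^const>\<open>Mmat\<close> (\<open>s = 1\<close>) and \<^const>\<open>Mtilde\<close> (\<open>s = -1\<close>): row \<open>k\<close> is the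
  jet at the next or previous corner of the solution with the \<open>k\<close>-th unit jet.
\<close>

definition conn :: "real \<Rightarrow> 3 \<Rightarrow> 3 \<Rightarrow> real fps" where
  "conn s k k' =
     (if k = 1 then (if k' = 1 then alpha_fps else if k' = 2 then n_fps else fps_const (s/6) * fps_X)
      else if k = 2 then (if k' = 1 then beta_fps else if k' = 2 then fps_const (1/2) - alpha_fps
        else fps_const s * tau_fps)
      else (if k' = 1 then fps_const s * gamma_fps
        else if k' = 2 then fps_const (s/2) * (3 + Zs 1) * G else - fps_const (1/2)))"

lemma tau_eq: "inverse W * beta_fps = tau_fps"
  unfolding beta_fps_def tau_fps_def using inverse_W by algebra

lemma Zs_0_X: "3 * Zs 0 = 2 * fps_X * W"
proof -
  have "3 * Zs 0 = (fps_const 3 * fps_const (2/3)) * fps_X * W"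
    unfolding Zs_0_eq by (simp add: numeral_fps_const mult.assoc del: fps_const_mult)
  then show ?thesis by (simp add: numeral_fps_const)
qed

lemma n_eq: "6 * n_fps = fps_X * (3 + Zs 1) * G"
proof -
  have "6 * n_fps = (fps_const 6 * fps_const (1/6)) * (fps_X * (3 + Zs 1) * G)"
    unfolding n_fps_def by (simp only: numeral_fps_const mult.assoc)
  then show ?thesis by simp
qed

lemma Zs_0_Zs_1: "Zs 0 = Zs 1 * (5 + Zs 1)"
  using Zs_rec[of 0] by simp

text \<open>The denominators of \<open>kappa\<close> cancel here:
  \<open>6 + Zs 0 = (2 + Zs 1) * (3 + Zs 1)\<close> removes \<open>2 + Zs 1\<close>, and
  \<open>W\<close> is removed by \<open>3 * Zs 0 = 2 * fps_X * W\<close> or by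
  \<open>gamma_fps\<close>. In the second claim \<open>kappa * beta_fps\<close> is a
  constant.\<close>

lemma unit_jet_entries:
  fixes h :: "real fps"
  assumes h: "h * 2 = 1"
  shows "- (h * kappa * (2 + alpha_fps * (- 4 - Zs 0) + alpha_fps * 2)) = n_fps"
    and "- (h * kappa * (beta_fps * (- 4 - Zs 0) + beta_fps * 2)) = h - alpha_fps"
    and "- (h * kappa * (gamma_fps * (- 4 - Zs 0) + - gamma_fps * 2)) = h * (3 + Zs 1) * G"
    and "inverse W * (alpha_fps - 1) = fps_const (1/6) * fps_X"
    and "inverse W * gamma_fps = h"
proof -
  have "12 * (- (h * kappa * (2 + alpha_fps * (- 4 - Zs 0) + alpha_fps * 2))) = 12 * n_fps"
    using h alpha_eq kappa_eq Zs_0_X n_eq Zs_0_Zs_1 by algebra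
  then show "- (h * kappa * (2 + alpha_fps * (- 4 - Zs 0) + alpha_fps * 2)) = n_fps"
    by (rule mult_left_cancel[THEN iffD1, rotated]) simp
  have "4 * (- (h * kappa * (beta_fps * (- 4 - Zs 0) + beta_fps * 2))) = 4 * (h - alpha_fps)"
    using h alpha_eq kappa_beta by algebra
  then show "- (h * kappa * (beta_fps * (- 4 - Zs 0) + beta_fps * 2)) = h - alpha_fps"
    by (rule mult_left_cancel[THEN iffD1, rotated]) simp
  have "4 * (- (h * kappa * (gamma_fps * (- 4 - Zs 0) + - gamma_fps * 2))) = 4 * (h * (3 + Zs 1) * G)"
    using h gamma_eq kappa_eq Zs_0_Zs_1 by algebra
  then show "- (h * kappa * (gamma_fps * (- 4 - Zs 0) + - gamma_fps * 2)) = h * (3 + Zs 1) * G"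
    by (rule mult_left_cancel[THEN iffD1, rotated]) simp
  have "6 * fps_const (1/6) = (1 :: real fps)" by (simp add: numeral_fps_const)
  then have "12 * (inverse W * (alpha_fps - 1)) = 12 * (fps_const (1/6) * fps_X)"
    using alpha_eq Zs_0_X inverse_W by algebra
  then show "inverse W * (alpha_fps - 1) = fps_const (1/6) * fps_X"
    by (rule mult_left_cancel[THEN iffD1, rotated]) simp
  show "inverse W * gamma_fps = h"
    using h gamma_eq inverse_W by algebra
qed

context gasket
begin

lemma jet_next: "jet (l + 1) (jet_basis l k) k' = conn 1 k k'"
proof -
  have h: "fps_const (1/2) * 2 = (1 :: real fps)" by (rule fps_double_half)
  note aux = unit_jet_entries[OF h]
  show ?thesis
    using exhaust_3[of k] exhaust_3[of k'] aux(4,5)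
    by (elim disjE) (simp_all add: jet_def sum_index3[of _ l] jet_basis_def corner_defect_def conn_def
      aux(1-3)[simplified] tau_eq)
qed


lemma jet_prev: "jet (l - 1) (jet_basis l k) k' = conn (- 1) k k'"
proof -
  have h: "fps_const (1/2) * 2 = (1 :: real fps)" by (rule fps_double_half)
  note aux = unit_jet_entries[OF h]
  have "inverse W * (1 - alpha_fps) = - (inverse W * (alpha_fps - 1))" by algebra
  also have "\<dots> = fps_const (- (1/6)) * fps_X" unfolding aux(4) by (simp flip: fps_const_neg)
  finally have a: "inverse W * (1 - alpha_fps) = fps_const (- (1/6)) * fps_X" .
  have "- (fps_const (1/2) * kappa * (- gamma_fps * (- 4 - Zs 0) + gamma_fps * 2)) =
      - (- (fps_const (1/2) * kappa * (gamma_fps * (- 4 - Zs 0) + - gamma_fps * 2)))" by algebra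
  also have "\<dots> = fps_const (- (1/2)) * (3 + Zs 1) * G" unfolding aux(3) by (simp flip: fps_const_neg)
  finally have b: "- (fps_const (1/2) * kappa * (- gamma_fps * (- 4 - Zs 0) + gamma_fps * 2)) =
    fps_const (- (1/2)) * (3 + Zs 1) * G" .
  have "- (fps_const (1/2) * kappa * (2 + alpha_fps * 2 + alpha_fps * (- 4 - Zs 0))) = n_fps"
    "- (fps_const (1/2) * kappa * (beta_fps * 2 + beta_fps * (- 4 - Zs 0))) = fps_const (1/2) - alpha_fps"
    unfolding aux(1,2)[symmetric] by (simp_all only: add_ac)
  note d = this
  have c: "fps_const (- 1) = (- 1 :: real fps)" by (simp flip: fps_const_neg)
  show ?thesis
    using exhaust_3[of k] exhaust_3[of k'] aux(5) a b
    by (elim disjE) (simp_all add: jet_def sum_index3[of _ l] jet_basis_def corner_defect_def conn_def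
      d tau_eq c)
qed

lemma jet_self_next_prev: "jet i (jet_basis l k) k' \<in> {of_bool (k = k'), conn 1 k k', conn (- 1) k k'}"
  using exhaust_index3[of i l] jet_jet_basis[of l k k'] jet_next[of l k k'] jet_prev[of l k k'] by auto

text \<open>Restriction to the cell at its own corner rescales the jet: value, normal and tangential
  derivative are multiplied by 1, 3/5 and 1/5, and the parameter becomes
  \<open>t / 5\<close>.\<close>

lemma sol_cell_self:
  assumes "y \<in> SG q"
  shows "sol l k (F l y) = fps_const (if k = 1 then 1 else if k = 2 then 3/5 else 1/5) * D (sol l k y)"
proof -
  let ?c = "fps_const (if k = 1 then 1 else if k = 2 then 3/5 else 1/5) :: real fps"
  have "(\<Sum>i\<in>UNIV. jet_basis l k i * ext l j i) = ?c * D (jet_basis l k j)" for j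
  proof -
    have al: "ea + ea * alpha_fps + eb * alpha_fps = D alpha_fps"
    proof -
      have "4 * D alpha_fps = 4 + Zs 1"
        using arg_cong[OF alpha_eq, of D] by (simp add: dil_mult dil_add D_Zs)
      then have "4 * (ea + ea * alpha_fps + eb * alpha_fps) = 4 * D alpha_fps"
        using alpha_eq ea_eb Zs_0_Zs_1 by algebra
      then show ?thesis by (rule mult_left_cancel[THEN iffD1, rotated]) simp
    qed
    have be: "ea * beta_fps + eb * beta_fps = fps_const (3/5) * D beta_fps"
    proof -
      have "5 * (fps_const (3/5) * D beta_fps) = 3 * D beta_fps"
        unfolding mult.assoc[symmetric] by (simp add: numeral_fps_const)
      also have "\<dots> = 5 * (ea * beta_fps + eb * beta_fps)"
        unfolding beta_functional_eq[symmetric] by (simp only: algebra_simps)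
      finally have "5 * (ea * beta_fps + eb * beta_fps) = 5 * (fps_const (3/5) * D beta_fps)" ..
      then show ?thesis by (rule mult_left_cancel[THEN iffD1, rotated]) simp
    qed
    have ga: "ea * gamma_fps - eb * gamma_fps = fps_const (1/5) * D gamma_fps"
    proof -
      have "5 * fps_const (1/5) = (1 :: real fps)" by (simp add: numeral_fps_const)
      moreover have "2 * D gamma_fps = D W" using arg_cong[OF gamma_eq, of D] by (simp add: dil_mult)
      ultimately have "10 * (ea * gamma_fps - eb * gamma_fps) = 10 * (fps_const (1/5) * D gamma_fps)"
        using gamma_eq W_functional_eq ea_minus_eb by algebra
      then show ?thesis by (rule mult_left_cancel[THEN iffD1, rotated]) simp
    qed
    show ?thesis
      using exhaust_index3[of j l] exhaust_3[of k]
      unfolding sum_index3[of _ l]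
      by (elim disjE; hypsubst) (use al be ga in \<open>simp_all add: jet_basis_def ext_def dil_uminus algebra_simps\<close>)
  qed
  note coeff = this
  have "sol l k (F l y) = (\<Sum>i\<in>UNIV. \<Sum>j\<in>UNIV. jet_basis l k i * ext l j i * D (fundamental j y))"
    unfolding comb_def fundamental_F[OF assms] by (simp add: sum_distrib_left mult.assoc)
  also have "\<dots> = (\<Sum>j\<in>UNIV. (\<Sum>i\<in>UNIV. jet_basis l k i * ext l j i) * D (fundamental j y))"
    unfolding sum_distrib_right by (rule sum.swap)
  also have "\<dots> = ?c * D (sol l k y)"
    unfolding coeff comb_def by (simp add: dil_sum dil_mult sum_distrib_left mult.assoc)
  finally show ?thesis .
qed

text \<open>Re-expansion at the corner whose cell contains the point, followed by rescaling. The
  coefficients do not depend on \<open>y\<close>, so a bound for \<open>sol\<close> at radius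
  \<open>r / 5\<close> yields a uniform bound at radius \<open>r\<close>.\<close>

lemma sol_cell:
  assumes "y \<in> SG q"
  shows "sol l k (F i y) = (\<Sum>k'\<in>UNIV. jet i (jet_basis l k) k' *
      (fps_const (if k' = 1 then 1 else if k' = 2 then 3/5 else 1/5) * D (sol i k' y)))"
  unfolding comb_expansion[of "jet_basis l k" _ i] sol_cell_self[OF assms] ..

end

section \<open>Uniform bounds for the coefficients\<close>

lemma radius_ge_add: "r \<le> fps_conv_radius f \<Longrightarrow> r \<le> fps_conv_radius g \<Longrightarrow> r \<le> fps_conv_radius (f + g)"
  for f g :: "real fps"
  using fps_conv_radius_add[of f g] by (auto simp: min_def split: if_splits intro: order_trans)

lemma radius_ge_diff: "r \<le> fps_conv_radius f \<Longrightarrow> r \<le> fps_conv_radius g \<Longrightarrow> r \<le> fps_conv_radius (f - g)"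
  for f g :: "real fps"
  using fps_conv_radius_diff[of f g] by (auto simp: min_def split: if_splits intro: order_trans)

lemma radius_ge_mult: "r \<le> fps_conv_radius f \<Longrightarrow> r \<le> fps_conv_radius g \<Longrightarrow> r \<le> fps_conv_radius (f * g)"
  for f g :: "real fps"
  using fps_conv_radius_mult[of f g] by (auto simp: min_def split: if_splits intro: order_trans)

lemma radius_ge_basic: "r \<le> fps_conv_radius (fps_const c)" "r \<le> fps_conv_radius (1 :: real fps)"
  "r \<le> fps_conv_radius (0 :: real fps)" "r \<le> fps_conv_radius (numeral n :: real fps)"
  "r \<le> fps_conv_radius (fps_X :: real fps)"
  "r \<le> fps_conv_radius (Zs m)" "r \<le> fps_conv_radius G" "r \<le> fps_conv_radius W"
  "r \<le> fps_conv_radius f \<Longrightarrow> r \<le> fps_conv_radius (- f)" for f :: "real fps" and c :: real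
  by (simp_all add: radius_Zs radius_G radius_W)

lemmas radius_intros = radius_ge_add radius_ge_diff radius_ge_mult radius_ge_basic radius_inverse_G

lemma radius_alpha_beta_gamma:
  "ereal lambda_star \<le> fps_conv_radius alpha_fps" "ereal lambda_star \<le> fps_conv_radius beta_fps"
  "ereal lambda_star \<le> fps_conv_radius gamma_fps"
  unfolding alpha_fps_def beta_fps_def gamma_fps_def by (intro radius_intros)+

lemma radius_conn: "ereal lambda_star \<le> fps_conv_radius (conn s k k')"
  unfolding conn_def n_fps_def tau_fps_def
  by (simp split: if_split, intro conjI impI radius_intros radius_alpha_beta_gamma)

context gasket
begin

lemma radius_jet_basis: "ereal lambda_star \<le> fps_conv_radius (jet_basis l k i)"
  unfolding jet_basis_def by (simp split: if_split, intro conjI impI radius_intros radius_alpha_beta_gamma)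

lemma radius_jet: "ereal lambda_star \<le> fps_conv_radius (jet i (jet_basis l k) k')"
  using jet_self_next_prev[of i l k k'] radius_conn[of 1 k k'] radius_conn[of "- 1" k k']
  by (cases "k = k'") auto

lemma coeffs_bounded_if_radius_lambda:
  assumes "ereal lambda_star \<le> fps_conv_radius f" "0 \<le> r" "r < lambda_star"
  shows "\<exists>C. coeffs_bounded r f C"
proof (rule coeffs_bounded_if_radius[OF _ assms(2)])
  have "ereal r < ereal lambda_star" using assms(3) by simp
  then show "ereal r < fps_conv_radius f" using assms(1) by (rule less_le_trans)
qed

lemma finite_index_bound:
  fixes f :: "'a::finite \<Rightarrow> real fps"
  assumes "\<And>i. \<exists>C. coeffs_bounded r (f i) C"
  shows "\<exists>C. \<forall>i. coeffs_bounded r (f i) C"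
proof -
  obtain C where C: "\<And>i. coeffs_bounded r (f i) (C i)" using assms by metis
  have "C i \<le> (\<Sum>i\<in>UNIV. C i)" for i
    using coeffs_bounded_nonneg[OF C] by (intro member_le_sum) auto
  then show ?thesis using C coeffs_bounded_mono by blast
qed

text \<open>Coefficient \<open>j + 1\<close> has coefficient \<open>j\<close> as its Laplacian, so
  the comparison principle bounds it by its corner values plus \<open>c\<close> times the previous
  bound; this gives geometric growth.\<close>

lemma sol_bounded_small: "\<exists>r>0. \<exists>C. \<forall>x\<in>SG q. \<forall>l k. coeffs_bounded r (sol l k x) C"
proof -
  define r where "r = lambda_star / 2"
  have r: "r > 0" "r < lambda_star" using lambda_star_pos by (auto simp: r_def)
  have "\<exists>B. \<forall>p :: 3 \<times> 3 \<times> 3. coeffs_bounded r ((\<lambda>(l, k, i). jet_basis l k i) p) B"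
    by (rule finite_index_bound) (use r in \<open>auto intro: coeffs_bounded_if_radius_lambda radius_jet_basis\<close>)
  then obtain B where B: "\<And>l k i. coeffs_bounded r (jet_basis l k i) B" by (auto simp: split_paired_all)
  have B0: "B \<ge> 0" using coeffs_bounded_nonneg[OF B] .
  obtain c where c: "c \<ge> 0"
    "\<And>u f b M x. \<lbrakk>has_laplacian q u f; \<And>x. x \<in> SG q \<Longrightarrow> \<bar>f x\<bar> \<le> M; \<And>i. \<bar>u (q i)\<bar> \<le> b; x \<in> SG q\<rbrakk>
       \<Longrightarrow> \<bar>u x\<bar> \<le> b + c * M"
    using comparison by blast
  \<comment> \<open>Chosen so that corner values and previous coefficient each contribute at most
    \<open>B * \<rho> ^ Suc j\<close>, half of the claimed bound.\<close>
  define \<rho> where "\<rho> = 1 / r + 2 * c"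
  have \<rho>: "\<rho> > 0" "1 / r \<le> \<rho>" "2 * c \<le> \<rho>" using r c by (auto simp: \<rho>_def intro: add_pos_nonneg)
  have main: "\<bar>sol l k x $ j\<bar> \<le> 2 * B * \<rho> ^ j" if "x \<in> SG q" for l k x j
    using that
  proof (induction j arbitrary: x)
    case 0
    have "\<bar>sol l k x $ 0\<bar> \<le> B + c * 0"
    proof (rule c(2)[OF has_laplacian_comb _ _ 0])
      show "\<bar>(fps_X * sol l k x) $ 0\<bar> \<le> 0" for x by simp
      show "\<bar>sol l k (q i) $ 0\<bar> \<le> B" for i
        using coeffs_bounded_nth[OF B r(1), of l k i 0] by simp
    qed
    then show ?case using B0 by simp
  next
    case (Suc j)
    have "\<bar>sol l k x $ Suc j\<bar> \<le> B * (1 / r) ^ Suc j + c * (2 * B * \<rho> ^ j)"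
    proof (rule c(2)[OF has_laplacian_comb _ _ Suc.prems])
      show "\<bar>(fps_X * sol l k x) $ Suc j\<bar> \<le> 2 * B * \<rho> ^ j" if "x \<in> SG q" for x
        using Suc.IH[OF that] by (simp add: fps_X_mult_nth)
      show "\<bar>sol l k (q i) $ Suc j\<bar> \<le> B * (1 / r) ^ Suc j" for i
        unfolding comb_corner by (rule coeffs_bounded_nth[OF B r(1)])
    qed
    also have "\<dots> \<le> B * \<rho> ^ Suc j + \<rho> / 2 * (2 * B * \<rho> ^ j)"
      using \<rho> B0 r by (intro add_mono mult_left_mono mult_right_mono power_mono) auto
    finally show ?case by simp
  qed
  have "coeffs_bounded (1 / (2 * \<rho>)) (sol l k x) (2 * (2 * B))" if "x \<in> SG q" for l k x
    by (rule coeffs_bounded_if_geometric[where s = \<rho>]) (use main[OF that] \<rho> B0 in auto)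
  moreover have "1 / (2 * \<rho>) > 0" using \<rho>(1) by simp
  ultimately show ?thesis by blast
qed

lemma sol_bounded:
  assumes "0 \<le> r" "r < lambda_star"
  shows "\<exists>C. \<forall>x\<in>SG q. \<forall>l k. coeffs_bounded r (sol l k x) C"
proof -
  obtain r0 C0 where r0: "r0 > 0" "\<And>x l k. x \<in> SG q \<Longrightarrow> coeffs_bounded r0 (sol l k x) C0"
    using sol_bounded_small by blast
  have main: "\<exists>C. \<forall>x\<in>SG q. \<forall>l k. coeffs_bounded r (sol l k x) C"
    if "0 \<le> r" "r < lambda_star" "r \<le> 5 ^ n * r0" for n r
    using that
  proof (induction n arbitrary: r)
    case 0
    then have "\<forall>x\<in>SG q. \<forall>l k. coeffs_bounded r (sol l k x) C0"
      using r0(2) coeffs_bounded_radius_mono[of r0 _ C0 r] by simp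
    then show ?case by blast
  next
    case (Suc n)
    have "\<exists>C. \<forall>x\<in>SG q. \<forall>l k. coeffs_bounded (r / 5) (sol l k x) C"
      by (rule Suc.IH) (use Suc.prems in auto)
    then obtain C where C: "\<And>x l k. x \<in> SG q \<Longrightarrow> coeffs_bounded (r / 5) (sol l k x) C" by blast
    have "\<exists>B. \<forall>p :: 3 \<times> 3 \<times> 3 \<times> 3. coeffs_bounded r ((\<lambda>(i, l, k, k'). jet i (jet_basis l k) k') p) B"
      by (rule finite_index_bound) (use Suc.prems in \<open>auto intro: coeffs_bounded_if_radius_lambda radius_jet\<close>)
    then obtain B where B: "\<And>i l k k'. coeffs_bounded r (jet i (jet_basis l k) k') B" by (auto simp: split_paired_all)
    have "coeffs_bounded r (sol l k x) (\<Sum>k'\<in>(UNIV :: 3 set). B * (1 * C))" if x: "x \<in> SG q" for x l k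
    proof -
      obtain i y where y: "y \<in> SG q" "x = F i y" using x by (rule SG_cases)
      have "coeffs_bounded r (D (sol i k' y)) C" for k'
        using C[OF y(1)] by (simp add: coeffs_bounded_dil)
      then show ?thesis
        unfolding y(2) sol_cell[OF y(1)] using Suc.prems(1)
        by (intro coeffs_bounded_sum coeffs_bounded_mult coeffs_bounded_const B) auto
    qed
    then show ?case by blast
  qed
  obtain n where "r / r0 < 5 ^ n" using real_arch_pow[of 5 "r / r0"] by auto
  then have "r \<le> 5 ^ n * r0" using r0(1) by (simp add: field_simps)
  then show ?thesis using main assms by blast
qed

lemma radius_sol: "x \<in> SG q \<Longrightarrow> ereal lambda_star \<le> fps_conv_radius (sol l k x)"
  using sol_bounded by (intro radius_ge_if_coeffs_bounded lambda_star_pos) blast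

end

section \<open>Eigenfunctions\<close>

lemma eval_fps_sum:
  fixes f :: "'i \<Rightarrow> real fps"
  assumes "finite I" "\<And>i. i \<in> I \<Longrightarrow> ereal (norm t) < fps_conv_radius (f i)"
  shows "eval_fps (\<Sum>i\<in>I. f i) t = (\<Sum>i\<in>I. eval_fps (f i) t) \<and>
    ereal (norm t) < fps_conv_radius (\<Sum>i\<in>I. f i)"
  using assms
proof (induction I)
  case (insert a I)
  have "ereal (norm t) < min (fps_conv_radius (f a)) (fps_conv_radius (\<Sum>i\<in>I. f i))"
    using insert by simp
  also have "\<dots> \<le> fps_conv_radius (f a + (\<Sum>i\<in>I. f i))" by (rule fps_conv_radius_add)
  finally show ?case using insert by (simp add: eval_fps_add)
qed simp

definition zeta :: "nat \<Rightarrow> real \<Rightarrow> real" where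
  "zeta m t = eval_fps Psi (2 / (3 * 5 ^ m) * t)"

lemma eval_Zs: "eval_fps (Zs m) t = zeta m t"
  unfolding Zs_def zeta_def eval_dil ..

lemma zeta_Suc: "zeta (Suc m) t = zeta m (t / 5)"
  by (simp add: zeta_def)

lemma tendsto_zeta: "(\<lambda>m. 3/2 * 5 ^ m * zeta m t) \<longlonglongrightarrow> t"
proof (cases "t = 0")
  case True
  then show ?thesis by (simp add: zeta_def eval_fps_at_0)
next
  case False
  have "(eval_fps Psi has_field_derivative eval_fps (fps_deriv Psi) 0) (at 0)"
    by (rule has_field_derivative_eval_fps) (simp add: radius_Psi)
  then have d: "((\<lambda>h. eval_fps Psi h / h) \<longlongrightarrow> 1) (at 0)"
    by (simp add: DERIV_def eval_fps_at_0)
  have "(\<lambda>m. 2/3 * t * (1/5) ^ m) \<longlonglongrightarrow> 2/3 * t * 0"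
    by (intro tendsto_intros LIMSEQ_power_zero) simp
  then have h: "filterlim (\<lambda>m. 2 / (3 * 5 ^ m) * t) (at 0) sequentially"
    using False by (simp add: filterlim_at power_divide mult_ac)
  have "(\<lambda>m. t * (eval_fps Psi (2 / (3 * 5 ^ m) * t) / (2 / (3 * 5 ^ m) * t))) \<longlonglongrightarrow> t * 1"
    by (intro tendsto_intros filterlim_compose[OF d h])
  then show ?thesis using False by (simp add: zeta_def field_simps)
qed

lemma tendsto_zeta_0:
  "(\<lambda>m. (5/3) ^ m * zeta m t) \<longlonglongrightarrow> 0"
proof -
  have lim: "(\<lambda>m. 2/3 * (1/3) ^ m * (3/2 * 5 ^ m * zeta m t)) \<longlonglongrightarrow> 2/3 * 0 * t"
    by (intro tendsto_intros tendsto_zeta LIMSEQ_power_zero) simp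
  have eq: "2/3 * (1/3) ^ m * (3/2 * 5 ^ m * zeta m t) = (5/3) ^ m * zeta m t" for m
    by (simp add: power_divide)
  show ?thesis using lim unfolding eq by simp
qed

context gasket
begin

lemma lt_radius: "\<bar>t\<bar> < lambda_star \<Longrightarrow> ereal lambda_star \<le> R \<Longrightarrow> ereal (norm t) < R"
  by (rule less_le_trans[of _ "ereal lambda_star"]) simp_all

lemma L_eval:
  assumes "\<bar>t\<bar> < lambda_star" "x \<in> SG q" "\<And>y. y \<in> SG q \<Longrightarrow> ereal lambda_star \<le> fps_conv_radius (U y)"
  shows "L m (\<lambda>y. eval_fps (U y) t) x = eval_fps (L m U x) t"
proof -
  have r: "ereal (norm t) < fps_conv_radius (U y)" if "y \<in> SG q" for y
    by (rule lt_radius[OF assms(1) assms(3)[OF that]])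
  have "eval_fps (L m U x) t = (\<Sum>y\<in>nbrs m x. eval_fps (U y - U x) t)"
    unfolding L_def
  proof (rule eval_fps_sum[THEN conjunct1])
    fix y assume "y \<in> nbrs m x"
    then have "y \<in> SG q" by (rule nbrs_in_SG)
    then have "ereal lambda_star \<le> fps_conv_radius (U y - U x)"
      by (intro radius_ge_diff assms)
    then show "ereal (norm t) < fps_conv_radius (U y - U x)" by (rule lt_radius[OF assms(1)])
  qed simp
  also have "\<dots> = (\<Sum>y\<in>nbrs m x. eval_fps (U y) t - eval_fps (U x) t)"
    by (intro sum.cong refl eval_fps_diff r assms(2)) (rule nbrs_in_SG)
  finally show ?thesis by (simp add: L_def)
qed

abbreviation esol :: "3 \<Rightarrow> 3 \<Rightarrow> real \<Rightarrow> real^2 \<Rightarrow> real" where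
  "esol l k t x \<equiv> eval_fps (sol l k x) t"

lemma L_esol:
  assumes "\<bar>t\<bar> < lambda_star" "x \<in> V m - V 0"
  shows "L m (esol l k t) x = zeta m t * esol l k t x"
proof -
  have x: "x \<in> SG q" using assms(2) V_subset_SG by blast
  have "L m (esol l k t) x = eval_fps (Zs m * sol l k x) t"
    unfolding L_comb[OF assms(2), symmetric] by (rule L_eval[OF assms(1) x radius_sol])
  also have "\<dots> = zeta m t * esol l k t x"
    using lt_radius[OF assms(1) radius_sol[OF x]] by (simp add: eval_fps_mult radius_Zs eval_Zs)
  finally show ?thesis .
qed

lemma L_esol_corner:
  assumes "\<bar>t\<bar> < lambda_star"
  shows "L m (esol l k t) (q j) = zeta m t / 2 * esol l k t (q j) +
     2 * eval_fps (jet j (jet_basis l k) 2) t * ((3/5) ^ m * eval_fps beta_fps (t / 5 ^ m))"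
proof -
  have rad: "ereal (norm t) < fps_conv_radius f" if "ereal lambda_star \<le> fps_conv_radius f" for f :: "real fps"
    by (rule lt_radius[OF assms that])
  have rm: "ereal (norm t) < fps_conv_radius (f * g)"
    if "ereal (norm t) < fps_conv_radius f" "ereal (norm t) < fps_conv_radius g" for f g :: "real fps"
    using that fps_conv_radius_mult[of f g] by (meson less_le_trans min_less_iff_conj)
  have b: "ereal (norm t) < fps_conv_radius (dil (1 / 5 ^ m) beta_fps)"
  proof (rule rad, rule radius_ge_if_coeffs_bounded[OF _ lambda_star_pos])
    fix r assume r: "0 \<le> r" "r < lambda_star"
    have "1 / 5 ^ m * r \<le> 1 * r" using r(1) by (intro mult_right_mono) auto
    then show "\<exists>C. coeffs_bounded r (dil (1 / 5 ^ m) beta_fps) C"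
      using r coeffs_bounded_if_radius_lambda[OF radius_alpha_beta_gamma(2), of "1 / 5 ^ m * r"]
      by (simp add: coeffs_bounded_dil)
  qed
  have jb: "ereal (norm t) < fps_conv_radius (jet_basis l k j)"
    and jj: "ereal (norm t) < fps_conv_radius (jet j (jet_basis l k) 2)"
    by (intro rad radius_jet_basis radius_jet)+
  let ?A = "fps_const (1/2) * Zs m" and ?B = "fps_const ((3/5) ^ m) * dil (1 / 5 ^ m) beta_fps"
  have A: "ereal (norm t) < fps_conv_radius ?A" "eval_fps ?A t = 1/2 * zeta m t"
    by (simp_all add: fps_conv_radius_cmult_left radius_Zs eval_fps_mult eval_Zs)
  have B: "ereal (norm t) < fps_conv_radius ?B" "eval_fps ?B t = (3/5) ^ m * eval_fps beta_fps (t / 5 ^ m)"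
    using b by (simp_all add: fps_conv_radius_cmult_left eval_fps_mult eval_dil)
  have C: "ereal (norm t) < fps_conv_radius (2 * jet j (jet_basis l k) 2)"
    "eval_fps (2 * jet j (jet_basis l k) 2) t = 2 * eval_fps (jet j (jet_basis l k) 2) t"
    using rm[OF _ jj, of 2] jj by (simp_all add: eval_fps_mult)
  have "L m (esol l k t) (q j) = eval_fps (L m (sol l k) (q j)) t"
    by (rule L_eval[OF assms q_in_SG radius_sol])
  also have "\<dots> = eval_fps (?A * jet_basis l k j) t + eval_fps (2 * jet j (jet_basis l k) 2 * ?B) t"
    unfolding L_comb_corner by (intro eval_fps_add rm A B C jb)
  also have "\<dots> = zeta m t / 2 * esol l k t (q j) +
     2 * eval_fps (jet j (jet_basis l k) 2) t * ((3/5) ^ m * eval_fps beta_fps (t / 5 ^ m))"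
    unfolding eval_fps_mult[OF A(1) jb] eval_fps_mult[OF C(1) B(1)] A(2) B(2) C(2) by simp
  finally show ?thesis .
qed

lemma continuous_esol:
  assumes "\<bar>t\<bar> < lambda_star"
  shows "continuous_on (SG q) (esol l k t)"
proof -
  define r where "r = (\<bar>t\<bar> + lambda_star) / 2"
  have r: "0 < r" "\<bar>t\<bar> < r" "r < lambda_star" using assms by (auto simp: r_def)
  obtain C where C: "\<And>x. x \<in> SG q \<Longrightarrow> coeffs_bounded r (sol l k x) C"
    using sol_bounded[of r] r by auto
  have C0: "C \<ge> 0" using coeffs_bounded_nonneg[OF C[OF q_in_SG]] .
  have "uniform_limit (SG q) (\<lambda>n x. \<Sum>j<n. sol l k x $ j * t ^ j) (\<lambda>x. suminf (\<lambda>j. sol l k x $ j * t ^ j)) sequentially"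
  proof (rule Weierstrass_m_test)
    show "summable (\<lambda>j. C * (\<bar>t\<bar> / r) ^ j)"
      using r by (intro summable_mult summable_geometric) auto
    fix j x assume "x \<in> SG q"
    then have "\<bar>sol l k x $ j\<bar> \<le> C * (1 / r) ^ j" by (intro coeffs_bounded_nth C r(1))
    then have "\<bar>sol l k x $ j\<bar> * \<bar>t\<bar> ^ j \<le> C * (1 / r) ^ j * \<bar>t\<bar> ^ j"
      by (intro mult_right_mono) auto
    then show "norm (sol l k x $ j * t ^ j) \<le> C * (\<bar>t\<bar> / r) ^ j"
      by (simp add: abs_mult power_abs power_divide)
  qed
  then show ?thesis
    unfolding eval_fps_def
    by (rule uniform_limit_theorem[rotated]) (auto intro!: always_eventually continuous_intros continuous_comb)
qed

text \<open>The convergence of \<open>3/2 * 5 ^ m * zeta m t\<close> to \<open>t\<close> does not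
  involve \<open>x\<close>. The threshold \<open>m0\<close> admits functions for which decimation
  fails on coarse levels.\<close>

lemma has_laplacian_if_graph_eigenfunction:
  assumes w: "continuous_on (SG q) w"
    and eq: "\<And>m x. m \<ge> m0 \<Longrightarrow> x \<in> V m - V 0 \<Longrightarrow> L m w x = zeta m t * w x"
  shows "has_laplacian q w (\<lambda>x. t * w x)"
  unfolding has_laplacian_iff
proof (intro conjI allI impI)
  show "continuous_on (SG q) (\<lambda>x. t * w x)" by (intro continuous_intros w)
  fix e :: real assume e: "e > 0"
  have "bounded (w ` SG q)" by (intro compact_imp_bounded compact_continuous_image w compact_SG)
  then obtain B where B: "B > 0" "\<And>x. x \<in> SG q \<Longrightarrow> \<bar>w x\<bar> \<le> B" unfolding bounded_pos by auto
  obtain N where N: "\<And>m. m \<ge> N \<Longrightarrow> \<bar>3/2 * 5 ^ m * zeta m t - t\<bar> < e / B"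
    using LIMSEQ_D[OF tendsto_zeta, of "e / B" t] e B(1) by auto
  have "\<bar>3/2 * 5 ^ m * L m w x - t * w x\<bar> < e" if m: "m \<ge> max N m0" and x: "x \<in> V m - V 0" for m x
  proof -
    have "x \<in> SG q" using x V_subset_SG by blast
    have "3/2 * 5 ^ m * L m w x - t * w x = (3/2 * 5 ^ m * zeta m t - t) * w x"
      using eq[OF _ x] m by (simp add: algebra_simps)
    then have "\<bar>3/2 * 5 ^ m * L m w x - t * w x\<bar> \<le> \<bar>3/2 * 5 ^ m * zeta m t - t\<bar> * B"
      using B(2)[OF \<open>x \<in> SG q\<close>] by (simp add: abs_mult mult_left_mono)
    also have "\<dots> < e / B * B" using N[of m] m B(1) by (intro mult_strict_right_mono) auto
    finally show ?thesis using B(1) by simp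
  qed
  then show "\<exists>N. \<forall>m\<ge>N. \<forall>x\<in>V m - V 0. \<bar>3/2 * 5 ^ m * L m w x - t * w x\<bar> < e" by blast
qed (rule w)

lemma has_normal_deriv_0_if_graph:
  assumes "\<And>m. m \<ge> m0 \<Longrightarrow> L m w (q j) = zeta m t / 2 * w (q j)"
  shows "has_normal_deriv q w j 0"
proof -
  have "(\<lambda>m. - ((5/3) ^ m * zeta m t * (w (q j) / 2))) \<longlonglongrightarrow> - (0 * (w (q j) / 2))"
    by (intro tendsto_intros tendsto_zeta_0)
  then have "(\<lambda>m. - ((5/3) ^ m * zeta m t * (w (q j) / 2))) \<longlonglongrightarrow> 0" by simp
  moreover have "\<forall>\<^sub>F m in sequentially. - ((5/3) ^ m * zeta m t * (w (q j) / 2)) = - ((5/3) ^ m * L m w (q j))"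
    using eventually_ge_at_top[of m0] by eventually_elim (simp add: assms)
  ultimately show ?thesis unfolding has_normal_deriv_iff by (rule Lim_transform_eventually)
qed

section \<open>Neumann eigenvalues\<close>

lemma neumann_eigenvalue_iff:
  "neumann_eigenvalue q \<mu> \<longleftrightarrow> (\<exists>w. has_laplacian q w (\<lambda>x. - \<mu> * w x) \<and> (\<exists>x\<in>SG q. w x \<noteq> 0) \<and>
     (\<forall>i. has_normal_deriv q w i 0))"
proof
  assume "neumann_eigenvalue q \<mu>"
  then obtain u f where u: "has_laplacian q u f" "\<exists>x\<in>SG q. u x \<noteq> 0"
    "\<And>x. x \<in> SG q \<Longrightarrow> - laplacian q u x = \<mu> * u x" "\<forall>i. has_normal_deriv q u i 0"
    unfolding neumann_eigenvalue_def dom_laplacian_def by blast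
  have "f x = - \<mu> * u x" if "x \<in> SG q" for x
    using u(3)[OF that] that unfolding laplacian_eq[OF u(1)] by simp
  then have "has_laplacian q u (\<lambda>x. - \<mu> * u x)"
    by (rule has_laplacian_transfer[OF u(1) refl])
  then show "\<exists>w. has_laplacian q w (\<lambda>x. - \<mu> * w x) \<and> (\<exists>x\<in>SG q. w x \<noteq> 0) \<and> (\<forall>i. has_normal_deriv q w i 0)"
    using u by blast
next
  assume "\<exists>w. has_laplacian q w (\<lambda>x. - \<mu> * w x) \<and> (\<exists>x\<in>SG q. w x \<noteq> 0) \<and> (\<forall>i. has_normal_deriv q w i 0)"
  then obtain w where w: "has_laplacian q w (\<lambda>x. - \<mu> * w x)" "\<exists>x\<in>SG q. w x \<noteq> 0" "\<forall>i. has_normal_deriv q w i 0"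
    by blast
  have "- laplacian q w x = \<mu> * w x" if "x \<in> SG q" for x
    unfolding laplacian_eq[OF w(1)] using that by simp
  then show "neumann_eigenvalue q \<mu>"
    unfolding neumann_eigenvalue_def dom_laplacian_def using w by blast
qed

section \<open>Explicit Neumann eigenfunctions\<close>

definition t_one :: real where "t_one = - lambda_star / 5"

text \<open>The antisymmetric solution: its normal derivative at \<open>q 0\<close> is 0 by the
  choice of the unit jet, and at the other corners it is a multiple of \<open>3 + Zs 1\<close>,
  which vanishes at \<open>t_one\<close>.\<close>

definition eigen_one :: "real^2 \<Rightarrow> real" where "eigen_one = esol 0 3 t_one"

lemma t_one: "\<bar>t_one\<bar> < lambda_star" "zeta 1 t_one = - 3" "zeta 0 t_one = - 6"
proof -
  show "\<bar>t_one\<bar> < lambda_star" using lambda_star_pos by (simp add: t_one_def)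
  have 1: "eval_fps Psi (- sigma3) = - 3" using sigma3(1) by (simp add: phi_def)
  then show "zeta 1 t_one = - 3" by (simp add: zeta_def t_one_def lambda_star_def)
  have "phi (5 * sigma3) = 6" unfolding phi_functional_eq sigma3(1) by simp
  then have "eval_fps Psi (- (5 * sigma3)) = - 6" by (simp add: phi_def)
  then show "zeta 0 t_one = - 6" by (simp add: zeta_def t_one_def lambda_star_def)
qed

lemma eigen_one_corner:
  "eigen_one (q 0) = 0" "eigen_one (q 2) = - eigen_one (q 1)" "eigen_one (q 1) \<noteq> 0"
proof -
  have 1: "eigen_one (q 1) = eval_fps gamma_fps t_one" and 2: "eigen_one (q 2) = eval_fps (- gamma_fps) t_one"
    by (simp_all add: eigen_one_def jet_basis_def)
  have g: "ereal (norm t_one) < fps_conv_radius gamma_fps"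
    by (rule lt_radius[OF t_one(1) radius_alpha_beta_gamma(3)])
  show "eigen_one (q 0) = 0" by (simp add: eigen_one_def jet_basis_def)
  show "eigen_one (q 2) = - eigen_one (q 1)" unfolding 1 2 using g by (simp add: eval_fps_minus)
  \<comment> \<open>That \<open>gamma_fps\<close> does not vanish at \<open>t_one\<close> is read
    off from this product, since \<open>Zs 0\<close> has the value -6 there.\<close>
  have "Zs 0 = fps_const (4/3) * (fps_X * gamma_fps)"
    unfolding Zs_0_eq gamma_eq[symmetric] by (simp add: numeral_fps_const mult_ac)
  moreover have "fps_conv_radius (fps_X * gamma_fps) = \<infinity>"
    using fps_conv_radius_mult[of fps_X gamma_fps]
    by (simp add: gamma_fps_def fps_conv_radius_cmult_left radius_W)
  ultimately have "zeta 0 t_one = 4/3 * (t_one * eigen_one (q 1))"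
    unfolding eval_Zs[symmetric] 1
    by (simp add: eval_fps_mult gamma_fps_def fps_conv_radius_cmult_left radius_W)
  then show "eigen_one (q 1) \<noteq> 0" using t_one(3) by auto
qed

lemma eigen_one_graph:
  "x \<in> V m - V 0 \<Longrightarrow> L m eigen_one x = zeta m t_one * eigen_one x"
  "L m eigen_one (q j) = zeta m t_one / 2 * eigen_one (q j)"
proof -
  show "x \<in> V m - V 0 \<Longrightarrow> L m eigen_one x = zeta m t_one * eigen_one x"
    unfolding eigen_one_def by (rule L_esol[OF t_one(1)])
  have z: "eval_fps (fps_const (s/2) * (3 + Zs 1) * G) t_one = 0" for s
  proof -
    have r: "fps_conv_radius (3 + Zs 1) = \<infinity>" using fps_conv_radius_add[of 3 "Zs 1"] by (simp add: radius_Zs)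
    have "eval_fps (3 + Zs 1) t_one = 3 + zeta 1 t_one" by (simp add: eval_fps_add radius_Zs eval_Zs)
    then have 0: "eval_fps (3 + Zs 1) t_one = 0" unfolding t_one(2) by simp
    have "fps_conv_radius (fps_const (s/2) * (3 + Zs 1)) = \<infinity>"
      using fps_conv_radius_mult[of "fps_const (s/2)" "3 + Zs 1"] r by simp
    then show ?thesis using r 0 by (simp add: eval_fps_mult radius_G)
  qed
  have "eval_fps (jet j (jet_basis 0 3) 2) t_one = 0"
    using jet_self_next_prev[of j 0 3 2] z[of 1] z[of "- 1"] by (auto simp: conn_def)
  then show "L m eigen_one (q j) = zeta m t_one / 2 * eigen_one (q j)"
    unfolding eigen_one_def L_esol_corner[OF t_one(1)] by simp
qed

lemma continuous_eigen_one: "continuous_on (SG q) eigen_one"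
  unfolding eigen_one_def by (rule continuous_esol[OF t_one(1)])

lemma neumann_lambda_star_5: "neumann_eigenvalue q (lambda_star / 5)"
  unfolding neumann_eigenvalue_iff
proof (intro exI conjI allI)
  have "has_laplacian q eigen_one (\<lambda>x. t_one * eigen_one x)"
    by (rule has_laplacian_if_graph_eigenfunction[OF continuous_eigen_one eigen_one_graph(1)])
  then show "has_laplacian q eigen_one (\<lambda>x. - (lambda_star / 5) * eigen_one x)"
    by (simp add: t_one_def)
  show "\<exists>x\<in>SG q. eigen_one x \<noteq> 0" using eigen_one_corner(3) q_in_SG by blast
  show "has_normal_deriv q eigen_one i 0" for i
    by (rule has_normal_deriv_0_if_graph[of 0]) (rule eigen_one_graph(2))
qed

text \<open>
  As \<open>eigen_one\<close> satisfies the Neumann conditions and is antisymmetric about \<open>q 0\<close>, its copies with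
  opposite signs on two cells match each other and the zero function on the third cell.
\<close>

definition eigen_two :: "real^2 \<Rightarrow> real" where
  "eigen_two = glue (\<lambda>k x. (if k = 0 then 0 else if k = 1 then 1 else - 1) * eigen_one x)"

lemma eigen_two_F:
  "x \<in> SG q \<Longrightarrow> eigen_two (F k x) = (if k = 0 then 0 else if k = 1 then 1 else - 1) * eigen_one x"
  unfolding eigen_two_def
proof (rule glue_F)
  fix k l
  have e3: "q 3 = q 0" by simp
  show "(if k = 0 then 0 else if k = 1 then 1 else - 1) * eigen_one (q l) =
      (if l = 0 then 0 else if l = 1 then 1 else - 1) * eigen_one (q k)"
    using exhaust_3[of k] exhaust_3[of l] eigen_one_corner(1,2) by (elim disjE) (simp_all add: e3)
qed

lemma eigen_two_graph:
  "x \<in> V (Suc m) - V 0 \<Longrightarrow> L (Suc m) eigen_two x = zeta (Suc m) (- lambda_star) * eigen_two x"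
  "L (Suc m) eigen_two (q j) = zeta (Suc m) (- lambda_star) / 2 * eigen_two (q j)"
proof -
  have z: "zeta (Suc m) (- lambda_star) = zeta m t_one" by (simp add: zeta_Suc t_one_def)
  let ?s = "\<lambda>k::3. if k = 0 then 0 else if k = 1 then 1 else - 1 :: real"
  have cell: "L m (\<lambda>y. eigen_two (F k y)) x = ?s k * L m eigen_one x" if "x \<in> SG q" for k x
    unfolding L_cmult[symmetric] by (rule L_cong[OF that]) (rule eigen_two_F)
  show "L (Suc m) eigen_two (q j) = zeta (Suc m) (- lambda_star) / 2 * eigen_two (q j)"
    unfolding L_corner cell[OF q_in_SG] eigen_one_graph(2) z
    using eigen_two_F[OF q_in_SG, of j j] by (simp add: F_corner)
  show "L (Suc m) eigen_two x = zeta (Suc m) (- lambda_star) * eigen_two x" if "x \<in> V (Suc m) - V 0"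
    using that
  proof (cases rule: vertex_cases)
    case (interior k y)
    then have y: "y \<in> SG q" using V_subset_SG by blast
    show ?thesis
      unfolding interior(2) L_interior[OF interior(1)] cell[OF y] eigen_one_graph(1)[OF interior(1)] z eigen_two_F[OF y]
      by simp
  next
    case (junction k l)
    have "eigen_two (F k (q l)) = ?s k * eigen_one (q l)" "eigen_two (F k (q l)) = ?s l * eigen_one (q k)"
      using eigen_two_F[OF q_in_SG, of k l] eigen_two_F[OF q_in_SG, of l k] unfolding F_corner_commute[of k l] by simp_all
    note val = this
    have "L (Suc m) eigen_two x = zeta m t_one / 2 * (?s k * eigen_one (q l)) + zeta m t_one / 2 * (?s l * eigen_one (q k))"
      unfolding junction(2) L_junction[OF junction(1)] cell[OF q_in_SG] eigen_one_graph(2) by (simp only: mult_ac)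
    also have "\<dots> = zeta m t_one * eigen_two x"
      unfolding val[symmetric] junction(2) by simp
    finally show ?thesis unfolding z .
  qed
qed

text \<open>The parameter \<open>- lambda_star\<close> is outside the open disc in which the series
  are known to converge. On the cells the parameter is \<open>t_one\<close>, so the eigenfunction is
  assembled there. The graph relations start at level 1; on level 0 they fail at
  \<open>q 0\<close>.\<close>

lemma neumann_lambda_star: "neumann_eigenvalue q lambda_star"
  unfolding neumann_eigenvalue_iff
proof (intro exI conjI allI)
  have "continuous_on (SG q) eigen_two"
  proof (rule continuous_on_SG_if_cells)
    fix k :: 3
    have "continuous_on (SG q) (\<lambda>x. (if k = 0 then 0 else if k = 1 then 1 else - 1) * eigen_one x)"
      by (intro continuous_intros continuous_eigen_one)
    then show "continuous_on (SG q) (\<lambda>x. eigen_two (F k x))"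
      by (rule continuous_on_eq) (simp add: eigen_two_F)
  qed
  then have "has_laplacian q eigen_two (\<lambda>x. (- lambda_star) * eigen_two x)"
  proof (rule has_laplacian_if_graph_eigenfunction[of _ 1])
    fix m x assume m: "m \<ge> 1" and x: "x \<in> V m - V 0"
    from m obtain m' where m': "m = Suc m'" by (cases m) auto
    show "L m eigen_two x = zeta m (- lambda_star) * eigen_two x"
      using x unfolding m' by (rule eigen_two_graph(1))
  qed
  then show "has_laplacian q eigen_two (\<lambda>x. - lambda_star * eigen_two x)" .
  have "eigen_two (F 1 (q 1)) \<noteq> 0" using eigen_one_corner(3) by (simp add: eigen_two_F)
  then show "\<exists>x\<in>SG q. eigen_two x \<noteq> 0" using F_in_SG[OF q_in_SG] by blast
  show "has_normal_deriv q eigen_two i 0" for i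
  proof (rule has_normal_deriv_0_if_graph[of 1])
    fix m :: nat assume "m \<ge> 1"
    then obtain m' where m': "m = Suc m'" by (cases m) auto
    show "L m eigen_two (q i) = zeta m (- lambda_star) / 2 * eigen_two (q i)"
      unfolding m' by (rule eigen_two_graph(2))
  qed
qed

end

section \<open>Reduction of the Neumann spectrum to a finite graph\<close>

lemma eval_fps_nonzero_near_0:
  fixes f :: "real fps"
  assumes "fps_conv_radius f > 0" "f $ 0 \<noteq> 0"
  shows "\<exists>d>0. \<forall>t. \<bar>t\<bar> < d \<longrightarrow> eval_fps f t \<noteq> 0"
proof -
  have "isCont (eval_fps f) 0"
    using has_field_derivative_eval_fps[of 0 f UNIV] assms(1)
    by (intro DERIV_isCont) (auto simp: zero_ereal_def)
  moreover have "eval_fps f 0 \<noteq> 0" using assms(2) by (simp add: eval_fps_at_0)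
  ultimately obtain d where "d > 0" "\<And>y. dist 0 y < d \<Longrightarrow> eval_fps f y \<noteq> 0"
    using continuous_at_avoid by blast
  then show ?thesis by (intro exI[of _ d]) (auto simp: dist_norm)
qed

lemma tendsto_eval_beta: "(\<lambda>n. eval_fps beta_fps (t / 5 ^ n)) \<longlonglongrightarrow> - (1/2)"
proof -
  have "0 < ereal lambda_star" using lambda_star_pos by simp
  then have "fps_conv_radius beta_fps > 0" using radius_alpha_beta_gamma(2) by (rule less_le_trans)
  then have "isCont (eval_fps beta_fps) 0"
    using has_field_derivative_eval_fps[of 0 beta_fps UNIV] by (intro DERIV_isCont) (auto simp: zero_ereal_def)
  moreover have "(\<lambda>n. t * (1/5) ^ n) \<longlonglongrightarrow> t * 0"
    by (intro tendsto_intros LIMSEQ_power_zero) simp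
  then have "(\<lambda>n. t / 5 ^ n) \<longlonglongrightarrow> 0" by (simp add: power_divide)
  ultimately have "(\<lambda>n. eval_fps beta_fps (t / 5 ^ n)) \<longlonglongrightarrow> eval_fps beta_fps 0"
    by (rule isCont_tendsto_compose)
  then show ?thesis by (simp add: eval_fps_at_0)
qed

text \<open>The proof sums Bessel's inequality for the point evaluations over all points.\<close>

lemma orthogonal_family_card:
  fixes w :: "'i \<Rightarrow> 'a \<Rightarrow> real" and p :: "'a \<Rightarrow> real"
  assumes A: "finite A" "finite T" and p: "\<And>x. x \<in> A \<Longrightarrow> p x > 0"
    and nz: "\<And>i. i \<in> T \<Longrightarrow> \<exists>x\<in>A. w i x \<noteq> 0"
    and orth: "\<And>i j. i \<in> T \<Longrightarrow> j \<in> T \<Longrightarrow> i \<noteq> j \<Longrightarrow> (\<Sum>x\<in>A. p x * w i x * w j x) = 0"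
  shows "card T \<le> card A"
proof -
  define N where "N i = (\<Sum>x\<in>A. p x * w i x * w i x)" for i
  have N: "N i > 0" if i: "i \<in> T" for i
  proof -
    obtain x where x: "x \<in> A" "w i x \<noteq> 0" using nz[OF i] by blast
    have "0 < p x * w i x * w i x" using p[OF x(1)] x(2) by (auto simp: mult.assoc zero_less_mult_iff linorder_neq_iff)
    also have "\<dots> \<le> N i" unfolding N_def
      by (rule member_le_sum[OF x(1) _ A(1)]) (auto simp: mult.assoc intro!: mult_nonneg_nonneg[OF less_imp_le[OF p] zero_le_square])
    finally show ?thesis .
  qed
  have bessel: "(\<Sum>i\<in>T. p x * w i x * w i x / N i) \<le> 1" if x: "x \<in> A" for x
  proof -
    define f where "f y = (if y = x then 1 / p x else 0)" for y
    define g where "g y = (\<Sum>i\<in>T. w i x / N i * w i y)" for y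
    have ff: "(\<Sum>y\<in>A. p y * f y * f y) = 1 / p x"
      using A(1) x p[OF x] by (simp add: f_def if_distrib cong: if_cong)
    have fg: "(\<Sum>y\<in>A. p y * f y * g y) = (\<Sum>i\<in>T. w i x * w i x / N i)"
    proof -
      have "(\<Sum>y\<in>A. p y * f y * g y) = (\<Sum>y\<in>A. if y = x then g x else 0)"
        using p[OF x] by (intro sum.cong) (auto simp: f_def)
      also have "\<dots> = g x" using A(1) x by simp
      finally show ?thesis by (simp add: g_def mult.commute)
    qed
    have gg: "(\<Sum>y\<in>A. p y * g y * g y) = (\<Sum>i\<in>T. w i x * w i x / N i)"
    proof -
      have "(\<Sum>y\<in>A. p y * g y * g y) = (\<Sum>y\<in>A. \<Sum>i\<in>T. \<Sum>j\<in>T. w i x / N i * (w j x / N j) * (p y * w i y * w j y))"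
        unfolding g_def by (simp add: sum_distrib_left sum_distrib_right sum_divide_distrib mult_ac)
      also have "\<dots> = (\<Sum>i\<in>T. \<Sum>y\<in>A. \<Sum>j\<in>T. w i x / N i * (w j x / N j) * (p y * w i y * w j y))"
        by (rule sum.swap)
      also have "\<dots> = (\<Sum>i\<in>T. \<Sum>j\<in>T. \<Sum>y\<in>A. w i x / N i * (w j x / N j) * (p y * w i y * w j y))"
        by (intro sum.cong refl sum.swap)
      also have "\<dots> = (\<Sum>i\<in>T. \<Sum>j\<in>T. if j = i then w i x / N i * (w i x / N i) * N i else 0)"
      proof (intro sum.cong refl)
        fix i j assume "i \<in> T" "j \<in> T"
        then have "(\<Sum>y\<in>A. p y * w i y * w j y) = (if j = i then N i else 0)"
          using orth[of i j] by (simp add: N_def)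
        then show "(\<Sum>y\<in>A. w i x / N i * (w j x / N j) * (p y * w i y * w j y)) =
            (if j = i then w i x / N i * (w i x / N i) * N i else 0)"
          unfolding sum_distrib_left[symmetric] by simp
      qed
      also have "\<dots> = (\<Sum>i\<in>T. w i x * w i x / N i)"
        using A(2) N by (intro sum.cong refl) (simp add: less_imp_neq[symmetric])
      finally show ?thesis .
    qed
    have "0 \<le> (\<Sum>y\<in>A. p y * (f y - g y)\<^sup>2)"
      by (intro sum_nonneg mult_nonneg_nonneg) (auto intro: less_imp_le[OF p])
    also have "\<dots> = (\<Sum>y\<in>A. p y * f y * f y) - 2 * (\<Sum>y\<in>A. p y * f y * g y) + (\<Sum>y\<in>A. p y * g y * g y)"
      by (simp add: power2_eq_square algebra_simps sum.distrib sum_subtractf sum_distrib_left)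
    finally have "(\<Sum>i\<in>T. w i x * w i x / N i) \<le> 1 / p x" unfolding ff fg gg by simp
    then have "p x * (\<Sum>i\<in>T. w i x * w i x / N i) \<le> 1"
      using p[OF x] by (simp add: field_simps)
    then show ?thesis by (simp add: sum_distrib_left mult.assoc)
  qed
  have "real (card T) = (\<Sum>i\<in>T. N i / N i)" using N by (simp add: less_imp_neq[symmetric])
  also have "\<dots> = (\<Sum>i\<in>T. \<Sum>x\<in>A. p x * w i x * w i x / N i)"
    by (simp only: sum_divide_distrib[symmetric] N_def[symmetric])
  also have "\<dots> = (\<Sum>x\<in>A. \<Sum>i\<in>T. p x * w i x * w i x / N i)" by (rule sum.swap)
  also have "\<dots> \<le> (\<Sum>x\<in>A. 1)" by (intro sum_mono bessel)
  finally show ?thesis by simp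
qed

context gasket
begin

lemma L_symmetric:
  fixes u v :: "real^2 \<Rightarrow> real"
  shows "(\<Sum>x\<in>V m. v x * L m u x) = (\<Sum>x\<in>V m. u x * L m v x)"
proof -
  have ex: "(\<Sum>x\<in>V m. v x * L m u x) = (\<Sum>x\<in>V m. \<Sum>y\<in>V m. of_bool (sg_adj q m x y) * (v x * u y)) -
      (\<Sum>x\<in>V m. \<Sum>y\<in>V m. of_bool (sg_adj q m x y) * (v x * u x))" for u v :: "real^2 \<Rightarrow> real"
  proof -
    have "L m u x = (\<Sum>y\<in>V m. of_bool (sg_adj q m x y) * (u y - u x))" for x
      unfolding L_def nbrs_def
      by (rule sum.mono_neutral_cong_left) (auto simp: finite_V sg_adj_def simp del: vertices.simps)
    then show ?thesis
      unfolding sum_subtractf[symmetric] by (simp add: sum_distrib_left algebra_simps)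
  qed
  have sym: "sg_adj q m x y = sg_adj q m y x" for x y by (auto simp: sg_adj_def)
  have "(\<Sum>x\<in>V m. \<Sum>y\<in>V m. of_bool (sg_adj q m x y) * (v x * u y)) =
      (\<Sum>x\<in>V m. \<Sum>y\<in>V m. of_bool (sg_adj q m x y) * (u x * v y))"
    by (subst sum.swap) (simp add: sym[of _ "_"] mult.commute[of "u _"])
  then show ?thesis unfolding ex by (simp add: mult.commute)
qed

text \<open>Comparison at a point where |w| is maximal bounds this maximum by
  \<open>c * \<bar>t\<bar>\<close> times itself, and \<open>c * \<bar>t\<bar> < 1\<close>.\<close>

lemma dirichlet_small:
  obtains d where "d > 0" "\<And>t w x. \<lbrakk>\<bar>t\<bar> < d; has_laplacian q w (\<lambda>x. t * w x); \<And>i. w (q i) = 0; x \<in> SG q\<rbrakk> \<Longrightarrow> w x = 0"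
proof -
  obtain c where c: "c \<ge> 0"
    "\<And>u f b M x. \<lbrakk>has_laplacian q u f; \<And>x. x \<in> SG q \<Longrightarrow> \<bar>f x\<bar> \<le> M; \<And>i. \<bar>u (q i)\<bar> \<le> b; x \<in> SG q\<rbrakk>
       \<Longrightarrow> \<bar>u x\<bar> \<le> b + c * M"
    using comparison by blast
  show ?thesis
  proof
    show "1 / (c + 1) > 0" using c(1) by simp
    fix t w x assume t: "\<bar>t\<bar> < 1 / (c + 1)" and w: "has_laplacian q w (\<lambda>x. t * w x)" "\<And>i. w (q i) = 0" and x: "x \<in> SG q"
    have "continuous_on (SG q) (\<lambda>x. \<bar>w x\<bar>)"
      by (intro continuous_intros has_laplacian_continuous[OF w(1)])
    then obtain z where z: "z \<in> SG q" "\<And>y. y \<in> SG q \<Longrightarrow> \<bar>w y\<bar> \<le> \<bar>w z\<bar>"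
      using continuous_attains_sup[OF compact_SG, of "\<lambda>x. \<bar>w x\<bar>"] x by blast
    have le: "\<bar>w z\<bar> \<le> 0 + c * (\<bar>t\<bar> * \<bar>w z\<bar>)"
      by (rule c(2)[OF w(1) _ _ z(1)]) (auto simp: abs_mult w(2) intro: mult_left_mono z(2))
    have lt: "c * \<bar>t\<bar> < 1"
    proof -
      have "\<bar>t\<bar> * (c + 1) < 1" using t c(1) by (simp add: field_simps)
      then show ?thesis by (simp add: distrib_left mult.commute) 
    qed
    have "(1 - c * \<bar>t\<bar>) * \<bar>w z\<bar> \<le> 0" using le by (simp add: algebra_simps)
    then have "\<bar>w z\<bar> = 0" using lt by (simp add: mult_le_0_iff)
    then show "w x = 0" using z(2)[OF x] by simp
  qed
qed

lemma has_laplacian_esol: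
  assumes "\<bar>t\<bar> < lambda_star"
  shows "has_laplacian q (esol l k t) (\<lambda>x. t * esol l k t x)"
  by (rule has_laplacian_if_graph_eigenfunction[OF continuous_esol[OF assms] L_esol[OF assms]])

text \<open>An arbitrary eigenfunction is not known to come from the series. For small
  \<open>t\<close> it does: \<open>beta_fps\<close> and \<open>gamma_fps\<close> do not vanish, so a
  combination of the basis matches its corner values, and \<open>dirichlet_small\<close> kills the
  difference.\<close>

lemma small_expansion:
  obtains d where "d > 0" "d \<le> lambda_star"
    "\<And>t w j. \<lbrakk>\<bar>t\<bar> < d; has_laplacian q w (\<lambda>x. t * w x)\<rbrakk> \<Longrightarrow> \<exists>a. \<forall>x\<in>SG q. w x = (\<Sum>k\<in>UNIV. a k * esol j k t x)"
    "\<And>t w x. \<lbrakk>\<bar>t\<bar> < d; has_laplacian q w (\<lambda>x. t * w x); \<And>i. w (q i) = 0; x \<in> SG q\<rbrakk> \<Longrightarrow> w x = 0"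
proof -
  have rpos: "fps_conv_radius f > 0" if "ereal lambda_star \<le> fps_conv_radius f" for f :: "real fps"
    by (rule less_le_trans[OF _ that]) (simp add: lambda_star_pos)
  obtain d1 where d1: "d1 > 0" "\<And>t. \<bar>t\<bar> < d1 \<Longrightarrow> eval_fps beta_fps t \<noteq> 0"
    using eval_fps_nonzero_near_0[OF rpos[OF radius_alpha_beta_gamma(2)]] by auto
  obtain d2 where d2: "d2 > 0" "\<And>t. \<bar>t\<bar> < d2 \<Longrightarrow> eval_fps gamma_fps t \<noteq> 0"
    using eval_fps_nonzero_near_0[OF rpos[OF radius_alpha_beta_gamma(3)]] by (auto simp: gamma_fps_def)
  obtain d3 where d3: "d3 > 0"
    "\<And>t w x. \<lbrakk>\<bar>t\<bar> < d3; has_laplacian q w (\<lambda>x. t * w x); \<And>i. w (q i) = 0; x \<in> SG q\<rbrakk> \<Longrightarrow> w x = 0"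
    by (rule dirichlet_small) blast
  define d where "d = min (min d1 d2) (min d3 lambda_star)"
  show ?thesis
  proof
    show "d > 0" "d \<le> lambda_star" using d1 d2 d3 lambda_star_pos by (auto simp: d_def)
    show "w x = 0" if "\<bar>t\<bar> < d" "has_laplacian q w (\<lambda>x. t * w x)" "\<And>i. w (q i) = 0" "x \<in> SG q" for t w x
      using d3(2)[OF _ that(2-4)] that(1) by (simp add: d_def)
    fix t w j assume t: "\<bar>t\<bar> < d" and w: "has_laplacian q w (\<lambda>x. t * w x)"
    have t': "\<bar>t\<bar> < lambda_star" "eval_fps beta_fps t \<noteq> 0" "eval_fps gamma_fps t \<noteq> 0"
      using t d1(2) d2(2) by (auto simp: d_def)
    define A where "A = eval_fps alpha_fps t"
    define B where "B = eval_fps beta_fps t"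
    define C where "C = eval_fps gamma_fps t"
    \<comment> \<open>Solution of the linear system that prescribes the values at
      \<open>q (j + 1)\<close> and \<open>q (j - 1)\<close>: \<open>a2\<close> fits their mean,
      \<open>a3\<close> their difference.\<close>
    define a2 where "a2 = ((w (q (j + 1)) + w (q (j - 1))) / 2 - w (q j) * A) / B"
    define a3 where "a3 = (w (q (j + 1)) - w (q (j - 1))) / (2 * C)"
    define a where "a k = (if k = 1 then w (q j) else if k = 2 then a2 else a3)" for k :: 3
    define s where "s x = a 1 * esol j 1 t x + a 2 * esol j 2 t x + a 3 * esol j 3 t x" for x
    have "has_laplacian q s (\<lambda>x. a 1 * (t * esol j 1 t x) + a 2 * (t * esol j 2 t x) + a 3 * (t * esol j 3 t x))"
      unfolding s_def by (intro has_laplacian_add has_laplacian_cmult has_laplacian_esol t'(1))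
    then have "has_laplacian q (\<lambda>x. w x - s x) (\<lambda>x. t * w x - (a 1 * (t * esol j 1 t x) + a 2 * (t * esol j 2 t x) + a 3 * (t * esol j 3 t x)))"
      by (rule has_laplacian_diff[OF w])
    then have v: "has_laplacian q (\<lambda>x. w x - s x) (\<lambda>x. t * (w x - s x))"
      by (rule has_laplacian_transfer) (simp_all add: s_def algebra_simps)
    have g: "eval_fps (- gamma_fps) t = - C"
      unfolding C_def by (rule eval_fps_minus[OF lt_radius[OF t'(1) radius_alpha_beta_gamma(3)]])
    have BC: "B \<noteq> 0" "C \<noteq> 0" using t' by (simp_all add: B_def C_def)
    have "s (q j) = w (q j)" by (simp add: s_def a_def jet_basis_def)
    moreover have "s (q (j + 1)) = w (q (j + 1))"
    proof -
      have "s (q (j + 1)) = w (q j) * A + a2 * B + a3 * C"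
        by (simp add: s_def a_def jet_basis_def A_def B_def C_def)
      then show ?thesis using BC by (simp add: a2_def a3_def field_simps)
    qed
    moreover have "s (q (j - 1)) = w (q (j - 1))"
    proof -
      have "s (q (j - 1)) = w (q j) * A + a2 * B - a3 * C"
        by (simp add: s_def a_def jet_basis_def A_def B_def g)
      then show ?thesis using BC by (simp add: a2_def a3_def field_simps)
    qed
    ultimately have "w (q i) - s (q i) = 0" for i using exhaust_index3[of i j] by auto
    then have "w x - s x = 0" if "x \<in> SG q" for x
      using d3(2)[OF _ v _ that] t by (simp add: d_def)
    then have "\<forall>x\<in>SG q. w x = (\<Sum>k\<in>UNIV. a k * esol j k t x)"
      by (simp add: s_def sum_3)
    then show "\<exists>a. \<forall>x\<in>SG q. w x = (\<Sum>k\<in>UNIV. a k * esol j k t x)" by blast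
  qed
qed

text \<open>
  An arbitrary eigenfunction obeys spectral decimation on all sufficiently fine levels; at a corner
  the deviation from the Neumann relation is a multiple of a fixed sequence.
\<close>

definition decimates :: "nat \<Rightarrow> real \<Rightarrow> (real^2 \<Rightarrow> real) \<Rightarrow> bool" where
  "decimates m t w \<longleftrightarrow> (\<forall>n\<ge>m. \<forall>x\<in>V n - V 0. L n w x = zeta n t * w x) \<and>
     (\<forall>j. \<exists>a. \<forall>n\<ge>m. L n w (q j) = zeta n t / 2 * w (q j) + a * ((3/5) ^ n * eval_fps beta_fps (t / 5 ^ n)))"

lemma decimates_expansion:
  assumes t: "\<bar>t\<bar> < lambda_star"
    and w: "\<And>j. \<exists>a. \<forall>x\<in>SG q. w x = (\<Sum>k\<in>UNIV. a k * esol j k t x)"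
  shows "decimates 0 t w"
  unfolding decimates_def
proof (intro conjI allI ballI impI)
  fix n x assume x: "x \<in> V n - V 0"
  then have xS: "x \<in> SG q" using V_subset_SG by blast
  obtain a where a: "\<And>x. x \<in> SG q \<Longrightarrow> w x = (\<Sum>k\<in>UNIV. a k * esol 0 k t x)" using w[of 0] by blast
  have "L n w x = L n (\<lambda>x. \<Sum>k\<in>UNIV. a k * esol 0 k t x) x" by (rule L_cong[OF xS a])
  then show "L n w x = zeta n t * w x"
    unfolding L_sum L_cmult L_esol[OF t x] a[OF xS] by (simp add: sum_distrib_left mult_ac)
next
  fix j
  obtain a where a: "\<And>x. x \<in> SG q \<Longrightarrow> w x = (\<Sum>k\<in>UNIV. a k * esol j k t x)" using w[of j] by blast
  have "L n w (q j) = zeta n t / 2 * w (q j) + 2 * a 2 * ((3/5) ^ n * eval_fps beta_fps (t / 5 ^ n))" for n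
  proof -
    let ?b = "(3/5) ^ n * eval_fps beta_fps (t / 5 ^ n)"
    have e: "eval_fps (jet j (jet_basis j k) 2) t = of_bool (k = 2)" for k
      unfolding jet_jet_basis by (cases "k = 2") simp_all
    have "L n w (q j) = L n (\<lambda>x. \<Sum>k\<in>UNIV. a k * esol j k t x) (q j)" by (rule L_cong[OF q_in_SG a])
    also have "\<dots> = (\<Sum>k\<in>UNIV. a k * (zeta n t / 2 * esol j k t (q j) + 2 * of_bool (k = 2) * ?b))"
      unfolding L_sum L_cmult L_esol_corner[OF t] e ..
    also have "\<dots> = zeta n t / 2 * (\<Sum>k\<in>UNIV. a k * esol j k t (q j)) + 2 * a 2 * ?b"
      by (simp add: sum_3 algebra_simps)
    finally show ?thesis unfolding a[OF q_in_SG, of j] .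
  qed
  then show "\<exists>a. \<forall>n\<ge>0. L n w (q j) = zeta n t / 2 * w (q j) + a * ((3/5) ^ n * eval_fps beta_fps (t / 5 ^ n))"
    by blast
qed

text \<open>At the scale \<open>(5/3) ^ m\<close> of normal derivatives the existence of the
  Laplacian leaves nothing: normal derivatives of adjacent cells cancel at a junction.\<close>

lemma tendsto_scaled_L:
  assumes "has_laplacian q w f" "x \<in> V n - V 0"
  shows "(\<lambda>m. (5/3) ^ m * L m w x) \<longlonglongrightarrow> 0"
proof -
  have lim: "(\<lambda>m. 2/3 * (1/3) ^ m * (3/2 * 5 ^ m * L m w x)) \<longlonglongrightarrow> 2/3 * 0 * f x"
    by (intro tendsto_intros has_laplacian_tendsto[OF assms] LIMSEQ_power_zero) simp
  have eq: "2/3 * (1/3) ^ m * (3/2 * 5 ^ m * L m w x) = (5/3) ^ m * L m w x" for m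
    by (simp add: power_divide)
  show ?thesis using lim unfolding eq by simp
qed

lemma beta_limit_zero:
  assumes "\<And>n. n \<ge> m \<Longrightarrow> c * eval_fps beta_fps (t / 5 ^ n) = X n" "X \<longlonglongrightarrow> 0"
  shows "c = 0"
proof -
  have "(\<lambda>n. c * eval_fps beta_fps (t / 5 ^ n)) \<longlonglongrightarrow> c * - (1/2)"
    by (intro tendsto_intros tendsto_eval_beta)
  moreover have "\<forall>\<^sub>F n in sequentially. c * eval_fps beta_fps (t / 5 ^ n) = X n"
    using eventually_ge_at_top[of m] by eventually_elim (rule assms(1))
  ultimately have "X \<longlonglongrightarrow> c * - (1/2)" by (rule Lim_transform_eventually)
  then have "c * - (1/2) = 0" using assms(2) by (rule LIMSEQ_unique)
  then show ?thesis by simp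
qed

lemma scaling_cancel: "(5/3 :: real) ^ n * ((3/5) ^ n * b) = b"
  by (simp add: power_mult_distrib[symmetric] mult.assoc[symmetric])

text \<open>Cells carry the parameter \<open>t / 5\<close>. At a junction the deviations of the two
  cells add up to a multiple of one sequence of size \<open>(3/5) ^ n\<close>, and
  \<open>tendsto_scaled_L\<close> forces this multiple to be 0.\<close>

lemma decimates_Suc:
  assumes w: "has_laplacian q w (\<lambda>x. t * w x)"
    and cells: "\<And>k. decimates m (t / 5) (\<lambda>x. w (F k x))"
  shows "decimates (Suc m) t w"
  unfolding decimates_def
proof (intro conjI allI ballI impI)
  fix n x assume n: "n \<ge> Suc m" and x: "x \<in> V n - V 0"
  from n obtain n' where n': "n = Suc n'" "n' \<ge> m" by (cases n) auto
  from x[unfolded n'(1)] show "L n w x = zeta n t * w x"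
  proof (cases rule: vertex_cases)
    case (interior k y)
    show ?thesis
      using cells[of k] interior n'(2) unfolding decimates_def n'(1) interior(2) L_interior[OF interior(1)] zeta_Suc by blast
  next
    case (junction k l)
    obtain a where a: "\<And>n. n \<ge> m \<Longrightarrow> L n (\<lambda>x. w (F k x)) (q l) =
        zeta n (t/5) / 2 * w (F k (q l)) + a * ((3/5) ^ n * eval_fps beta_fps (t / 5 / 5 ^ n))"
      using cells[of k] unfolding decimates_def by blast
    obtain b where b: "\<And>n. n \<ge> m \<Longrightarrow> L n (\<lambda>x. w (F l x)) (q k) =
        zeta n (t/5) / 2 * w (F l (q k)) + b * ((3/5) ^ n * eval_fps beta_fps (t / 5 / 5 ^ n))"
      using cells[of l] unfolding decimates_def by blast
    have Ln: "L (Suc n) w x = zeta n (t/5) * w x + (a + b) * ((3/5) ^ n * eval_fps beta_fps (t / 5 / 5 ^ n))"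
      if "n \<ge> m" for n
      unfolding junction(2) L_junction[OF junction(1)] a[OF that] b[OF that] F_corner_commute[of l k]
      by (simp add: algebra_simps)
    have "a + b = 0"
    proof (rule beta_limit_zero)
      have "(\<lambda>n. (5/3) ^ Suc n * L (Suc n) w x) \<longlonglongrightarrow> 0"
        using tendsto_scaled_L[OF w x] by (rule LIMSEQ_Suc)
      then have lim: "(\<lambda>n. 3/5 * ((5/3) ^ Suc n * L (Suc n) w x) - (5/3) ^ n * zeta n (t/5) * w x) \<longlonglongrightarrow> 3/5 * 0 - 0 * w x"
        by (intro tendsto_intros tendsto_zeta_0)
      have eq: "3/5 * ((5/3) ^ Suc n * L (Suc n) w x) = (5/3) ^ n * L (Suc n) w x" for n
        by simp
      show "(\<lambda>n. (5/3) ^ n * L (Suc n) w x - (5/3) ^ n * zeta n (t/5) * w x) \<longlonglongrightarrow> 0"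
        using lim unfolding eq by simp
      show "(a + b) * eval_fps beta_fps (t / 5 / 5 ^ n) = (5/3) ^ n * L (Suc n) w x - (5/3) ^ n * zeta n (t/5) * w x"
        if "n \<ge> m" for n
      proof -
        have "(5/3) ^ n * L (Suc n) w x = (5/3) ^ n * zeta n (t/5) * w x + (a + b) * ((5/3) ^ n * ((3/5) ^ n * eval_fps beta_fps (t / 5 / 5 ^ n)))"
          unfolding Ln[OF that] by (simp only: distrib_left mult_ac)
        then show ?thesis unfolding scaling_cancel by simp
      qed
    qed
    then show ?thesis unfolding n'(1) Ln[OF n'(2)] by (simp add: zeta_Suc)
  qed
next
  fix j
  obtain a where a: "\<And>n. n \<ge> m \<Longrightarrow> L n (\<lambda>x. w (F j x)) (q j) =
      zeta n (t/5) / 2 * w (F j (q j)) + a * ((3/5) ^ n * eval_fps beta_fps (t / 5 / 5 ^ n))"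
    using cells[of j] unfolding decimates_def by blast
  have "L n w (q j) = zeta n t / 2 * w (q j) + (5/3 * a) * ((3/5) ^ n * eval_fps beta_fps (t / 5 ^ n))" if n: "n \<ge> Suc m" for n
  proof -
    from n obtain n' where n': "n = Suc n'" "n' \<ge> m" by (cases n) auto
    show ?thesis unfolding n'(1) L_corner a[OF n'(2)] by (simp add: zeta_Suc F_corner)
  qed
  then show "\<exists>a. \<forall>n\<ge>Suc m. L n w (q j) = zeta n t / 2 * w (q j) + a * ((3/5) ^ n * eval_fps beta_fps (t / 5 ^ n))"
    by blast
qed

text \<open>After \<open>m\<close> subdivisions the parameter on the cells is small enough for
  \<open>small_expansion\<close>, and \<open>decimates_Suc\<close> carries the relations back up.
  The Neumann conditions then remove the deviation at the corners, and a solution vanishing on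
  \<open>V m\<close> vanishes on every cell.\<close>

lemma neumann_graph:
  obtains d where "d > 0" "\<And>m t w. \<lbrakk>\<bar>t\<bar> < 5 ^ m * d; has_laplacian q w (\<lambda>x. t * w x);
      \<And>i. has_normal_deriv q w i 0; \<exists>x\<in>SG q. w x \<noteq> 0\<rbrakk> \<Longrightarrow>
      (\<forall>x\<in>V m. L m w x = (if x \<in> V 0 then 1/2 else 1) * (zeta m t * w x)) \<and> (\<exists>x\<in>V m. w x \<noteq> 0)"
proof -
  obtain d where d: "d > 0" "d \<le> lambda_star"
    "\<And>t w j. \<lbrakk>\<bar>t\<bar> < d; has_laplacian q w (\<lambda>x. t * w x)\<rbrakk> \<Longrightarrow> \<exists>a. \<forall>x\<in>SG q. w x = (\<Sum>k\<in>UNIV. a k * esol j k t x)"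
    "\<And>t w x. \<lbrakk>\<bar>t\<bar> < d; has_laplacian q w (\<lambda>x. t * w x); \<And>i. w (q i) = 0; x \<in> SG q\<rbrakk> \<Longrightarrow> w x = 0"
    by (rule small_expansion) blast
  have cell: "has_laplacian q (\<lambda>x. w (F k x)) (\<lambda>x. t / 5 * w (F k x))" if "has_laplacian q w (\<lambda>x. t * w x)" for t w k
    using has_laplacian_cell[OF that, of k] by simp
  have dec: "decimates m t w" if "\<bar>t\<bar> < 5 ^ m * d" "has_laplacian q w (\<lambda>x. t * w x)" for m t w
    using that
  proof (induction m arbitrary: t w)
    case 0
    then have "\<bar>t\<bar> < d" by simp
    then show ?case using d(2) d(3)[OF _ 0(2)] by (intro decimates_expansion) auto
  next
    case (Suc m)
    show ?case
      by (rule decimates_Suc[OF Suc.prems(2)], rule Suc.IH[OF _ cell[OF Suc.prems(2)]]) (use Suc.prems(1) in simp)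
  qed
  have van: "w x = 0" if "\<bar>t\<bar> < 5 ^ m * d" "has_laplacian q w (\<lambda>x. t * w x)" "\<And>x. x \<in> V m \<Longrightarrow> w x = 0" "x \<in> SG q" for m t w x
    using that
  proof (induction m arbitrary: t w x)
    case 0
    then show ?case using d(4)[of t w x] by auto
  next
    case (Suc m)
    from Suc.prems(4) obtain k y where y: "y \<in> SG q" "x = F k y" by (rule SG_cases)
    have "w (F k y) = 0"
      by (rule Suc.IH[OF _ cell[OF Suc.prems(2)] _ y(1)]) (use Suc.prems(1,3) F_V in auto)
    then show ?case using y(2) by simp
  qed
  show ?thesis
  proof (rule that[OF d(1)])
    fix m t w assume t: "\<bar>t\<bar> < 5 ^ m * d" and w: "has_laplacian q w (\<lambda>x. t * w x)"
      and nd: "\<And>i. has_normal_deriv q w i 0" and nz: "\<exists>x\<in>SG q. w x \<noteq> 0"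
    note D = dec[OF t w]
    have corner: "L m w (q j) = zeta m t / 2 * w (q j)" for j
    proof -
      obtain a where a: "\<And>n. n \<ge> m \<Longrightarrow> L n w (q j) =
          zeta n t / 2 * w (q j) + a * ((3/5) ^ n * eval_fps beta_fps (t / 5 ^ n))"
        using D unfolding decimates_def by blast
      have "a = 0"
      proof (rule beta_limit_zero)
        have "(\<lambda>n. - (- ((5/3) ^ n * L n w (q j))) - (5/3) ^ n * zeta n t * (w (q j) / 2)) \<longlonglongrightarrow> - 0 - 0 * (w (q j) / 2)"
          using nd[of j] unfolding has_normal_deriv_iff by (intro tendsto_intros tendsto_zeta_0)
        then show "(\<lambda>n. (5/3) ^ n * L n w (q j) - (5/3) ^ n * zeta n t * (w (q j) / 2)) \<longlonglongrightarrow> 0" by simp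
        show "a * eval_fps beta_fps (t / 5 ^ n) = (5/3) ^ n * L n w (q j) - (5/3) ^ n * zeta n t * (w (q j) / 2)"
          if "n \<ge> m" for n
        proof -
          have "(5/3) ^ n * L n w (q j) = (5/3) ^ n * zeta n t * (w (q j) / 2) + a * ((5/3) ^ n * ((3/5) ^ n * eval_fps beta_fps (t / 5 ^ n)))"
            unfolding a[OF that] by (simp add: algebra_simps)
          then show ?thesis unfolding scaling_cancel by simp
        qed
      qed
      then show ?thesis using a[of m] by simp
    qed
    have "L m w x = (if x \<in> V 0 then 1/2 else 1) * (zeta m t * w x)" if "x \<in> V m" for x
    proof (cases "x \<in> V 0")
      case True
      then obtain j where "x = q j" by auto
      then show ?thesis using corner[of j] True by simp
    next
      case False
      then have "x \<in> V m - V 0" using that by simp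
      then have "L m w x = zeta m t * w x" using D unfolding decimates_def by blast
      then show ?thesis using False by simp
    qed
    moreover have "\<exists>x\<in>V m. w x \<noteq> 0" using van[OF t w] nz by blast
    ultimately show "(\<forall>x\<in>V m. L m w x = (if x \<in> V 0 then 1/2 else 1) * (zeta m t * w x)) \<and> (\<exists>x\<in>V m. w x \<noteq> 0)"
      by blast
  qed
qed

text \<open>A negative eigenvalue would make \<open>zeta m t\<close> positive; then the graph
  Laplacian is positive at a positive maximum, which is impossible. The same applies to
  \<open>- w\<close>.\<close>

lemma neumann_eigenvalue_nonneg:
  assumes "neumann_eigenvalue q \<mu>"
  shows "\<mu> \<ge> 0"
proof (rule ccontr)
  assume "\<not> \<mu> \<ge> 0"
  define t where "t = - \<mu>"
  have t: "t > 0" using \<open>\<not> \<mu> \<ge> 0\<close> by (simp add: t_def)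
  obtain w where w: "has_laplacian q w (\<lambda>x. t * w x)" "\<exists>x\<in>SG q. w x \<noteq> 0" "\<And>i. has_normal_deriv q w i 0"
    using assms unfolding neumann_eigenvalue_iff t_def by blast
  obtain d where d: "d > 0" "\<And>m t w. \<lbrakk>\<bar>t\<bar> < 5 ^ m * d; has_laplacian q w (\<lambda>x. t * w x);
      \<And>i. has_normal_deriv q w i 0; \<exists>x\<in>SG q. w x \<noteq> 0\<rbrakk> \<Longrightarrow>
      (\<forall>x\<in>V m. L m w x = (if x \<in> V 0 then 1/2 else 1) * (zeta m t * w x)) \<and> (\<exists>x\<in>V m. w x \<noteq> 0)"
    by (rule neumann_graph) blast
  obtain m where "t / d < 5 ^ m" using real_arch_pow[of 5 "t / d"] by auto
  then have m: "\<bar>t\<bar> < 5 ^ m * d" using d(1) t by (simp add: field_simps)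
  have g: "\<And>x. x \<in> V m \<Longrightarrow> L m w x = (if x \<in> V 0 then 1/2 else 1) * (zeta m t * w x)" "\<exists>x\<in>V m. w x \<noteq> 0"
    using d(2)[OF m w(1,3,2)] by blast+
  have z: "zeta m t > 0" unfolding zeta_def using t by (intro eval_Psi_pos) simp
  have no_pos: "v x \<le> 0" if v: "\<And>x. x \<in> V m \<Longrightarrow> L m v x = (if x \<in> V 0 then 1/2 else 1) * (zeta m t * v x)" and x: "x \<in> V m" for v x
  proof (rule ccontr)
    assume "\<not> v x \<le> 0"
    have "Max (v ` V m) \<in> v ` V m" using finite_V x by (intro Max_in) auto
    then obtain y where y: "y \<in> V m" "Max (v ` V m) = v y" by blast
    have max: "v x \<le> v y" if "x \<in> V m" for x
      using Max_ge[of "v ` V m" "v x"] finite_V that unfolding y(2)[symmetric] by simp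
    have "v y > 0" using max[OF x] \<open>\<not> v x \<le> 0\<close> by simp
    then have "L m v y > 0" unfolding v[OF y(1)] using z by simp
    then show False using L_nonpos_at_max[of m v y] max by fastforce
  qed
  have "w x = 0" if "x \<in> V m" for x
  proof -
    have "w x \<le> 0" by (rule no_pos[OF g(1) that])
    moreover have "- w x \<le> 0"
    proof (rule no_pos[OF _ that])
      fix x assume "x \<in> V m"
      then show "L m (\<lambda>x. - w x) x = (if x \<in> V 0 then 1/2 else 1) * (zeta m t * - w x)"
        using g(1)[of x] L_cmult[of m "-1" w x] by simp
    qed
    ultimately show ?thesis by simp
  qed
  then show False using g(2) by blast
qed

text \<open>One level \<open>m\<close> serves all eigenvalues up to \<Lambda>: it is fine enough for
  \<open>neumann_graph\<close>, and \<open>zeta m\<close> is injective on the range in question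
  because \<open>PsiC\<close> is injective near 0. Distinct eigenvalues thus give orthogonal nonzero
  functions on the finite set \<open>V m\<close>.\<close>

lemma finite_neumann_eigenvalues: "finite {\<mu>. neumann_eigenvalue q \<mu> \<and> \<mu> \<le> lambda_star}"
proof -
  let ?S = "{\<mu>. neumann_eigenvalue q \<mu> \<and> \<mu> \<le> lambda_star}"
  obtain d where d: "d > 0" "\<And>m t w. \<lbrakk>\<bar>t\<bar> < 5 ^ m * d; has_laplacian q w (\<lambda>x. t * w x);
      \<And>i. has_normal_deriv q w i 0; \<exists>x\<in>SG q. w x \<noteq> 0\<rbrakk> \<Longrightarrow>
      (\<forall>x\<in>V m. L m w x = (if x \<in> V 0 then 1/2 else 1) * (zeta m t * w x)) \<and> (\<exists>x\<in>V m. w x \<noteq> 0)"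
    by (rule neumann_graph) blast
  obtain r where r: "r > 0" "inj_on PsiC (ball 0 r)" by (rule PsiC_locally_injective)
  obtain m where "lambda_star / min d r < 5 ^ m" using real_arch_pow[of 5 "lambda_star / min d r"] by auto
  then have "lambda_star < 5 ^ m * min d r" using d(1) r(1) by (simp add: field_simps)
  moreover have "5 ^ m * min d r \<le> 5 ^ m * d" "5 ^ m * min d r \<le> 5 ^ m * r"
    by (intro mult_left_mono; simp)+
  ultimately have m: "lambda_star < 5 ^ m * d" "lambda_star < 5 ^ m * r" by linarith+
  have "\<exists>w. (\<forall>x\<in>V m. L m w x = (if x \<in> V 0 then 1/2 else 1) * (zeta m (- \<mu>) * w x)) \<and> (\<exists>x\<in>V m. w x \<noteq> 0)"
    if S: "\<mu> \<in> ?S" for \<mu>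
  proof -
    obtain w where w: "has_laplacian q w (\<lambda>x. - \<mu> * w x)" "\<exists>x\<in>SG q. w x \<noteq> 0" "\<And>i. has_normal_deriv q w i 0"
      using S unfolding neumann_eigenvalue_iff by blast
    have "\<bar>- \<mu>\<bar> < 5 ^ m * d" using S neumann_eigenvalue_nonneg[of \<mu>] m(1) by auto
    then show ?thesis using d(2)[OF _ w(1,3,2)] by blast
  qed
  then have "\<forall>\<mu>\<in>?S. \<exists>w. (\<forall>x\<in>V m. L m w x = (if x \<in> V 0 then 1/2 else 1) * (zeta m (- \<mu>) * w x)) \<and> (\<exists>x\<in>V m. w x \<noteq> 0)"
    by (rule ballI)
  from bchoice[OF this] obtain w where
    ws: "\<forall>\<mu>\<in>?S. (\<forall>x\<in>V m. L m (w \<mu>) x = (if x \<in> V 0 then 1/2 else 1) * (zeta m (- \<mu>) * w \<mu> x)) \<and> (\<exists>x\<in>V m. w \<mu> x \<noteq> 0)" ..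
  have w: "L m (w \<mu>) x = (if x \<in> V 0 then 1/2 else 1) * (zeta m (- \<mu>) * w \<mu> x)" if "\<mu> \<in> ?S" "x \<in> V m" for \<mu> x
    by (rule bspec[OF conjunct1[OF bspec[OF ws that(1)]] that(2)])
  have w_nz: "\<exists>x\<in>V m. w \<mu> x \<noteq> 0" if "\<mu> \<in> ?S" for \<mu>
    by (rule conjunct2[OF bspec[OF ws that]])
  have inj: "zeta m (- \<mu>) \<noteq> zeta m (- \<nu>)" if "\<mu> \<in> ?S" "\<nu> \<in> ?S" "\<mu> \<noteq> \<nu>" for \<mu> \<nu>
  proof
    let ?h = "\<lambda>\<mu>. complex_of_real (2 / (3 * 5 ^ m) * (- \<mu>))"
    have ball: "?h \<mu> \<in> ball 0 r" if "\<mu> \<in> ?S" for \<mu>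
    proof -
      have "0 \<le> \<mu>" "\<mu> \<le> lambda_star" using that neumann_eigenvalue_nonneg by auto
      then have "2 / (3 * 5 ^ m) * \<mu> < r" using m(2) lambda_star_pos by (simp add: field_simps)
      moreover have "norm (?h \<mu>) = 2 / (3 * 5 ^ m) * \<mu>"
        using \<open>0 \<le> \<mu>\<close> unfolding norm_of_real by (simp add: abs_mult)
      ultimately show ?thesis by simp
    qed
    assume "zeta m (- \<mu>) = zeta m (- \<nu>)"
    then have "PsiC (?h \<mu>) = PsiC (?h \<nu>)" unfolding PsiC_of_real zeta_def by simp
    then have "?h \<mu> = ?h \<nu>" by (rule inj_onD[OF r(2)]) (intro ball that)+
    then have "2 / (3 * 5 ^ m) * (- \<mu>) = 2 / (3 * 5 ^ m) * (- \<nu>)" unfolding of_real_eq_iff .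
    then show False using that(3) by simp
  qed
  have card: "card T \<le> card (V m)" if T: "T \<subseteq> ?S" "finite T" for T
  \<comment> \<open>With the factor 1/2 at the corners as weight, symmetry of \<open>L m\<close>
    gives the orthogonality.\<close>
  proof (rule orthogonal_family_card[where p = "\<lambda>x. if x \<in> V 0 then 1/2 else 1"])
    fix \<mu> \<nu> assume mn: "\<mu> \<in> T" "\<nu> \<in> T" "\<mu> \<noteq> \<nu>"
    then have S: "\<mu> \<in> ?S" "\<nu> \<in> ?S" using T(1) by blast+
    let ?o = "\<Sum>x\<in>V m. (if x \<in> V 0 then 1/2 else 1) * w \<mu> x * w \<nu> x"
    have "(\<Sum>x\<in>V m. w \<nu> x * L m (w \<mu>) x) = zeta m (- \<mu>) * ?o"
      unfolding sum_distrib_left by (intro sum.cong refl) (simp add: w[OF S(1)] del: vertices.simps)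
    moreover have "(\<Sum>x\<in>V m. w \<mu> x * L m (w \<nu>) x) = zeta m (- \<nu>) * ?o"
      unfolding sum_distrib_left by (intro sum.cong refl) (simp add: w[OF S(2)] del: vertices.simps)
    ultimately have "zeta m (- \<mu>) * ?o = zeta m (- \<nu>) * ?o" using L_symmetric[where v = "w \<nu>" and u = "w \<mu>" and m = m] by (simp only:)
    then have "?o = 0 \<or> zeta m (- \<mu>) = zeta m (- \<nu>)" by (simp only: mult_cancel_right)
    then show "?o = 0" using inj[OF S mn(3)] by blast
  next
    show "\<exists>x\<in>V m. w \<mu> x \<noteq> 0" if "\<mu> \<in> T" for \<mu>
      by (rule w_nz[OF subsetD[OF T(1) that]])
  qed (simp_all add: T(2) finite_V)
  show ?thesis
  proof (rule ccontr)
    assume "infinite ?S"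
    from infinite_arbitrarily_large[OF this, of "Suc (card (V m))"]
    obtain T where "finite T" "card T = Suc (card (V m))" "T \<subseteq> ?S" by (elim exE conjE)
    then show False using card[of T] by simp
  qed
qed

text \<open>This inequality turns \<open>R < lambda2 q\<close> into \<open>R < lambda_star\<close>.
  As \<open>lambda2\<close> is a definite description, the second smallest nonzero eigenvalue must
  first be shown to exist; finiteness of \<open>S\<close> and its two members \<Lambda> / 5 and
  \<Lambda> provide it, at most \<Lambda>.\<close>

theorem lambda2_le: "lambda2 q \<le> lambda_star"
proof -
  let ?N = "neumann_eigenvalue q"
  define S where "S = {\<mu>. ?N \<mu> \<and> \<mu> \<noteq> 0 \<and> \<mu> \<le> lambda_star}"
  have fin: "finite S" unfolding S_def by (rule finite_subset[OF _ finite_neumann_eigenvalues]) auto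
  have mem: "lambda_star \<in> S" "lambda_star / 5 \<in> S"
    unfolding S_def using neumann_lambda_star neumann_lambda_star_5 lambda_star_pos by auto
  define a where "a = Min S"
  have a: "a \<in> S" "\<And>\<mu>. \<mu> \<in> S \<Longrightarrow> a \<le> \<mu>" unfolding a_def using fin mem by (auto intro: Min_in)
  have "a \<le> lambda_star / 5" using a(2)[OF mem(2)] .
  then have "a \<noteq> lambda_star" using lambda_star_pos by linarith
  define b where "b = Min (S - {a})"
  have ne: "lambda_star \<in> S - {a}" using mem \<open>a \<noteq> lambda_star\<close> by auto
  have b: "b \<in> S" "b \<noteq> a" "\<And>\<mu>. \<mu> \<in> S \<Longrightarrow> \<mu> \<noteq> a \<Longrightarrow> b \<le> \<mu>"
  proof -
    have "b \<in> S - {a}" unfolding b_def by (rule Min_in) (use fin ne in auto)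
    then show "b \<in> S" "b \<noteq> a" by auto
    show "b \<le> \<mu>" if "\<mu> \<in> S" "\<mu> \<noteq> a" for \<mu> unfolding b_def by (rule Min_le) (use fin that in auto)
  qed
  have ab: "a < b" using a(2)[OF b(1)] b(2) by simp
  have ble: "b \<le> lambda_star" using b(1) by (simp add: S_def)
  have below_b: "{\<mu>. ?N \<mu> \<and> \<mu> \<noteq> 0 \<and> \<mu> < b} = {a}"
  proof (intro equalityI subsetI)
    fix \<mu> assume "\<mu> \<in> {\<mu>. ?N \<mu> \<and> \<mu> \<noteq> 0 \<and> \<mu> < b}"
    then have "\<mu> \<in> S" "\<mu> < b" using ble by (auto simp: S_def)
    then show "\<mu> \<in> {a}" using b(3)[of \<mu>] by force
  qed (use a(1) ab in \<open>auto simp: S_def\<close>)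
  have "lambda2 q = b"
    unfolding lambda2_def
  proof (rule the_equality)
    show "?N b \<and> b \<noteq> 0 \<and> card {\<mu>. ?N \<mu> \<and> \<mu> \<noteq> 0 \<and> \<mu> < b} = 1"
      unfolding below_b using b(1) by (simp add: S_def)
    fix r assume r: "?N r \<and> r \<noteq> 0 \<and> card {\<mu>. ?N \<mu> \<and> \<mu> \<noteq> 0 \<and> \<mu> < r} = 1"
    then obtain c where c: "{\<mu>. ?N \<mu> \<and> \<mu> \<noteq> 0 \<and> \<mu> < r} = {c}" by (auto simp: card_1_singleton_iff)
    show "r = b"
    proof (rule antisym)
      show "r \<le> b"
      proof (rule ccontr)
        assume "\<not> r \<le> b"
        then have "a \<in> {\<mu>. ?N \<mu> \<and> \<mu> \<noteq> 0 \<and> \<mu> < r}" "b \<in> {\<mu>. ?N \<mu> \<and> \<mu> \<noteq> 0 \<and> \<mu> < r}"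
          using a(1) b(1) ab by (auto simp: S_def)
        then show False unfolding c using b(2) by simp
      qed
      have "c \<in> {\<mu>. ?N \<mu> \<and> \<mu> \<noteq> 0 \<and> \<mu> < r}" unfolding c by simp
      then have cr: "?N c" "c \<noteq> 0" "c < r" by auto
      show "b \<le> r"
      proof (rule ccontr)
        assume "\<not> b \<le> r"
        then have "r \<in> {\<mu>. ?N \<mu> \<and> \<mu> \<noteq> 0 \<and> \<mu> < b}" "c \<in> {\<mu>. ?N \<mu> \<and> \<mu> \<noteq> 0 \<and> \<mu> < b}" using r cr by auto
        then show False unfolding below_b using cr by simp
      qed
    qed
  qed
  then show ?thesis using ble by simp
qed

end

unbundle no fps_syntax
unbundle vec_syntax

section \<open>Change of the expansion point\<close>

lemma geometric_bound_if_bigo: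
  fixes f :: "nat \<Rightarrow> real"
  assumes "f \<in> O(\<lambda>j. R ^ j)" "R > 0"
  shows "\<exists>C. \<forall>j. \<bar>f j\<bar> \<le> C * R ^ j"
proof -
  obtain K where "\<forall>\<^sub>F j in sequentially. norm (f j) \<le> K * norm (R ^ j)"
    using assms(1) by (auto elim: landau_o.bigE)
  then obtain N where N: "\<And>j. j \<ge> N \<Longrightarrow> \<bar>f j\<bar> \<le> K * R ^ j"
    using assms(2) unfolding eventually_sequentially by auto
  define C where "C = max K (\<Sum>j<N. \<bar>f j\<bar> / R ^ j)"
  have "\<bar>f j\<bar> \<le> C * R ^ j" for j
  proof (cases "j \<ge> N")
    case True
    have "K * R ^ j \<le> C * R ^ j" using assms(2) by (intro mult_right_mono) (auto simp: C_def)
    then show ?thesis using N[OF True] by simp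
  next
    case False
    have "\<bar>f j\<bar> / R ^ j \<le> (\<Sum>j<N. \<bar>f j\<bar> / R ^ j)"
      using False assms(2) by (intro member_le_sum) auto
    then have "\<bar>f j\<bar> / R ^ j \<le> C" by (simp add: C_def)
    then show ?thesis using assms(2) by (simp add: field_simps)
  qed
  then show ?thesis by blast
qed

lemma bigo_if_geometric_bound:
  fixes f :: "nat \<Rightarrow> real"
  assumes "\<And>j. \<bar>f j\<bar> \<le> C * R ^ j" "R > 0"
  shows "f \<in> O(\<lambda>j. R ^ j)"
  by (rule bigoI[where c = C]) (use assms in auto)

lemma summable_geometric_bound:
  fixes f :: "nat \<Rightarrow> real"
  assumes "\<And>j. \<bar>f j\<bar> \<le> C * x ^ j" "0 \<le> x" "x < 1"
  shows "summable f" "\<bar>suminf f\<bar> \<le> C / (1 - x)"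
proof -
  have s: "(\<lambda>j. C * x ^ j) sums (C * (1 / (1 - x)))"
    using assms by (intro sums_mult geometric_sums) auto
  show "summable f"
    by (rule summable_comparison_test'[OF sums_summable[OF s], of 0]) (use assms in auto)
  have "norm (suminf f) \<le> suminf (\<lambda>j. C * x ^ j)"
    by (rule norm_suminf_le[OF _ sums_summable[OF s]]) (use assms in auto)
  then show "\<bar>suminf f\<bar> \<le> C / (1 - x)" using sums_unique[OF s] by simp
qed

text \<open>The two orders of summation are compared through partial sums: truncation at
  \<open>n\<close> replaces each inner series by an initial segment of length \<open>n - i\<close>.
  The \<open>n\<close> errors are each of order \<open>(R * \<rho>) ^ n\<close>, and
  \<open>n * (R * \<rho>) ^ n\<close> tends to 0.\<close>

lemma rearranged_series:
  fixes c a p :: "nat \<Rightarrow> real"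
  assumes c: "\<And>j. \<bar>c j\<bar> \<le> C * R ^ j" and a: "\<And>j. \<bar>a j\<bar> \<le> B * \<rho> ^ j" and p: "\<And>j. \<bar>p j\<bar> \<le> S * \<rho> ^ j"
    and R: "0 \<le> R" "0 \<le> \<rho>" "R * \<rho> < 1"
  shows "summable (\<lambda>s. c (s + i) * a s)"
    and "\<bar>\<Sum>s. c (s + i) * a s\<bar> \<le> C * B / (1 - R * \<rho>) * R ^ i"
    and "(\<lambda>j. c j * (\<Sum>s\<le>j. a s * p (j - s))) sums (\<Sum>i. (\<Sum>s. c (s + i) * a s) * p i)"
proof -
  define x where "x = R * \<rho>"
  have x: "0 \<le> x" "x < 1" using R by (auto simp: x_def)
  have C0: "C \<ge> 0" "B \<ge> 0" "S \<ge> 0"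
    using order_trans[OF abs_ge_zero c[of 0]] order_trans[OF abs_ge_zero a[of 0]] order_trans[OF abs_ge_zero p[of 0]] by simp_all
  have ca: "\<bar>c (s + i) * a s\<bar> \<le> C * B * R ^ i * x ^ s" for s i
  proof -
    have "\<bar>c (s + i) * a s\<bar> \<le> (C * R ^ (s + i)) * (B * \<rho> ^ s)"
      unfolding abs_mult using C0 R by (intro mult_mono c a) auto
    also have "\<dots> = C * B * R ^ i * x ^ s" by (simp add: x_def power_add power_mult_distrib mult_ac)
    finally show ?thesis .
  qed
  show sca: "summable (\<lambda>s. c (s + i) * a s)" for i
    by (rule summable_geometric_bound(1)[OF ca x])
  have bd: "\<bar>\<Sum>s. c (s + i) * a s\<bar> \<le> C * B / (1 - x) * R ^ i" for i
    using summable_geometric_bound(2)[OF ca x, of i] by simp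
  then show "\<bar>\<Sum>s. c (s + i) * a s\<bar> \<le> C * B / (1 - R * \<rho>) * R ^ i" by (simp add: x_def)
  define b where "b i = (\<Sum>s. c (s + i) * a s)" for i
  have bp: "\<bar>b i * p i\<bar> \<le> C * B / (1 - x) * S * x ^ i" for i
  proof -
    have "\<bar>b i * p i\<bar> \<le> (C * B / (1 - x) * R ^ i) * (S * \<rho> ^ i)"
      unfolding abs_mult b_def using C0 R x by (intro mult_mono bd p) auto
    then show ?thesis by (simp add: x_def power_mult_distrib mult_ac)
  qed
  have sb: "(\<lambda>i. b i * p i) sums (\<Sum>i. b i * p i)"
    by (intro summable_sums summable_geometric_bound(1)[OF bp x])
  have tail: "\<bar>b i - (\<Sum>s<m. c (s + i) * a s)\<bar> \<le> C * B / (1 - x) * R ^ i * x ^ m" for i m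
  proof -
    have "b i - (\<Sum>s<m. c (s + i) * a s) = (\<Sum>s. c (s + m + i) * a (s + m))"
      unfolding b_def using suminf_minus_initial_segment[OF sca, of m] by simp
    also have "\<bar>\<dots>\<bar> \<le> C * B * R ^ i * x ^ m / (1 - x)"
      by (rule summable_geometric_bound(2)[OF _ x]) (use ca[of "s + m" i for s] in \<open>simp add: power_add mult_ac\<close>)
    finally show ?thesis by simp
  qed
  \<comment> \<open>Both sides run over the triangle \<open>s + i < n\<close>.\<close>
  have partial: "(\<Sum>j<n. c j * (\<Sum>s\<le>j. a s * p (j - s))) = (\<Sum>i<n. p i * (\<Sum>s<n - i. c (s + i) * a s))" for n
  proof -
    have "(\<Sum>j<n. c j * (\<Sum>s\<le>j. a s * p (j - s))) = (\<Sum>j<n. \<Sum>s\<le>j. c (s + (j - s)) * (a s * p (j - s)))"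
      unfolding sum_distrib_left by (intro sum.cong refl) auto
    also have "\<dots> = (\<Sum>(s, i)\<in>{(s, i). s + i < n}. c (s + i) * (a s * p i))"
      by (rule sum.triangle_reindex[symmetric])
    also have "{(s, i). s + i < n} = prod.swap ` (SIGMA i:{..<n}. {..<n - i})"
      by (auto simp: image_iff)
    also have "(\<Sum>(s, i)\<in>prod.swap ` (SIGMA i:{..<n}. {..<n - i}). c (s + i) * (a s * p i)) =
        (\<Sum>(i, s)\<in>(SIGMA i:{..<n}. {..<n - i}). c (s + i) * (a s * p i))"
      by (subst sum.reindex) (auto simp: case_prod_beta)
    also have "\<dots> = (\<Sum>i<n. \<Sum>s<n - i. c (s + i) * (a s * p i))"
      by (rule sum.Sigma[symmetric]) auto
    finally show ?thesis by (simp add: sum_distrib_left mult_ac)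
  qed
  let ?K = "C * B / (1 - x) * S"
  have diff: "\<bar>(\<Sum>i<n. b i * p i) - (\<Sum>j<n. c j * (\<Sum>s\<le>j. a s * p (j - s)))\<bar> \<le> ?K * (of_nat n * x ^ n)" for n
  proof -
    have "(\<Sum>i<n. b i * p i) - (\<Sum>j<n. c j * (\<Sum>s\<le>j. a s * p (j - s))) =
        (\<Sum>i<n. p i * (b i - (\<Sum>s<n - i. c (s + i) * a s)))"
      unfolding partial by (simp add: sum_subtractf[symmetric] algebra_simps)
    also have "\<bar>\<dots>\<bar> \<le> (\<Sum>i<n. ?K * x ^ n)"
    proof (rule order_trans[OF sum_abs sum_mono])
      fix i assume i: "i \<in> {..<n}"
      have "\<bar>p i * (b i - (\<Sum>s<n - i. c (s + i) * a s))\<bar> \<le> (S * \<rho> ^ i) * (C * B / (1 - x) * R ^ i * x ^ (n - i))"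
        unfolding abs_mult using C0 R x by (intro mult_mono p tail) auto
      also have "\<dots> = ?K * (x ^ i * x ^ (n - i))" by (simp add: x_def power_mult_distrib mult_ac)
      also have "x ^ i * x ^ (n - i) = x ^ n" using i by (simp add: power_add[symmetric])
      finally show "\<bar>p i * (b i - (\<Sum>s<n - i. c (s + i) * a s))\<bar> \<le> ?K * x ^ n" .
    qed
    finally show ?thesis by (simp add: mult_ac)
  qed
  have "(\<lambda>n. of_nat n * x ^ n) \<longlonglongrightarrow> 0"
    using x by (intro powser_times_n_limit_0) simp
  then have "(\<lambda>n. ?K * (of_nat n * x ^ n)) \<longlonglongrightarrow> 0" by (rule tendsto_mult_right_zero)
  then have "(\<lambda>n. (\<Sum>i<n. b i * p i) - (\<Sum>j<n. c j * (\<Sum>s\<le>j. a s * p (j - s)))) \<longlonglongrightarrow> 0"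
    by (rule Lim_null_comparison[rotated]) (intro always_eventually allI, simp only: real_norm_def diff)
  from tendsto_diff[OF sb[unfolded sums_def] this]
  show "(\<lambda>j. c j * (\<Sum>s\<le>j. a s * p (j - s))) sums (\<Sum>i. (\<Sum>s. c (s + i) * a s) * p i)"
    unfolding sums_def b_def by simp
qed

context gasket
begin

lemma alpha_fps_nth: "alpha q j = fps_nth alpha_fps j"
  and beta_fps_nth: "beta q j = fps_nth beta_fps j"
  by (simp_all add: alpha_def beta_def monomial_eq jet_basis_def)

lemma n_fps_nth: "ncoef q j = fps_nth n_fps j"
proof -
  have "has_normal_deriv q (\<lambda>x. fps_nth (sol 0 1 x) j) (0 + 1) (fps_nth n_fps j)"
    using has_normal_deriv_comb[of "jet_basis 0 1" j "0 + 1"] unfolding jet_next by (simp add: conn_def)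
  then have "has_normal_deriv q (monomial q 0 j 1) 1 (fps_nth n_fps j)"
    unfolding monomial_eq normal_tangential_restrict by simp
  then show ?thesis
    unfolding ncoef_def normal_deriv_def has_normal_deriv_def by (intro the_equality) (auto dest: LIMSEQ_unique)
qed

lemma tau_fps_nth: "tcoef q j = fps_nth tau_fps j"
proof -
  have "has_tangential_deriv q (\<lambda>x. fps_nth (sol 0 2 x) j) (0 + 1) (fps_nth tau_fps j)"
    using has_tangential_deriv_comb[of "jet_basis 0 2" j "0 + 1"] unfolding jet_next by (simp add: conn_def)
  then have "has_tangential_deriv q (monomial q 0 j 2) 1 (fps_nth tau_fps j)"
    unfolding monomial_eq normal_tangential_restrict by simp
  then show ?thesis
    unfolding tcoef_def tangential_deriv_def has_tangential_deriv_def by (intro the_equality) (auto dest: LIMSEQ_unique)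
qed

text \<open>\<open>alpha_fps\<close> is 1 plus \<open>fps_X * W\<close> divided by 6, while
  \<open>gamma_fps\<close> is half of \<open>W\<close>. This explains the factor 3 and the shifted
  index in the third rows of the matrices; the same happens with \<open>n_fps\<close>.\<close>

lemma gamma_nth: "fps_nth gamma_fps j = 3 * fps_nth alpha_fps (Suc j)"
proof -
  have "alpha_fps = 1 + fps_const (1/6) * (fps_X * W)"
    unfolding alpha_fps_def Zs_0_eq by (simp add: mult.assoc[symmetric])
  then have "fps_nth alpha_fps (Suc j) = fps_nth (1 + fps_const (1/6) * (fps_X * W)) (Suc j)"
    by (rule arg_cong)
  then show ?thesis by (simp add: gamma_fps_def fps_X_mult_nth)
qed

lemma third_row_nth: "fps_nth (fps_const (s/2) * (3 + Zs 1) * G) j = s * (3 * fps_nth n_fps (Suc j))"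
proof -
  have "n_fps = fps_const (1/6) * (fps_X * ((3 + Zs 1) * G))" unfolding n_fps_def by (simp only: mult.assoc)
  then have "fps_nth n_fps (Suc j) = fps_nth (fps_const (1/6) * (fps_X * ((3 + Zs 1) * G))) (Suc j)"
    by (rule arg_cong)
  also have "\<dots> = 1/6 * fps_nth ((3 + Zs 1) * G) j"
    by (simp only: fps_mult_left_const_nth fps_X_mult_nth) simp
  finally show ?thesis by (simp only: mult.assoc fps_mult_left_const_nth)
qed

text \<open>The exceptional entries for \<open>j = 0\<close> and \<open>j = 1\<close> come from the
  polynomial terms 1/2 and \<open>s / 6\<close> times \<open>fps_X\<close> in
  \<open>conn\<close>.\<close>

lemma conn_nth: "fps_nth (conn s k k') j =
   (if k = 1 then (if k' = 1 then alpha q j else if k' = 2 then ncoef q j else if j = 1 then s/6 else 0)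
    else if k = 2 then (if k' = 1 then beta q j else if k' = 2 then (if j = 0 then 1/2 else 0) - alpha q j
      else s * tcoef q j)
    else (if k' = 1 then s * (3 * alpha q (j + 1)) else if k' = 2 then s * (3 * ncoef q (j + 1))
      else if j = 0 then - (1/2) else 0))"
proof -
  have X: "fps_nth (fps_const (s/6) * fps_X) j = (if j = 1 then s/6 else 0)" by (simp add: fps_X_def)
  have h: "fps_nth (fps_const (1/2)) j = (if j = 0 then 1/2 else 0 :: real)" by simp
  show ?thesis
    unfolding conn_def alpha_fps_nth beta_fps_nth n_fps_nth tau_fps_nth Suc_eq_plus1[symmetric]
      gamma_nth[symmetric] third_row_nth[symmetric] X[symmetric]
    by (simp only: if_distrib[of "\<lambda>f. fps_nth f j"] fps_sub_nth fps_neg_nth fps_mult_left_const_nth h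
        if_distrib[of uminus] minus_zero)
qed

lemma Mmat_nth: "Mmat q j $ k $ k' = fps_nth (conn 1 k k') j"
  using exhaust_3[of k] exhaust_3[of k']
  unfolding conn_nth by (elim disjE; hypsubst; simp add: Mmat_def vector_3 numeral_2_eq_2)

lemma Mtilde_nth: "Mtilde q j $ k $ k' = fps_nth (conn (- 1) k k') j"
  using exhaust_3[of k] exhaust_3[of k']
  unfolding conn_nth by (elim disjE; hypsubst; simp add: Mtilde_def vector_3 numeral_2_eq_2)

lemma monomial_nth: "x \<in> SG q \<Longrightarrow> monomial q l j k x = fps_nth (sol l k x) j"
  by (simp add: monomial_eq)

text \<open>Stated for an arbitrary corner \<open>i\<close>, so that one proof covers both
  neighbours. The new coefficients satisfy the growth bound with the same \<open>R\<close>.\<close>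

lemma expansion_change:
  fixes c :: "nat \<Rightarrow> real^3" and N :: "nat \<Rightarrow> real^3^3"
  assumes c: "subcritical_growth q c"
    and u: "\<And>x. x \<in> SG q \<Longrightarrow> u x = (\<Sum>k\<in>UNIV. \<Sum>j. c j $ k * monomial q l j k x)"
    and N: "\<And>j k k'. N j $ k $ k' = fps_nth (jet i (jet_basis l k) k') j"
  shows "\<exists>c'. (\<forall>j'. (\<lambda>j. c (j + j') v* N j) sums c' j') \<and> subcritical_growth q c' \<and> has_power_series q i c' u"
proof -
  obtain R where R: "0 < R" "R < lambda2 q" "\<And>k. (\<lambda>j. c j $ k) \<in> O(\<lambda>j. R ^ j)"
    using c unfolding subcritical_growth_def by blast
  have Rl: "R < lambda_star" using R(2) lambda2_le by simp
  \<comment> \<open>Strictly between \<open>R\<close> and \<Lambda>, so that monomials and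
    connection coefficients are bounded by multiples of \<open>(1 / r) ^ j\<close> while
    \<open>R / r < 1\<close>.\<close>
  define r where "r = (R + lambda_star) / 2"
  have r: "R < r" "r < lambda_star" "0 < r" using Rl R(1) by (auto simp: r_def)
  define \<rho> where "\<rho> = 1 / r"
  have \<rho>: "0 \<le> \<rho>" "R * \<rho> < 1" using r R by (auto simp: \<rho>_def)
  have "\<forall>k. \<exists>C. \<forall>j. \<bar>c j $ k\<bar> \<le> C * R ^ j"
    using geometric_bound_if_bigo[OF R(3) R(1)] by blast
  then obtain C where C: "\<And>k j. \<bar>c j $ k\<bar> \<le> C k * R ^ j" by metis
  obtain S where S: "\<And>x l k. x \<in> SG q \<Longrightarrow> coeffs_bounded r (sol l k x) S"
    using sol_bounded[of r] r by auto
  have "\<forall>k k'. \<exists>B. coeffs_bounded r (jet i (jet_basis l k) k') B"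
    using coeffs_bounded_if_radius_lambda[OF radius_jet] r by simp
  then obtain B where B: "\<And>k k'. coeffs_bounded r (jet i (jet_basis l k) k') (B k k')" by metis
  let ?a = "\<lambda>k k'. fps_nth (jet i (jet_basis l k) k')"
  have a: "\<bar>?a k k' j\<bar> \<le> B k k' * \<rho> ^ j" for k k' j
    unfolding \<rho>_def by (rule coeffs_bounded_nth[OF B r(3)])
  have p: "\<bar>fps_nth (sol l k x) j\<bar> \<le> S * \<rho> ^ j" if "x \<in> SG q" for x l k j
    unfolding \<rho>_def by (rule coeffs_bounded_nth[OF S[OF that] r(3)])
  note rs = rearranged_series(3)[OF C a p less_imp_le[OF R(1)] \<rho>]
  note rs0 = rearranged_series(1,2)[OF C a p[OF q_in_SG[of 0]] less_imp_le[OF R(1)] \<rho>]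
  define d where "d j' k k' = (\<Sum>s. c (s + j') $ k * ?a k k' s)" for j' k k'
  define c' where "c' j' = (\<chi> k'. \<Sum>k\<in>UNIV. d j' k k')" for j'
  have sums: "(\<lambda>j. c (j + j') v* N j) sums c' j'" for j'
    unfolding sums_def
  proof (rule vec_tendstoI)
    fix k'
    have "(\<lambda>j. \<Sum>k\<in>UNIV. c (j + j') $ k * ?a k k' j) sums (\<Sum>k\<in>UNIV. d j' k k')"
      unfolding d_def by (intro sums_sum summable_sums rs0(1))
    then show "(\<lambda>n. (\<Sum>j<n. c (j + j') v* N j) $ k') \<longlonglongrightarrow> c' j' $ k'"
      unfolding sums_def sum_component c'_def vector_matrix_mult_def N vec_lambda_beta
      by (simp only: mult.commute)
  qed
  define C' where "C' = (\<lambda>k'. \<Sum>k\<in>UNIV. C k * B k k' / (1 - R * \<rho>))"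
  have c'_bound: "\<bar>c' j $ k'\<bar> \<le> C' k' * R ^ j" for j k'
  proof -
    have "\<bar>c' j $ k'\<bar> \<le> (\<Sum>k\<in>UNIV. \<bar>d j k k'\<bar>)" by (simp add: c'_def sum_abs)
    also have "\<dots> \<le> (\<Sum>k\<in>UNIV. C k * B k k' / (1 - R * \<rho>) * R ^ j)"
      unfolding d_def by (intro sum_mono rs0(2))
    finally show ?thesis by (simp add: C'_def sum_distrib_right)
  qed
  have growth: "subcritical_growth q c'"
    unfolding subcritical_growth_def using R(1,2) bigo_if_geometric_bound[OF c'_bound R(1)] by blast
  have "has_power_series q i c' u"
    unfolding has_power_series_def
  proof (intro ballI conjI allI)
    fix x assume x: "x \<in> SG q"
    let ?p = "\<lambda>k'. fps_nth (sol i k' x)"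
    show "summable (\<lambda>j. c' j $ k * monomial q i j k x)" for k
    proof (rule summable_geometric_bound(1))
      show "\<bar>c' j $ k * monomial q i j k x\<bar> \<le> C' k * S * (R * \<rho>) ^ j" for j
      proof -
        have "\<bar>c' j $ k\<bar> * \<bar>?p k j\<bar> \<le> (C' k * R ^ j) * (S * \<rho> ^ j)"
          using order_trans[OF abs_ge_zero c'_bound[of j k]] by (intro mult_mono c'_bound p x) auto
        then show ?thesis unfolding monomial_nth[OF x] abs_mult by (simp add: power_mult_distrib mult_ac)
      qed
    qed (use \<rho> R in auto)
    have dp: "summable (\<lambda>j. d j k k' * ?p k' j)" for k k'
    proof (rule summable_geometric_bound(1))
      show "\<bar>d j k k' * ?p k' j\<bar> \<le> C k * B k k' / (1 - R * \<rho>) * S * (R * \<rho>) ^ j" for j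
      proof -
        have db: "\<bar>d j k k'\<bar> \<le> C k * B k k' / (1 - R * \<rho>) * R ^ j"
          unfolding d_def by (rule rs0(2))
        have "\<bar>d j k k'\<bar> * \<bar>?p k' j\<bar> \<le> (C k * B k k' / (1 - R * \<rho>) * R ^ j) * (S * \<rho> ^ j)"
          using order_trans[OF abs_ge_zero db] by (intro mult_mono db p x) auto
        then show ?thesis unfolding abs_mult by (simp add: power_mult_distrib mult_ac)
      qed
    qed (use \<rho> R in auto)
    \<comment> \<open>Coefficient \<open>j\<close> of the expansion of \<open>sol l k\<close> at
      corner \<open>i\<close> is a sum over \<open>k'\<close> of Cauchy products, to each of which
      \<open>rearranged_series\<close> applies.\<close>
    have main: "(\<lambda>j. c j $ k * fps_nth (sol l k x) j) sums (\<Sum>k'\<in>UNIV. \<Sum>j. d j k k' * ?p k' j)" for k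
    proof -
      have "(\<lambda>j. \<Sum>k'\<in>UNIV. c j $ k * (\<Sum>s\<le>j. ?a k k' s * ?p k' (j - s))) sums
          (\<Sum>k'\<in>UNIV. \<Sum>j. d j k k' * ?p k' j)"
        unfolding d_def by (intro sums_sum rs x)
      moreover have "fps_nth (sol l k x) j = (\<Sum>k'\<in>UNIV. \<Sum>s\<le>j. ?a k k' s * ?p k' (j - s))" for j
        unfolding comb_expansion[of "jet_basis l k" x i] fps_sum_nth fps_mult_nth atLeast0AtMost ..
      ultimately show ?thesis by (simp only: sum_distrib_left)
    qed
    have "u x = (\<Sum>k\<in>UNIV. \<Sum>k'\<in>UNIV. \<Sum>j. d j k k' * ?p k' j)"
      unfolding u[OF x] monomial_nth[OF x] by (intro sum.cong refl sums_unique[OF main, symmetric])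
    also have "\<dots> = (\<Sum>k'\<in>UNIV. \<Sum>k\<in>UNIV. \<Sum>j. d j k k' * ?p k' j)" by (rule sum.swap)
    also have "\<dots> = (\<Sum>k'\<in>UNIV. \<Sum>j. \<Sum>k\<in>UNIV. d j k k' * ?p k' j)"
      by (intro sum.cong refl suminf_sum[symmetric] dp)
    also have "\<dots> = (\<Sum>k'\<in>UNIV. \<Sum>j. c' j $ k' * monomial q i j k' x)"
      by (simp add: c'_def sum_distrib_right monomial_nth[OF x])
    finally show "u x = (\<Sum>k'\<in>UNIV. \<Sum>j. c' j $ k' * monomial q i j k' x)" .
  qed
  then show ?thesis using sums growth by blast
qed

lemma expansion_summable:
  fixes c :: "nat \<Rightarrow> real^3"
  assumes c: "subcritical_growth q c"
    and u: "\<And>x. x \<in> SG q \<Longrightarrow> u x = (\<Sum>k\<in>UNIV. \<Sum>j. c j $ k * monomial q l j k x)"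
  shows "has_power_series q l c u"
  unfolding has_power_series_def
proof (intro ballI conjI allI)
  fix x k assume x: "x \<in> SG q"
  obtain R where R: "0 < R" "R < lambda2 q" "(\<lambda>j. c j $ k) \<in> O(\<lambda>j. R ^ j)"
    using c unfolding subcritical_growth_def by blast
  obtain C where C: "\<And>j. \<bar>c j $ k\<bar> \<le> C * R ^ j" using geometric_bound_if_bigo[OF R(3,1)] by blast
  define r where "r = (R + lambda_star) / 2"
  have r: "R < r" "r < lambda_star" "0 < r" using R(1,2) lambda2_le by (auto simp: r_def)
  obtain S where S: "\<And>x l k. x \<in> SG q \<Longrightarrow> coeffs_bounded r (sol l k x) S"
    using sol_bounded[of r] r by auto
  show "summable (\<lambda>j. c j $ k * monomial q l j k x)"
  proof (rule summable_geometric_bound(1))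
    fix j
    have "\<bar>c j $ k\<bar> * \<bar>fps_nth (sol l k x) j\<bar> \<le> (C * R ^ j) * (S * (1 / r) ^ j)"
      using order_trans[OF abs_ge_zero C[of j]] by (intro mult_mono C coeffs_bounded_nth[OF S[OF x] r(3)]) auto
    then show "\<bar>c j $ k * monomial q l j k x\<bar> \<le> C * S * (R / r) ^ j"
      unfolding monomial_nth[OF x] abs_mult by (simp add: power_divide mult_ac)
  qed (use R r in auto)
qed (use u in auto)

end

theorem theorem3p4:
  fixes q :: "3 \<Rightarrow> real^2" and l :: 3 and c :: "nat \<Rightarrow> real^3" and u :: "real^2 \<Rightarrow> real"
  assumes "equilateral q"
    and "subcritical_growth q c"
    and "\<forall>x\<in>SG q. u x = (\<Sum>k\<in>UNIV. \<Sum>j. c j $ k * monomial q l j k x)"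
  shows "has_power_series q l c u \<and>
    (\<exists>c'. (\<forall>j'. (\<lambda>j. c (j + j') v* Mmat q j) sums c' j') \<and>
          subcritical_growth q c' \<and> has_power_series q (l + 1) c' u) \<and>
    (\<exists>c'. (\<forall>j'. (\<lambda>j. c (j + j') v* Mtilde q j) sums c' j') \<and>
          subcritical_growth q c' \<and> has_power_series q (l - 1) c' u)"
proof -
  interpret gasket q by unfold_locales (rule assms(1))
  have u: "u x = (\<Sum>k\<in>UNIV. \<Sum>j. c j $ k * monomial q l j k x)" if "x \<in> SG q" for x
    using assms(3) that by blast
  show ?thesis
    using expansion_summable[OF assms(2) u]
      expansion_change[OF assms(2) u, of "Mmat q" "l + 1"] expansion_change[OF assms(2) u, of "Mtilde q" "l - 1"]
    by (simp add: jet_next jet_prev Mmat_nth Mtilde_nth)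
qed

end
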